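(* Let $p(a,x)$ be a $d\times d$ matrix-valued hermitian free polynomial in the freely noncommuting hermitian variables $a=(a_1,\dots,a_\mu)$, $x=(x_1,\dots,x_\mu)$. If $p(a,x)$ is convex in $x$, then there exist a $d\times d$ matrix-valued hermitian linear in $x$ pencil $L$, a positive integer $N$ and an $N\times d$ matrix-valued free polynomial $\Lambda$ that is linear in $x$ such that $$p(a,x)=L(a,x)+\Lambda(a,x)^*\Lambda(a,x).$$ In particular, $p$ has degree at most two in $x$, and $\mathcal D_{-p}=\{(A,X): p(A,X)\preceq 0\}$ is the feasible set of the affine linear in $x$ matrix inequality $$\begin{pmatrix} I & \Lambda(a,x)\\ \Lambda(a,x)^* & -L(a,x)\end{pmatrix}\succeq 0,$$ that is, for all $n$ and all $(A,X)\in\mathbb S_n(\mathbb C^\mu)\times\mathbb S_n(\mathbb C^\mu)$, $p(A,X)\preceq 0$ if and only if this block matrix evaluated at $(A,X)$ is positive semidefinite. Conversely, if $p=L+\Lambda^*\Lambda$ for some such $L$ and $\Lambda$, then $p$ is convex in $x$.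
   Context: $\mathbb S_n(\mathbb C^\mu)$ denotes the set of $\mu$-tuples of $n\times n$ complex hermitian matrices. For a hermitian matrix $T$, $T\succeq 0$ means $T$ is positive semidefinite, and $S\preceq T$ means $T-S\succeq 0$. Free polynomials: an $N\times d$ matrix-valued free polynomial is a finite sum $p=\sum_w p_w w$ over words $w$ (including the empty word) in the freely noncommuting variables $a_1,\dots,a_\mu,x_1,\dots,x_\mu$, with $p_w\in M_{N,d}(\mathbb C)$. It is evaluated at $(A,X)\in\mathbb S_n(\mathbb C^\mu)\times\mathbb S_n(\mathbb C^\mu)$ by $p(A,X)=\sum_w p_w\otimes w(A,X)$, where $w(A,X)$ is the product obtained by substituting $A_j$ for $a_j$ and $X_k$ for $x_k$ (the empty word gives $I_n$). The involution is $p^*=\sum_w p_w^* w^*$, where $w^*$ is $w$ with the order of its letters reversed (the variables are fixed by the involution). A $d\times d$ matrix-valued $p$ is hermitian if $p^*=p$. The degree of $p$ in $x$ is the maximal number of occurrences of $x$-letters in a word with nonzero coefficient. A hermitian linear in $x$ pencil is a hermitian free polynomial $L(a,x)$ that is affine linear in $x$ (each word appearing in it contains at most one $x$-letter; there is no restriction on the degree in $a$). A free polynomial is linear in $x$ if each word appearing in it contains exactly one $x$-letter. A $d\times d$ matrix-valued hermitian free polynomial $p(a,x)$ is convex in $x$ if for each positive integer $n$, each $A\in\mathbb S_n(\mathbb C^\mu)$, all $X,Y\in\mathbb S_n(\mathbb C^\mu)$ and each $0<t<1$, $$p(A,tX+(1-t)Y)\preceq t\,p(A,X)+(1-t)\,p(A,Y).$$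 *)

theory Defs
  imports "Jordan_Normal_Form.Schur_Decomposition"
begin

text \<open>Equality with the adjoint forces a matrix to be square.\<close>

definition hermitian_mat :: "complex mat \<Rightarrow> bool" where
  "hermitian_mat T \<longleftrightarrow> mat_adjoint T = T"

definition psd_mat :: "complex mat \<Rightarrow> bool" where
  "psd_mat T \<longleftrightarrow> hermitian_mat T \<and> (\<forall>v \<in> carrier_vec (dim_row T). 0 \<le> (T *\<^sub>v v) \<bullet>c v)"

text \<open>The library order \<open>\<le>\<close> on matrices is entrywise; the order below is the Loewner order.\<close>

definition loewner_le :: "complex mat \<Rightarrow> complex mat \<Rightarrow> bool" (infix \<open>\<preceq>\<close> 50) where
  "S \<preceq> T \<longleftrightarrow> psd_mat (T - S)"

definition herm_tuples :: "nat \<Rightarrow> ('m \<Rightarrow> complex mat) set" where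
  "herm_tuples n = {X. \<forall>j. X j \<in> carrier_mat n n \<and> hermitian_mat (X j)}"

definition kron :: "complex mat \<Rightarrow> complex mat \<Rightarrow> complex mat" (infixl \<open>\<otimes>\<^sub>K\<close> 70) where
  "A \<otimes>\<^sub>K B = mat (dim_row A * dim_row B) (dim_col A * dim_col B)
     (\<lambda>(i, j). A $$ (i div dim_row B, j div dim_col B) * B $$ (i mod dim_row B, j mod dim_col B))"

text \<open>Matrices of all sizes share one type, which therefore is not a monoid and does not admit
  the library's \<open>sum\<close>; the size of the result (needed for an empty sum) is given explicitly.\<close>

definition mat_sum :: "nat \<Rightarrow> nat \<Rightarrow> ('i \<Rightarrow> complex mat) \<Rightarrow> 'i set \<Rightarrow> complex mat" where
  "mat_sum nr nc f I = mat nr nc (\<lambda>ij. \<Sum>k\<in>I. f k $$ ij)"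

text \<open>The letters \<open>a\<^sub>j\<close> and \<open>x\<^sub>j\<close>; the number of variables of each kind is the cardinality
  of the type \<open>'m\<close>.\<close>

datatype 'm letter = Avar 'm | Xvar 'm

text \<open>A free polynomial is represented by its coefficient function \<open>w \<mapsto> p\<^sub>w\<close>.\<close>

type_synonym 'm fpoly = "'m letter list \<Rightarrow> complex mat"

definition fp_supp :: "'m fpoly \<Rightarrow> 'm letter list set" where
  "fp_supp p = {w. p w \<noteq> 0\<^sub>m (dim_row (p w)) (dim_col (p w))}"

definition free_polys :: "nat \<Rightarrow> nat \<Rightarrow> 'm fpoly set" where
  "free_polys N d = {p. (\<forall>w. p w \<in> carrier_mat N d) \<and> finite (fp_supp p)}"

text \<open>All coefficients of an element of \<open>free_polys N d\<close> have the same size, so that \<open>N\<close> and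
  \<open>d\<close> can be read off the coefficient \<open>p []\<close> of the empty word.\<close>

abbreviation fp_rows :: "'m fpoly \<Rightarrow> nat" where
  "fp_rows p \<equiv> dim_row (p [])"

abbreviation fp_cols :: "'m fpoly \<Rightarrow> nat" where
  "fp_cols p \<equiv> dim_col (p [])"

fun letter_eval :: "('m \<Rightarrow> complex mat) \<Rightarrow> ('m \<Rightarrow> complex mat) \<Rightarrow> 'm letter \<Rightarrow> complex mat" where
  "letter_eval A X (Avar j) = A j"
| "letter_eval A X (Xvar j) = X j"

fun word_eval :: "nat \<Rightarrow> ('m \<Rightarrow> complex mat) \<Rightarrow> ('m \<Rightarrow> complex mat) \<Rightarrow> 'm letter list \<Rightarrow> complex mat" where
  "word_eval n A X [] = 1\<^sub>m n"
| "word_eval n A X (l # w) = letter_eval A X l * word_eval n A X w"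

definition fp_eval :: "nat \<Rightarrow> 'm fpoly \<Rightarrow> ('m \<Rightarrow> complex mat) \<Rightarrow> ('m \<Rightarrow> complex mat) \<Rightarrow> complex mat" where
  "fp_eval n p A X =
     mat_sum (fp_rows p * n) (fp_cols p * n) (\<lambda>w. p w \<otimes>\<^sub>K word_eval n A X w) (fp_supp p)"

definition fp_add :: "'m fpoly \<Rightarrow> 'm fpoly \<Rightarrow> 'm fpoly" where
  "fp_add p q = (\<lambda>w. p w + q w)"

definition fp_uminus :: "'m fpoly \<Rightarrow> 'm fpoly" where
  "fp_uminus p = (\<lambda>w. - p w)"

definition fp_mult :: "'m fpoly \<Rightarrow> 'm fpoly \<Rightarrow> 'm fpoly" where
  "fp_mult p q = (\<lambda>w. mat_sum (fp_rows p) (fp_cols q) (\<lambda>(u, v). p u * q v) {(u, v). u @ v = w})"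

definition fp_adjoint :: "'m fpoly \<Rightarrow> 'm fpoly" where
  "fp_adjoint p = (\<lambda>w. mat_adjoint (p (rev w)))"

definition fp_hermitian :: "'m fpoly \<Rightarrow> bool" where
  "fp_hermitian p \<longleftrightarrow> fp_adjoint p = p"

definition fp_one :: "nat \<Rightarrow> 'm fpoly" where
  "fp_one N = (\<lambda>w. if w = [] then 1\<^sub>m N else 0\<^sub>m N N)"

definition fp_block :: "'m fpoly \<Rightarrow> 'm fpoly \<Rightarrow> 'm fpoly \<Rightarrow> 'm fpoly \<Rightarrow> 'm fpoly" where
  "fp_block p q r s = (\<lambda>w. four_block_mat (p w) (q w) (r w) (s w))"

fun is_Xvar :: "'m letter \<Rightarrow> bool" where
  "is_Xvar (Avar j) = False"
| "is_Xvar (Xvar j) = True"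

definition xcount :: "'m letter list \<Rightarrow> nat" where
  "xcount w = length (filter is_Xvar w)"

text \<open>The zero polynomial is given degree \<open>0\<close>.\<close>

definition fp_xdegree :: "'m fpoly \<Rightarrow> nat" where
  "fp_xdegree p = Max (insert 0 (xcount ` fp_supp p))"

definition hermitian_pencils :: "nat \<Rightarrow> 'm fpoly set" where
  "hermitian_pencils d = {L \<in> free_polys d d. fp_hermitian L \<and> (\<forall>w \<in> fp_supp L. xcount w \<le> 1)}"

definition linear_in_x :: "'m fpoly \<Rightarrow> bool" where
  "linear_in_x p \<longleftrightarrow> (\<forall>w \<in> fp_supp p. xcount w = 1)"

definition convex_in_x :: "'m fpoly \<Rightarrow> bool" where
  "convex_in_x p \<longleftrightarrow>
     (\<forall>n > 0. \<forall>A \<in> herm_tuples n. \<forall>X \<in> herm_tuples n. \<forall>Y \<in> herm_tuples n. \<forall>t::real. 0 < t \<and> t < 1 \<longrightarrow>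
        fp_eval n p A (\<lambda>j. complex_of_real t \<cdot>\<^sub>m X j + complex_of_real (1 - t) \<cdot>\<^sub>m Y j)
        \<preceq> complex_of_real t \<cdot>\<^sub>m fp_eval n p A X + complex_of_real (1 - t) \<cdot>\<^sub>m fp_eval n p A Y)"

end

theory Submission
  imports Defs
begin

text \<open>Let \<open>p\<close> be convex in \<open>x\<close>. Then \<open>D(a,x,y) = p(a,x+y) + p(a,x-y) - 2 p(a,x)\<close> is positive
  semidefinite at all hermitian tuples, hence a sum of squares \<open>\<Sum>\<^sub>k \<Lambda>\<^sub>k\<^sup>* \<Lambda>\<^sub>k\<close> by Helton's theorem:
  otherwise the point of the closed cone of sums of squares that is closest to \<open>D\<close> gives a
  separating functional, and after a small perturbation into a strictly positive functional the
  GNS construction turns it into hermitian matrices at which \<open>D\<close> is not positive. As \<open>D\<close> has no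
  terms of degree \<open>0\<close> in \<open>y\<close>, neither have the \<open>\<Lambda>\<^sub>k\<close>. A word of \<open>D\<close> of degree \<open>2\<close> in \<open>y\<close> thus splits
  into two words of degree \<open>1\<close> in \<open>y\<close>; marking the first two letters \<open>x\<close> of a word of \<open>p\<close> as the
  letters \<open>y\<close> shows that the part of \<open>\<Lambda>\<^sub>k\<close> of degree \<open>1\<close> in \<open>y\<close> has degree \<open>0\<close> in \<open>x\<close>. Hence \<open>p\<close> has degree
  at most two in \<open>x\<close>, and its part of degree two is one half of the sum of the squares of these parts.\<close>

section \<open>Positive semidefinite kernels\<close>

text \<open>Marking works because the coefficient of a word of \<open>D\<close> depends only on the
  word of \<open>p\<close> beneath it and on the number of its letters \<open>y\<close>, not on
  which letters are marked. One marking can thus show that a coefficient is nonzero, while another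
  marking of the same word restricts where that word may be cut. The second difference takes the
  place of a Hessian: it needs convexity only at midpoints and no derivative, at the price of
  possible terms of every positive even degree in \<open>y\<close>; only the parts of degree 0 and 2
  are evaluated.

  The obstacle in Helton's theorem is that matrices are finite. Words are truncated at a length
  \<open>K\<close>, so multiplication by a letter leaves the space, and the GNS operators are
  compressions that reproduce the functional on words of length up to \<open>2 * K\<close> only. A
  strictly positive functional is needed twice: it bounds traces, which makes the cone of sums of
  squares closed, and a small multiple of it makes the separating functional definite, so that the
  GNS space has a basis indexed by words and no quotient has to be formed.\<close>

definition kform :: "'i set \<Rightarrow> ('i \<Rightarrow> 'i \<Rightarrow> complex) \<Rightarrow> ('i \<Rightarrow> complex) \<Rightarrow> complex" where
  "kform J G s = (\<Sum>i\<in>J. \<Sum>j\<in>J. cnj (s i) * G i j * s j)"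

text \<open>Kernels over an arbitrary index set stand in for matrices, so that pairs of a word and a
  coordinate serve as indices without an enumeration. Hermitian symmetry is a separate conjunct
  because nonnegativity is asked of the real part only.\<close>

definition psd_kernel :: "'i set \<Rightarrow> ('i \<Rightarrow> 'i \<Rightarrow> complex) \<Rightarrow> bool" where
  "psd_kernel J G \<longleftrightarrow> (\<forall>i\<in>J. \<forall>j\<in>J. G j i = cnj (G i j)) \<and> (\<forall>s. 0 \<le> Re (kform J G s))"

lemma psd_kernel_herm: "psd_kernel J G \<Longrightarrow> i \<in> J \<Longrightarrow> j \<in> J \<Longrightarrow> G j i = cnj (G i j)"
  unfolding psd_kernel_def by blast

lemma psd_kernelI:
  assumes "\<And>i j. i \<in> J \<Longrightarrow> j \<in> J \<Longrightarrow> G j i = cnj (G i j)" "\<And>s. 0 \<le> Re (kform J G s)"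
  shows "psd_kernel J G"
  using assms unfolding psd_kernel_def by blast

lemma kform_supported:
  assumes "finite J" "I \<subseteq> J" "\<And>i. i \<in> J - I \<Longrightarrow> s i = 0"
  shows "kform J G s = kform I G s"
proof -
  have "kform J G s = (\<Sum>i\<in>I. \<Sum>j\<in>J. cnj (s i) * G i j * s j)"
    unfolding kform_def by (rule sum.mono_neutral_right) (use assms in auto)
  also have "\<dots> = kform I G s"
    unfolding kform_def by (intro sum.cong refl sum.mono_neutral_right) (use assms in auto)
  finally show ?thesis .
qed

lemma psd_kernel_mono:
  assumes "finite J" "I \<subseteq> J" "psd_kernel J G"
  shows "psd_kernel I G"
proof -
  have "0 \<le> Re (kform I G s)" for s
  proof -
    have "kform I G s = kform I G (\<lambda>i. if i \<in> I then s i else 0)"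
      unfolding kform_def by (intro sum.cong) auto
    also have "\<dots> = kform J G (\<lambda>i. if i \<in> I then s i else 0)"
      by (rule kform_supported[symmetric]) (use assms in auto)
    finally show ?thesis using assms(3) unfolding psd_kernel_def by metis
  qed
  then show ?thesis using assms unfolding psd_kernel_def by (meson subsetD)
qed

lemma kform_add: "kform J (\<lambda>i j. G i j + H i j) s = kform J G s + kform J H s"
  by (simp add: kform_def sum.distrib algebra_simps)

lemma psd_kernel_add:
  assumes "psd_kernel J G" "psd_kernel J H"
  shows "psd_kernel J (\<lambda>i j. G i j + H i j)"
proof (rule psd_kernelI)
  fix i j assume ij: "i \<in> J" "j \<in> J"
  show "G j i + H j i = cnj (G i j + H i j)"
    using psd_kernel_herm[OF assms(1) ij] psd_kernel_herm[OF assms(2) ij] by simp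
next
  fix s
  show "0 \<le> Re (kform J (\<lambda>i j. G i j + H i j) s)"
    using assms unfolding psd_kernel_def kform_add by simp
qed

lemma psd_kernel_scale:
  assumes "psd_kernel J G" "0 \<le> c"
  shows "psd_kernel J (\<lambda>i j. of_real c * G i j)"
proof (rule psd_kernelI)
  fix i j assume ij: "i \<in> J" "j \<in> J"
  show "of_real c * G j i = cnj (of_real c * G i j)"
    using psd_kernel_herm[OF assms(1) ij] by simp
next
  fix s
  have "kform J (\<lambda>i j. of_real c * G i j) s = of_real c * kform J G s"
    by (simp add: kform_def sum_distrib_left mult_ac)
  then show "0 \<le> Re (kform J (\<lambda>i j. of_real c * G i j) s)"
    using assms by (simp add: psd_kernel_def)
qed

lemma kform_rank_one:
  "kform J (\<lambda>i j. cnj (s i) * s j) x = of_real ((cmod (\<Sum>j\<in>J. s j * x j))\<^sup>2)"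
proof -
  have "kform J (\<lambda>i j. cnj (s i) * s j) x = cnj (\<Sum>j\<in>J. s j * x j) * (\<Sum>j\<in>J. s j * x j)"
    unfolding kform_def cnj_sum sum_product by (intro sum.cong refl) simp
  then show ?thesis using complex_norm_square[of "\<Sum>j\<in>J. s j * x j"]
    by (simp only: mult.commute)
qed

lemma psd_kernel_rank_one: "psd_kernel J (\<lambda>i j. cnj (s i) * s j)"
  by (auto simp: psd_kernel_def kform_rank_one)

lemma kform_insert:
  assumes "finite J" "k \<notin> J"
  shows "kform (insert k J) G s = kform J G s + cnj (s k) * G k k * s k
    + cnj (s k) * (\<Sum>j\<in>J. G k j * s j) + (\<Sum>i\<in>J. cnj (s i) * G i k) * s k"
  using assms by (simp add: kform_def sum.distrib sum_distrib_left sum_distrib_right algebra_simps)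

lemma psd_kernel_diag:
  assumes "finite J" "psd_kernel J G" "i \<in> J"
  shows "0 \<le> Re (G i i)" "Im (G i i) = 0"
proof -
  have "psd_kernel {i} G" using psd_kernel_mono[of J "{i}"] assms by auto
  then have "0 \<le> Re (kform {i} G (\<lambda>_. 1))" unfolding psd_kernel_def by blast
  then show "0 \<le> Re (G i i)" by (simp add: kform_def)
  have "G i i = cnj (G i i)" using psd_kernel_herm[OF assms(2)] assms(3) by blast
  then show "Im (G i i) = 0" by (auto simp: complex_eq_iff)
qed

text \<open>With a zero diagonal entry at \<open>i\<close>, the form at the vector with entries
  \<open>- t * G i j\<close> at \<open>i\<close> and 1 at \<open>j\<close> is affine in
  \<open>t\<close> with slope \<open>- 2 * (cmod (G i j))^2\<close>. It can stay nonnegative for all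
  \<open>t\<close> only if the slope is zero.\<close>

lemma psd_kernel_null_diag:
  assumes "finite J" "psd_kernel J G" "i \<in> J" "j \<in> J" "G i i = 0"
  shows "G i j = 0"
proof (cases "i = j")
  case False
  let ?r = "Re (G j j)"
  have psd: "psd_kernel {i, j} G" using psd_kernel_mono[of J "{i,j}"] assms by auto
  have h: "G j i = cnj (G i j)" using psd_kernel_herm[OF assms(2)] assms by blast
  have "0 \<le> ?r - 2 * t * (cmod (G i j))\<^sup>2" for t :: real
  proof -
    define s where "s = (\<lambda>k. if k = i then - of_real t * G i j else (1::complex))"
    have "0 \<le> Re (kform {i, j} G s)" using psd unfolding psd_kernel_def by blast
    also have "kform {i, j} G s = G j j - 2 * of_real t * (G i j * cnj (G i j))"
      using False h by (simp add: kform_def s_def assms(5) algebra_simps)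
    also have "G i j * cnj (G i j) = of_real ((cmod (G i j))\<^sup>2)"
      by (simp only: complex_norm_square)
    finally show ?thesis by simp
  qed
  from this[of "(?r + 1) / (2 * (cmod (G i j))\<^sup>2)"] have "cmod (G i j) = 0"
    by (cases "cmod (G i j) = 0") (auto simp: field_simps)
  then show ?thesis by simp
qed (use assms in auto)

text \<open>Each step of the induction splits off one rank one kernel, as in a Cholesky decomposition.\<close>

lemma psd_kernel_factorization:
  assumes "finite J" "psd_kernel J G"
  shows "\<exists>\<rho>. \<forall>i\<in>J. \<forall>j\<in>J. G i j = (\<Sum>k<card J. cnj (\<rho> k i) * \<rho> k j)"
  using assms
proof (induction J arbitrary: G rule: finite_induct)
  case empty
  then show ?case by auto
next
  case (insert m J)
  \<comment> \<open>If \<open>G m m = 0\<close>, division by zero makes \<open>r\<close> the zero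
    function and nothing is split off; row \<open>m\<close> of \<open>G\<close> then vanishes anyway
    by \<open>psd_kernel_null_diag\<close>.\<close>
  define r where "r = (\<lambda>j. G m j / of_real (sqrt (Re (G m m))))"
  define G' where "G' = (\<lambda>i j. G i j - cnj (r i) * r j)"
  have fin: "finite (insert m J)" using insert by auto
  note d = psd_kernel_diag[OF fin insert.prems insertI1]
  have herm: "G j i = cnj (G i j)" if "i \<in> insert m J" "j \<in> insert m J" for i j
    using psd_kernel_herm[OF insert.prems] that by blast
  have Gm: "G m m = of_real (Re (G m m))" using d by (simp add: complex_eq_iff)
  have rm: "cnj (r m) * r j = G m j" if j: "j \<in> insert m J" for j
  proof (cases "Re (G m m) = 0")
    case True
    then have "G m m = 0" using Gm by simp
    then have "G m j = 0" using psd_kernel_null_diag[OF fin insert.prems insertI1 j] by simp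
    then show ?thesis using True by (simp add: r_def)
  next
    case False
    then have "0 < Re (G m m)" using d by simp
    then show ?thesis unfolding r_def by (subst Gm) (simp add: field_simps flip: of_real_mult)
  qed
  have rm': "cnj (r j) * r m = G j m" if j: "j \<in> insert m J" for j
    using arg_cong[OF rm[OF j], of cnj] herm[OF insertI1 j] by (simp add: mult.commute)
  have "psd_kernel J G'"
  proof (rule psd_kernelI)
    fix i j assume "i \<in> J" "j \<in> J"
    then show "G' j i = cnj (G' i j)" using herm[of i j] by (simp add: G'_def)
  next
    fix s
    show "0 \<le> Re (kform J G' s)"
    proof (cases "Re (G m m) = 0")
      case True
      then have "G' = G" by (simp add: G'_def r_def)
      moreover have "psd_kernel J G" using psd_kernel_mono[OF fin subset_insertI insert.prems] .
      ultimately show ?thesis unfolding psd_kernel_def by simp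
    next
      case False
      then have g0: "r m \<noteq> 0" using rm[of m] Gm by auto
      define S where "S = (\<Sum>j\<in>J. r j * s j)"
      \<comment> \<open>The entry at \<open>m\<close> is chosen so that the rank one part vanishes
        on \<open>s'\<close>. The value of \<open>G'\<close> at \<open>s\<close> is then the value
        of \<open>G\<close> at \<open>s'\<close>.\<close>
      define s' where "s' = (\<lambda>j. if j = m then - S / r m else s j)"
      have "S + r m * s' m = 0" using g0 by (simp add: s'_def)
      moreover have SJ: "(\<Sum>j\<in>J. r j * s' j) = S" unfolding S_def s'_def
        by (intro sum.cong) (use insert in auto)
      ultimately have S0: "(\<Sum>j\<in>insert m J. r j * s' j) = 0"
        using insert by (simp add: add.commute)
      have "kform (insert m J) G s' = kform (insert m J) G' s'
          + kform (insert m J) (\<lambda>i j. cnj (r i) * r j) s'"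
        by (simp add: G'_def flip: kform_add)
      also have "kform (insert m J) (\<lambda>i j. cnj (r i) * r j) s' = 0"
        unfolding kform_rank_one S0 by simp
      also have "kform (insert m J) G' s' = kform J G' s'"
        unfolding kform_insert[OF insert(1,2)] using rm rm' by (simp add: G'_def)
      also have "kform J G' s' = kform J G' s"
        unfolding kform_def s'_def by (intro sum.cong) (use insert in auto)
      finally show ?thesis using insert.prems unfolding psd_kernel_def by (metis add.right_neutral)
    qed
  qed
  from insert.IH[OF this] obtain \<rho> where
    \<rho>: "\<And>i j. i \<in> J \<Longrightarrow> j \<in> J \<Longrightarrow> G' i j = (\<Sum>k<card J. cnj (\<rho> k i) * \<rho> k j)" by blast
  \<comment> \<open>Row and column \<open>m\<close> of \<open>G'\<close> are zero, so the vectors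
    from the induction hypothesis are extended by 0 at \<open>m\<close>.\<close>
  define \<rho>' where "\<rho>' = (\<lambda>k i. if k = card J then r i else if i = m then 0 else \<rho> k i)"
  have "G i j = (\<Sum>k<card (insert m J). cnj (\<rho>' k i) * \<rho>' k j)"
    if ij: "i \<in> insert m J" "j \<in> insert m J" for i j
  proof -
    have "(\<Sum>k<card J. cnj (\<rho>' k i) * \<rho>' k j) = G' i j"
    proof (cases "i = m \<or> j = m")
      case True
      then have "G' i j = 0" using rm rm' ij by (auto simp: G'_def)
      then show ?thesis using True by (auto simp: \<rho>'_def)
    next
      case False
      then show ?thesis using \<rho> ij by (auto simp: \<rho>'_def)
    qed
    then show ?thesis using insert by (simp add: \<rho>'_def G'_def)
  qed
  then show ?case by blast
qed

text \<open>\<open>\<rho>\<close> consists of the columns of \<open>R\<close> with \<open>G = R\<^sup>* R\<close>, and \<open>\<sigma>\<close> is the dual basis.\<close>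

lemma pd_kernel_basis:
  assumes "finite J" "psd_kernel J G"
    and pd: "\<And>s. kform J G s = 0 \<Longrightarrow> \<forall>i\<in>J. s i = 0"
  obtains \<rho> \<sigma> :: "nat \<Rightarrow> 'i \<Rightarrow> complex"
  where "\<And>i j. i \<in> J \<Longrightarrow> j \<in> J \<Longrightarrow> G i j = (\<Sum>k<card J. cnj (\<rho> k i) * \<rho> k j)"
    and "\<And>i j. i \<in> J \<Longrightarrow> j \<in> J \<Longrightarrow> (\<Sum>k<card J. cnj (\<sigma> k i) * \<rho> k j) = (if i = j then 1 else 0)"
    and "\<And>k l. k < card J \<Longrightarrow> l < card J \<Longrightarrow> (\<Sum>i\<in>J. \<rho> k i * cnj (\<sigma> l i)) = (if k = l then 1 else 0)"
proof -
  obtain \<rho> where \<rho>: "\<And>i j. i \<in> J \<Longrightarrow> j \<in> J \<Longrightarrow> G i j = (\<Sum>k<card J. cnj (\<rho> k i) * \<rho> k j)"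
    using psd_kernel_factorization[OF assms(1,2)] by blast
  define n where "n = card J"
  obtain e where e: "bij_betw e {..<n} J"
    using ex_bij_betw_nat_finite[OF assms(1)] by (auto simp: n_def atLeast0LessThan)
  define e' where "e' = the_inv_into {..<n} e"
  have e': "bij_betw e' J {..<n}" unfolding e'_def by (rule bij_betw_the_inv_into[OF e])
  have e'e: "e' (e k) = k" if "k < n" for k
    using that e unfolding e'_def by (auto simp: the_inv_into_f_f bij_betw_def)
  have ee': "e (e' i) = i" if "i \<in> J" for i
    using that e unfolding e'_def by (auto simp: f_the_inv_into_f bij_betw_def)
  \<comment> \<open>A square matrix, because the factorization uses exactly \<open>card J\<close>
    vectors; hence a trivial null space yields a two-sided inverse.\<close>
  define R where "R = mat n n (\<lambda>(k, m). \<rho> k (e m))"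
  have R: "R \<in> carrier_mat n n" by (simp add: R_def)
  have "det R \<noteq> 0"
  proof
    assume "det R = 0"
    then obtain v where v: "v \<in> carrier_vec n" "v \<noteq> 0\<^sub>v n" "R *\<^sub>v v = 0\<^sub>v n"
      using det_0_iff_vec_prod_zero[OF R] by auto
    define s where "s = (\<lambda>i. v $ e' i)"
    have z: "(\<Sum>i\<in>J. \<rho> k i * s i) = 0" if "k < n" for k
    proof -
      have "0 = (R *\<^sub>v v) $ k" using v that by simp
      also have "\<dots> = (\<Sum>m<n. \<rho> k (e m) * v $ m)"
        using that v(1) by (simp add: R_def scalar_prod_def atLeast0LessThan)
      also have "\<dots> = (\<Sum>m<n. \<rho> k (e m) * s (e m))" using e'e by (simp add: s_def)
      also have "\<dots> = (\<Sum>i\<in>J. \<rho> k i * s i)" by (rule sum.reindex_bij_betw[OF e])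
      finally show ?thesis by simp
    qed
    have "kform J G s = (\<Sum>i\<in>J. \<Sum>j\<in>J. \<Sum>k<n. cnj (\<rho> k i * s i) * (\<rho> k j * s j))"
      unfolding kform_def by (intro sum.cong refl)
        (simp add: \<rho> sum_distrib_left sum_distrib_right mult_ac flip: n_def)
    also have "\<dots> = (\<Sum>i\<in>J. \<Sum>k<n. \<Sum>j\<in>J. cnj (\<rho> k i * s i) * (\<rho> k j * s j))"
      by (intro sum.cong refl sum.swap)
    also have "\<dots> = (\<Sum>k<n. \<Sum>i\<in>J. \<Sum>j\<in>J. cnj (\<rho> k i * s i) * (\<rho> k j * s j))"
      by (rule sum.swap)
    also have "\<dots> = (\<Sum>k<n. cnj (\<Sum>i\<in>J. \<rho> k i * s i) * (\<Sum>j\<in>J. \<rho> k j * s j))"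
      by (simp add: sum_product)
    also have "\<dots> = 0" using z by simp
    finally have "\<forall>i\<in>J. s i = 0" using pd by blast
    then have "v $ m = 0" if "m < n" for m
      using that e e'e by (auto simp: s_def bij_betw_def)
    then have "v = 0\<^sub>v n" using v(1) by (intro eq_vecI) auto
    then show False using v by simp
  qed
  then obtain S where S: "S \<in> carrier_mat n n" "S * R = 1\<^sub>m n" "R * S = 1\<^sub>m n"
    using det_non_zero_imp_unit[OF R, of "()"] unfolding Units_def ring_mat_def by auto
  \<comment> \<open>Conjugated entries of the inverse \<open>S\<close>; \<open>S * R = 1\<close> and
    \<open>R * S = 1\<close> become the two duality relations.\<close>
  define \<sigma> where "\<sigma> = (\<lambda>k i. cnj (S $$ (e' i, k)))"
  have "(\<Sum>k<n. cnj (\<sigma> k i) * \<rho> k j) = (if i = j then 1 else 0)" if "i \<in> J" "j \<in> J" for i j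
  proof -
    have b: "e' i < n" "e' j < n" using e' that by (auto simp: bij_betw_def)
    have "(S * R) $$ (e' i, e' j) = (\<Sum>k<n. S $$ (e' i, k) * R $$ (k, e' j))"
      using S(1) R b by (simp add: scalar_prod_def atLeast0LessThan)
    also have "\<dots> = (\<Sum>k<n. cnj (\<sigma> k i) * \<rho> k j)"
      using b that ee' by (simp add: \<sigma>_def R_def)
    finally have "(\<Sum>k<n. cnj (\<sigma> k i) * \<rho> k j) = (if e' i = e' j then 1 else 0)"
      using S(2) b by simp
    then show ?thesis using that ee' by (metis (full_types))
  qed
  moreover have "(\<Sum>i\<in>J. \<rho> k i * cnj (\<sigma> l i)) = (if k = l then 1 else 0)" if "k < n" "l < n" for k l
  proof -
    have "(R * S) $$ (k, l) = (\<Sum>m<n. R $$ (k, m) * S $$ (m, l))"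
      using S(1) R that by (simp add: scalar_prod_def atLeast0LessThan)
    also have "\<dots> = (\<Sum>m<n. \<rho> k (e m) * cnj (\<sigma> l (e m)))"
      using that e'e by (simp add: \<sigma>_def R_def)
    also have "\<dots> = (\<Sum>i\<in>J. \<rho> k i * cnj (\<sigma> l i))" by (rule sum.reindex_bij_betw[OF e])
    finally show ?thesis using S(3) that by simp
  qed
  ultimately show ?thesis using that[OF \<rho>, of \<sigma>] unfolding n_def by blast
qed

section \<open>Separation from the cone of images of positive kernels\<close>

lemma finite_bounded_subseq_real:
  fixes f :: "nat \<Rightarrow> 'c \<Rightarrow> real"
  assumes "finite I" "\<And>n i. i \<in> I \<Longrightarrow> \<bar>f n i\<bar> \<le> B"
  shows "\<exists>r. strict_mono (r :: nat \<Rightarrow> nat) \<and> (\<forall>i\<in>I. convergent (\<lambda>n. f (r n) i))"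
  using assms
proof (induction I rule: finite_induct)
  case empty
  then show ?case by (auto intro: exI[of _ id] simp: strict_mono_def)
next
  case (insert i I)
  then obtain r :: "nat \<Rightarrow> nat" where r: "strict_mono r" "\<And>j. j \<in> I \<Longrightarrow> convergent (\<lambda>n. f (r n) j)"
    by auto
  \<comment> \<open>A monotone subsequence for the new coordinate; the coordinates treated before
    keep converging along it.\<close>
  obtain g :: "nat \<Rightarrow> nat" where g: "strict_mono g" "monoseq (\<lambda>n. f (r (g n)) i)"
    using seq_monosub[of "\<lambda>n. f (r n) i"] by auto
  have "Bseq (\<lambda>n. f (r (g n)) i)"
    using insert.prems[of i] by (intro BseqI'[of _ B]) auto
  then have "convergent (\<lambda>n. f (r (g n)) i)" using g Bseq_monoseq_convergent by blast
  moreover have "convergent (\<lambda>n. f (r (g n)) j)" if "j \<in> I" for j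
    using convergent_subseq_convergent[OF r(2)[OF that] g(1)] by (simp add: o_def)
  ultimately show ?case using strict_mono_o[OF r(1) g(1)]
    by (intro exI[of _ "r \<circ> g"]) (auto simp: o_def)
qed

lemma finite_bounded_subseq:
  fixes f :: "nat \<Rightarrow> 'c \<Rightarrow> complex"
  assumes "finite I" "\<And>n i. i \<in> I \<Longrightarrow> cmod (f n i) \<le> B"
  obtains r g where "strict_mono (r :: nat \<Rightarrow> nat)" "\<And>i. i \<in> I \<Longrightarrow> (\<lambda>n. f (r n) i) \<longlonglongrightarrow> g i"
proof -
  define h where "h = (\<lambda>n (i, b). if b then Re (f n i) else Im (f n i))"
  have "\<bar>h n p\<bar> \<le> B" if "p \<in> I \<times> UNIV" for n p
    using assms(2)[of "fst p" n] abs_Re_le_cmod[of "f n (fst p)"] abs_Im_le_cmod[of "f n (fst p)"] that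
    by (auto simp: h_def split: prod.splits)
  then obtain r :: "nat \<Rightarrow> nat" where r: "strict_mono r"
    "\<And>p. p \<in> I \<times> UNIV \<Longrightarrow> convergent (\<lambda>n. h (r n) p)"
    using finite_bounded_subseq_real[of "I \<times> UNIV" h B] assms(1) by auto
  have "\<exists>l. (\<lambda>n. f (r n) i) \<longlonglongrightarrow> l" if i: "i \<in> I" for i
  proof -
    obtain a where "(\<lambda>n. Re (f (r n) i)) \<longlonglongrightarrow> a"
      using r(2)[of "(i, True)"] i unfolding h_def convergent_def by auto
    moreover obtain b where "(\<lambda>n. Im (f (r n) i)) \<longlonglongrightarrow> b"
      using r(2)[of "(i, False)"] i unfolding h_def convergent_def by auto
    ultimately have "(\<lambda>n. f (r n) i) \<longlonglongrightarrow> Complex a b" by (simp add: tendsto_complex_iff)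
    then show ?thesis by blast
  qed
  then obtain g where "\<And>i. i \<in> I \<Longrightarrow> (\<lambda>n. f (r n) i) \<longlonglongrightarrow> g i" by metis
  with r(1) that show ?thesis by blast
qed

text \<open>The map from Gram matrices to polynomials: if \<open>\<pi> i j\<close> is the product of
  the adjoint of the word \<open>i\<close> with the word \<open>j\<close>, this is the coefficient
  at \<open>t\<close> of the sum of all these products with weights \<open>G i j\<close>.\<close>

definition kpush :: "'i set \<Rightarrow> ('i \<Rightarrow> 'i \<Rightarrow> 't) \<Rightarrow> ('i \<Rightarrow> 'i \<Rightarrow> complex) \<Rightarrow> 't \<Rightarrow> complex" where
  "kpush J \<pi> G t = (\<Sum>i\<in>J. \<Sum>j\<in>J. if \<pi> i j = t then G i j else 0)"

lemma kpush_add: "kpush J \<pi> (\<lambda>i j. G i j + H i j) t = kpush J \<pi> G t + kpush J \<pi> H t"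
proof -
  have "(if b then x + y else 0) = (if b then x else 0) + (if b then y else (0::complex))" for b x y
    by simp
  then show ?thesis by (simp add: kpush_def sum.distrib)
qed

lemma kpush_scale: "kpush J \<pi> (\<lambda>i j. c * G i j) t = c * kpush J \<pi> G t"
proof -
  have "(if b then c * x else 0) = c * (if b then x else (0::complex))" for b x
    by simp
  then show ?thesis by (simp add: kpush_def sum_distrib_left)
qed

text \<open>Duality: a functional \<open>r\<close> on coefficients pulls back along
  \<open>\<pi>\<close> to a kernel that pairs with Gram matrices. Positivity of \<open>r\<close> on
  squares is positivity of that kernel.\<close>

lemma kpush_pairing:
  assumes "finite T" "\<And>i j. i \<in> J \<Longrightarrow> j \<in> J \<Longrightarrow> \<pi> i j \<in> T"
  shows "(\<Sum>t\<in>T. kpush J \<pi> G t * r t) = (\<Sum>i\<in>J. \<Sum>j\<in>J. G i j * r (\<pi> i j))"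
proof -
  have "(\<Sum>t\<in>T. kpush J \<pi> G t * r t) = (\<Sum>t\<in>T. \<Sum>i\<in>J. \<Sum>j\<in>J. if \<pi> i j = t then G i j * r t else 0)"
    by (simp add: kpush_def sum_distrib_right if_distribR cong: if_cong)
      (intro sum.cong refl, simp)
  also have "\<dots> = (\<Sum>i\<in>J. \<Sum>t\<in>T. \<Sum>j\<in>J. if \<pi> i j = t then G i j * r t else 0)"
    by (rule sum.swap)
  also have "\<dots> = (\<Sum>i\<in>J. \<Sum>j\<in>J. \<Sum>t\<in>T. if \<pi> i j = t then G i j * r t else 0)"
    by (intro sum.cong refl sum.swap)
  also have "\<dots> = (\<Sum>i\<in>J. \<Sum>j\<in>J. G i j * r (\<pi> i j))"
    using assms by (intro sum.cong refl) (simp add: sum.delta')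
  finally show ?thesis .
qed

section \<open>Trace estimates and closest points of the cone\<close>

lemma psd_kernel_trace_bound:
  assumes "finite J" "psd_kernel J G" "i \<in> J" "j \<in> J"
  shows "cmod (G i j) \<le> (\<Sum>k\<in>J. Re (G k k))"
proof -
  obtain \<rho> where \<rho>: "\<And>i j. i \<in> J \<Longrightarrow> j \<in> J \<Longrightarrow> G i j = (\<Sum>k<card J. cnj (\<rho> k i) * \<rho> k j)"
    using psd_kernel_factorization[OF assms(1,2)] by blast
  have d: "Re (G k k) = (\<Sum>l<card J. (cmod (\<rho> l k))\<^sup>2)" if "k \<in> J" for k
    using \<rho>[OF that that] by (simp add: cmod_def power2_eq_square)
  have "cmod (G i j) \<le> (\<Sum>l<card J. cmod (\<rho> l i) * cmod (\<rho> l j))"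
    unfolding \<rho>[OF assms(3,4)] by (rule order_trans[OF norm_sum]) (simp add: norm_mult)
  also have "\<dots> \<le> (\<Sum>l<card J. ((cmod (\<rho> l i))\<^sup>2 + (cmod (\<rho> l j))\<^sup>2) / 2)"
  proof (rule sum_mono)
    fix l
    show "cmod (\<rho> l i) * cmod (\<rho> l j) \<le> ((cmod (\<rho> l i))\<^sup>2 + (cmod (\<rho> l j))\<^sup>2) / 2"
      using sum_squares_bound[of "cmod (\<rho> l i)" "cmod (\<rho> l j)"] by simp
  qed
  also have "\<dots> = (Re (G i i) + Re (G j j)) / 2"
    using assms by (simp add: d sum.distrib flip: sum_divide_distrib)
  \<comment> \<open>Each of the two entries is at most the trace, so their mean is too, also when
    \<open>i = j\<close>.\<close>
  also have "\<dots> \<le> (\<Sum>k\<in>J. Re (G k k))"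
    using member_le_sum[of i J "\<lambda>k. Re (G k k)"] member_le_sum[of j J "\<lambda>k. Re (G k k)"]
      psd_kernel_diag[OF assms(1,2)] assms by fastforce
  finally show ?thesis .
qed

text \<open>\<open>G\<close> is a sum of rank one kernels; the lower bound on the form of
  \<open>L\<close>, applied to each of them, adds up to a multiple of the trace.\<close>

lemma psd_kernel_pairing_trace:
  assumes "finite J" "psd_kernel J G"
    and L: "\<And>s. c * (\<Sum>i\<in>J. (cmod (s i))\<^sup>2) \<le> Re (kform J L s)"
  shows "c * (\<Sum>k\<in>J. Re (G k k)) \<le> Re (\<Sum>i\<in>J. \<Sum>j\<in>J. G i j * L i j)"
proof -
  obtain \<rho> where \<rho>: "\<And>i j. i \<in> J \<Longrightarrow> j \<in> J \<Longrightarrow> G i j = (\<Sum>k<card J. cnj (\<rho> k i) * \<rho> k j)"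
    using psd_kernel_factorization[OF assms(1,2)] by blast
  have d: "Re (G k k) = (\<Sum>l<card J. (cmod (\<rho> l k))\<^sup>2)" if "k \<in> J" for k
    using \<rho>[OF that that] by (simp add: cmod_def power2_eq_square)
  have "c * (\<Sum>k\<in>J. Re (G k k)) = c * (\<Sum>l<card J. \<Sum>k\<in>J. (cmod (\<rho> l k))\<^sup>2)"
    by (subst sum.swap) (simp add: d)
  also have "\<dots> \<le> (\<Sum>l<card J. Re (kform J L (\<rho> l)))"
    using L by (subst sum_distrib_left) (rule sum_mono)
  also have "\<dots> = Re (\<Sum>l<card J. kform J L (\<rho> l))" by simp
  also have "(\<Sum>l<card J. kform J L (\<rho> l))
      = (\<Sum>i\<in>J. \<Sum>l<card J. \<Sum>j\<in>J. cnj (\<rho> l i) * L i j * \<rho> l j)"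
    unfolding kform_def by (rule sum.swap)
  also have "\<dots> = (\<Sum>i\<in>J. \<Sum>j\<in>J. \<Sum>l<card J. cnj (\<rho> l i) * L i j * \<rho> l j)"
    by (intro sum.cong refl sum.swap)
  also have "\<dots> = (\<Sum>i\<in>J. \<Sum>j\<in>J. G i j * L i j)"
    by (intro sum.cong refl) (simp add: \<rho> sum_distrib_left sum_distrib_right mult_ac)
  finally show ?thesis .
qed

lemma psd_kernel_limit:
  assumes "finite J" "\<And>n. psd_kernel J (G n)"
    and lim: "\<And>i j. i \<in> J \<Longrightarrow> j \<in> J \<Longrightarrow> (\<lambda>n. G n i j) \<longlonglongrightarrow> H i j"
  shows "psd_kernel J H"
proof (rule psd_kernelI)
  fix i j assume ij: "i \<in> J" "j \<in> J"
  have "(\<lambda>n. G n j i) = (\<lambda>n. cnj (G n i j))"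
    using psd_kernel_herm[OF assms(2) ij] by auto
  then have "(\<lambda>n. G n j i) \<longlonglongrightarrow> cnj (H i j)"
    using tendsto_cnj[OF lim[OF ij]] by simp
  then show "H j i = cnj (H i j)" using lim[OF ij(2,1)] LIMSEQ_unique by blast
next
  fix s
  have "(\<lambda>n. Re (kform J (G n) s)) \<longlonglongrightarrow> Re (kform J H s)"
    unfolding kform_def by (intro tendsto_intros lim)
  moreover have "0 \<le> Re (kform J (G n) s)" for n
    using assms(2) unfolding psd_kernel_def by blast
  ultimately show "0 \<le> Re (kform J H s)" by (intro LIMSEQ_le_const) auto
qed

text \<open>The functional \<open>L\<close> bounds the trace of \<open>G\<close> by its image, so minimising sequences converge.\<close>

lemma kpush_closest_exists:
  assumes fin: "finite J" "finite T" and \<pi>: "\<And>i j. i \<in> J \<Longrightarrow> j \<in> J \<Longrightarrow> \<pi> i j \<in> T"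
    and c: "0 < c" and L: "\<And>s. c * (\<Sum>i\<in>J. (cmod (s i))\<^sup>2) \<le> Re (kform J (\<lambda>i j. L (\<pi> i j)) s)"
  obtains G where "psd_kernel J G"
    "\<And>G'. psd_kernel J G' \<Longrightarrow>
      (\<Sum>t\<in>T. (cmod (kpush J \<pi> G t - q t))\<^sup>2) \<le> (\<Sum>t\<in>T. (cmod (kpush J \<pi> G' t - q t))\<^sup>2)"
proof -
  define F where "F = (\<lambda>G. \<Sum>t\<in>T. (cmod (kpush J \<pi> G t - q t))\<^sup>2)"
  have F0: "0 \<le> F G" for G by (simp add: F_def sum_nonneg)
  define m where "m = Inf (F ` {G. psd_kernel J G})"
  have bdd: "bdd_below (F ` {G. psd_kernel J G})" using F0 by (intro bdd_belowI[of _ 0]) auto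
  have mle: "m \<le> F G" if "psd_kernel J G" for G
    unfolding m_def using that by (intro cInf_lower bdd) auto
  have "psd_kernel J (\<lambda>_ _. 0)" by (rule psd_kernelI) (auto simp: kform_def)
  then have ne: "F ` {G. psd_kernel J G} \<noteq> {}" by auto
  have "\<exists>G. psd_kernel J G \<and> F G < m + 1 / real (Suc n)" for n
    using cInf_lessD[OF ne, of "m + 1 / real (Suc n)"] by (auto simp: m_def)
  then obtain G where G: "\<And>n. psd_kernel J (G n)" "\<And>n. F (G n) < m + 1 / real (Suc n)" by metis
  \<comment> \<open>Along the minimising sequence every coordinate of the image is within
    \<open>sqrt (m + 1)\<close> of \<open>q\<close>, so the pairing of the image with
    \<open>L\<close>, and with it the trace, is bounded by this constant.\<close>
  define B where "B = (\<Sum>t\<in>T. (cmod (q t) + sqrt (m + 1)) * cmod (L t)) / c"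
  have bound: "cmod (G n i j) \<le> B" if "i \<in> J" "j \<in> J" for n i j
  proof -
    have "F (G n) \<le> m + 1" using G(2)[of n] by (rule less_imp_le[OF less_le_trans]) simp
    have p: "cmod (kpush J \<pi> (G n) t) \<le> cmod (q t) + sqrt (m + 1)" if "t \<in> T" for t
    proof -
      have "(cmod (kpush J \<pi> (G n) t - q t))\<^sup>2 \<le> F (G n)"
        unfolding F_def using that fin
        by (intro member_le_sum[of t T "\<lambda>t. (cmod (kpush J \<pi> (G n) t - q t))\<^sup>2"]) auto
      also note \<open>F (G n) \<le> m + 1\<close>
      finally have "cmod (kpush J \<pi> (G n) t - q t) \<le> sqrt (m + 1)"
        using real_le_rsqrt by blast
      then show ?thesis using norm_triangle_sub[of "kpush J \<pi> (G n) t" "q t"] by simp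
    qed
    have "c * (\<Sum>k\<in>J. Re (G n k k)) \<le> Re (\<Sum>i\<in>J. \<Sum>j\<in>J. G n i j * L (\<pi> i j))"
      by (rule psd_kernel_pairing_trace[OF fin(1) G(1) L])
    also have "\<dots> = Re (\<Sum>t\<in>T. kpush J \<pi> (G n) t * L t)"
      using kpush_pairing[where J = J and \<pi> = \<pi> and T = T and G = "G n" and r = L] fin \<pi> by simp
    also have "\<dots> \<le> (\<Sum>t\<in>T. cmod (kpush J \<pi> (G n) t * L t))"
      by (rule order_trans[OF complex_Re_le_cmod norm_sum])
    also have "\<dots> \<le> (\<Sum>t\<in>T. (cmod (q t) + sqrt (m + 1)) * cmod (L t))"
      by (rule sum_mono) (simp add: norm_mult mult_right_mono p)
    finally have "(\<Sum>k\<in>J. Re (G n k k)) \<le> B" using c by (simp add: B_def field_simps)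
    then show ?thesis using psd_kernel_trace_bound[OF fin(1) G(1) that, of n] by linarith
  qed
  obtain r g where r: "strict_mono (r :: nat \<Rightarrow> nat)"
    and g: "\<And>p. p \<in> J \<times> J \<Longrightarrow> (\<lambda>n. (\<lambda>n (i, j). G n i j) (r n) p) \<longlonglongrightarrow> g p"
    by (rule finite_bounded_subseq[of "J \<times> J" "\<lambda>n (i, j). G n i j" B]) (use fin bound in auto)
  define H where "H = (\<lambda>i j. g (i, j))"
  have H: "(\<lambda>n. G (r n) i j) \<longlonglongrightarrow> H i j" if "i \<in> J" "j \<in> J" for i j
    using g[of "(i, j)"] that by (simp add: H_def)
  have psdH: "psd_kernel J H"
    using psd_kernel_limit[OF fin(1), of "\<lambda>n. G (r n)" H] G(1) H by blast
  have "(\<lambda>n. kpush J \<pi> (G (r n)) t) \<longlonglongrightarrow> kpush J \<pi> H t" for t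
    unfolding kpush_def
  proof (intro tendsto_sum)
    fix i j assume "i \<in> J" "j \<in> J"
    then show "(\<lambda>n. if \<pi> i j = t then G (r n) i j else 0) \<longlonglongrightarrow> (if \<pi> i j = t then H i j else 0)"
      using H by auto
  qed
  then have "(\<lambda>n. F (G (r n))) \<longlonglongrightarrow> F H" unfolding F_def by (intro tendsto_intros)
  moreover have "(\<lambda>n. m + 1 / real (Suc (r n))) \<longlonglongrightarrow> m + 0"
    by (intro tendsto_intros LIMSEQ_subseq_LIMSEQ[OF lim_inverse_n'[THEN LIMSEQ_Suc] r, unfolded o_def])
  ultimately have "F H \<le> m + 0" using G(2) by (intro LIMSEQ_le[of "\<lambda>n. F (G (r n))"]) (auto intro: less_imp_le)
  then show ?thesis using that[OF psdH] mle by (force simp: F_def)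
qed

text \<open>Division by \<open>\<epsilon>\<close> and passage to small \<open>\<epsilon>\<close>
  leave the linear term. The range ends at 1 because one of the directions used later shrinks a
  kernel \<open>G\<close> to \<open>(1 - \<epsilon>) * G\<close>, which is positive only up to
  there.\<close>

lemma quadratic_nonneg_imp_linear_nonneg:
  fixes b C :: real
  assumes "\<And>\<epsilon>. 0 < \<epsilon> \<Longrightarrow> \<epsilon> \<le> 1 \<Longrightarrow> 0 \<le> 2 * \<epsilon> * b + \<epsilon>\<^sup>2 * C"
  shows "0 \<le> b"
proof (rule ccontr)
  assume b: "\<not> 0 \<le> b"
  \<comment> \<open>This gives \<open>\<epsilon> * C \<le> - b\<close>, so that
    \<open>2 * b + \<epsilon> * C \<le> b < 0\<close>.\<close>
  define \<epsilon> where "\<epsilon> = min 1 (- b / (\<bar>C\<bar> + 1))"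
  have e: "0 < \<epsilon>" "\<epsilon> \<le> 1" using b by (auto simp: \<epsilon>_def divide_simps)
  have "\<epsilon> * C \<le> \<epsilon> * (\<bar>C\<bar> + 1)" using e by (intro mult_left_mono) auto
  also have "\<dots> \<le> (- b / (\<bar>C\<bar> + 1)) * (\<bar>C\<bar> + 1)" by (intro mult_right_mono) (auto simp: \<epsilon>_def)
  also have "\<dots> = - b" by simp
  finally have "2 * b + \<epsilon> * C < 0" using b by linarith
  then have "\<epsilon> * (2 * b + \<epsilon> * C) < 0" using e by (simp add: mult_pos_neg)
  moreover have "\<epsilon> * (2 * b + \<epsilon> * C) = 2 * \<epsilon> * b + \<epsilon>\<^sup>2 * C"
    by (simp add: algebra_simps power2_eq_square)
  ultimately show False using assms[OF e] by linarith
qed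

text \<open>If \<open>q\<close> is not in the closed cone of images of positive kernels, the difference between \<open>q\<close>
  and its closest point in the cone is a separating functional.\<close>

lemma kpush_or_separated:
  fixes q :: "'t \<Rightarrow> complex" and star :: "'t \<Rightarrow> 't"
  assumes fin: "finite J" "finite T" and \<pi>: "\<And>i j. i \<in> J \<Longrightarrow> j \<in> J \<Longrightarrow> \<pi> i j \<in> T"
    and star: "\<And>i j. star (\<pi> i j) = \<pi> j i" "\<And>t. star (star t) = t"
    and q: "\<And>t. q (star t) = cnj (q t)"
    and c: "0 < c" and L: "\<And>s. c * (\<Sum>i\<in>J. (cmod (s i))\<^sup>2) \<le> Re (kform J (\<lambda>i j. L (\<pi> i j)) s)"
  shows "(\<exists>G. psd_kernel J G \<and> (\<forall>t\<in>T. kpush J \<pi> G t = q t)) \<or>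
    (\<exists>r. psd_kernel J (\<lambda>i j. r (\<pi> i j)) \<and> (\<forall>t. r (star t) = cnj (r t)) \<and> Re (\<Sum>t\<in>T. q t * r t) < 0)"
proof -
  obtain G where G: "psd_kernel J G"
    and min: "\<And>G'. psd_kernel J G' \<Longrightarrow>
      (\<Sum>t\<in>T. (cmod (kpush J \<pi> G t - q t))\<^sup>2) \<le> (\<Sum>t\<in>T. (cmod (kpush J \<pi> G' t - q t))\<^sup>2)"
    using kpush_closest_exists[of J T \<pi> c L q] assms by blast
  define R where "R = (\<lambda>t. kpush J \<pi> G t - q t)"
  \<comment> \<open>The conjugate makes the pairing with \<open>r\<close> the complex inner product
    with \<open>R\<close>, while keeping it linear in the other argument.\<close>
  define r where "r = (\<lambda>t. cnj (R t))"
  have expand: "(\<Sum>t\<in>T. (cmod (R t + of_real \<epsilon> * z t))\<^sup>2)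
      = (\<Sum>t\<in>T. (cmod (R t))\<^sup>2) + 2 * \<epsilon> * Re (\<Sum>t\<in>T. z t * r t) + \<epsilon>\<^sup>2 * (\<Sum>t\<in>T. (cmod (z t))\<^sup>2)"
    for z \<epsilon>
  proof -
    have "(cmod (R t + of_real \<epsilon> * z t))\<^sup>2 = (cmod (R t))\<^sup>2 + 2 * \<epsilon> * Re (z t * r t) + \<epsilon>\<^sup>2 * (cmod (z t))\<^sup>2" for t
      unfolding cmod_power2 r_def by (simp add: power2_eq_square algebra_simps)
    then show ?thesis by (simp add: sum.distrib sum_distrib_left)
  qed
  \<comment> \<open>First variation: moving from the closest point in a feasible direction cannot
    decrease the distance to first order.\<close>
  have direction: "0 \<le> Re (\<Sum>t\<in>T. kpush J \<pi> P t * r t)"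
    if "\<And>\<epsilon>. 0 < \<epsilon> \<Longrightarrow> \<epsilon> \<le> 1 \<Longrightarrow> psd_kernel J (\<lambda>i j. G i j + of_real \<epsilon> * P i j)" for P
  proof (rule quadratic_nonneg_imp_linear_nonneg)
    fix \<epsilon> :: real assume e: "0 < \<epsilon>" "\<epsilon> \<le> 1"
    from min[OF that[OF e]] have
      "(\<Sum>t\<in>T. (cmod (R t))\<^sup>2) \<le> (\<Sum>t\<in>T. (cmod (R t + of_real \<epsilon> * kpush J \<pi> P t))\<^sup>2)"
      by (simp add: kpush_add kpush_scale R_def algebra_simps)
    then show "0 \<le> 2 * \<epsilon> * Re (\<Sum>t\<in>T. kpush J \<pi> P t * r t) + \<epsilon>\<^sup>2 * (\<Sum>t\<in>T. (cmod (kpush J \<pi> P t))\<^sup>2)"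
      unfolding expand by simp
  qed
  show ?thesis
  proof (cases "\<forall>t\<in>T. R t = 0")
    case True
    then show ?thesis using G by (auto simp: R_def)
  next
    case False
    have "kpush J \<pi> G (star t) = cnj (kpush J \<pi> G t)" for t
    proof -
      have "kpush J \<pi> G (star t) = (\<Sum>i\<in>J. \<Sum>j\<in>J. if \<pi> j i = t then G i j else 0)"
        unfolding kpush_def by (intro sum.cong refl if_cong) (metis star)
      also have "\<dots> = (\<Sum>j\<in>J. \<Sum>i\<in>J. if \<pi> j i = t then G i j else 0)" by (rule sum.swap)
      also have "\<dots> = (\<Sum>j\<in>J. \<Sum>i\<in>J. cnj (if \<pi> j i = t then G j i else 0))"
        by (intro sum.cong refl) (auto intro: psd_kernel_herm[OF G])
      also have "\<dots> = cnj (kpush J \<pi> G t)" by (simp add: kpush_def)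
      finally show ?thesis .
    qed
    then have r_star: "r (star t) = cnj (r t)" for t by (simp add: r_def R_def q)
    have "psd_kernel J (\<lambda>i j. r (\<pi> i j))"
    proof (rule psd_kernelI)
      fix i j
      show "r (\<pi> j i) = cnj (r (\<pi> i j))" by (metis star(1) r_star)
    next
      fix s
      have "0 \<le> Re (\<Sum>t\<in>T. kpush J \<pi> (\<lambda>i j. cnj (s i) * s j) t * r t)"
        by (rule direction, rule psd_kernel_add[OF G], rule psd_kernel_scale[OF psd_kernel_rank_one]) simp
      also have "(\<Sum>t\<in>T. kpush J \<pi> (\<lambda>i j. cnj (s i) * s j) t * r t) = kform J (\<lambda>i j. r (\<pi> i j)) s"
        using kpush_pairing[where J = J and \<pi> = \<pi> and T = T and r = r] fin \<pi>
        by (simp add: kform_def mult_ac)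
      finally show "0 \<le> Re (kform J (\<lambda>i j. r (\<pi> i j)) s)" .
    qed
    \<comment> \<open>Shrinking \<open>G\<close> is feasible too, which bounds the pairing of its
      image with \<open>r\<close> above by 0. As \<open>q\<close> is that image minus
      \<open>R\<close>, its pairing with \<open>r\<close> is smaller still by the squared norm of
      \<open>R\<close>.\<close>
    moreover have "0 \<le> Re (\<Sum>t\<in>T. kpush J \<pi> (\<lambda>i j. - 1 * G i j) t * r t)"
    proof (rule direction)
      fix \<epsilon> :: real assume "0 < \<epsilon>" "\<epsilon> \<le> 1"
      then show "psd_kernel J (\<lambda>i j. G i j + of_real \<epsilon> * (- 1 * G i j))"
        using psd_kernel_scale[OF G, of "1 - \<epsilon>"] by (simp add: algebra_simps)
    qed
    then have "Re (\<Sum>t\<in>T. kpush J \<pi> G t * r t) \<le> 0"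
      unfolding kpush_scale by (simp add: sum_negf)
    moreover have "(\<Sum>t\<in>T. q t * r t) = (\<Sum>t\<in>T. kpush J \<pi> G t * r t) - (\<Sum>t\<in>T. of_real ((cmod (R t))\<^sup>2))"
      unfolding complex_norm_square by (simp add: R_def r_def algebra_simps flip: sum_subtractf)
    moreover from False obtain t0 where "t0 \<in> T" "R t0 \<noteq> 0" by blast
    then have "0 < (\<Sum>t\<in>T. (cmod (R t))\<^sup>2)"
      using fin by (intro sum_pos2[of T t0]) auto
    ultimately show ?thesis using r_star by (intro disjI2 exI[of _ r]) simp
  qed
qed

text \<open>Put \<open>e i = c i * (cmod (s i))^2\<close>. By the arithmetic-geometric mean
  inequality an off-diagonal term is at most \<open>(e i + e j) / (2 * B)\<close> in modulus. Summed
  over all pairs these bounds amount to \<open>card J / B\<close> times the sum of \<open>e\<close>,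
  at most half of the diagonal part.\<close>

lemma kform_diagonally_dominant:
  assumes fin: "finite J" and c1: "\<And>i. i \<in> J \<Longrightarrow> 1 \<le> c i"
    and diag: "\<And>i. i \<in> J \<Longrightarrow> L i i = of_real (c i)"
    and off: "\<And>i j. i \<in> J \<Longrightarrow> j \<in> J \<Longrightarrow> i \<noteq> j \<Longrightarrow> (B * cmod (L i j))\<^sup>2 \<le> c i * c j"
    and B: "2 * real (card J) \<le> B" "0 < B"
  shows "1/2 * (\<Sum>i\<in>J. (cmod (s i))\<^sup>2) \<le> Re (kform J L s)"
proof -
  define e where "e = (\<lambda>i. c i * (cmod (s i))\<^sup>2)"
  have e0: "0 \<le> e i" if "i \<in> J" for i using c1[OF that] by (simp add: e_def)
  have bound: "(if i = j then e i else 0) - (e i + e j) / (2 * B) \<le> Re (cnj (s i) * L i j * s j)"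
    if ij: "i \<in> J" "j \<in> J" for i j
  proof (cases "i = j")
    case True
    have "cnj (s i) * L i i * s i = of_real (c i) * (s i * cnj (s i))"
      by (simp add: diag[OF ij(1)])
    also have "\<dots> = of_real (e i)" unfolding e_def of_real_mult complex_norm_square ..
    finally show ?thesis using True e0[OF ij(1)] B by (simp add: field_simps)
  next
    case False
    have "B * cmod (L i j) \<le> sqrt (c i) * sqrt (c j)"
      using real_le_rsqrt[OF off[OF ij False]] by (simp add: real_sqrt_mult)
    then have "B * cmod (L i j) * (cmod (s i) * cmod (s j)) \<le> sqrt (c i) * sqrt (c j) * (cmod (s i) * cmod (s j))"
      by (intro mult_right_mono) auto
    also have "\<dots> = (sqrt (c i) * cmod (s i)) * (sqrt (c j) * cmod (s j))" by simp
    also have "2 * \<dots> \<le> (sqrt (c i) * cmod (s i))\<^sup>2 + (sqrt (c j) * cmod (s j))\<^sup>2"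
      using sum_squares_bound[of "sqrt (c i) * cmod (s i)" "sqrt (c j) * cmod (s j)"] by (simp add: mult.assoc)
    also have "\<dots> = e i + e j" using c1[OF ij(1)] c1[OF ij(2)] by (simp add: e_def power_mult_distrib)
    finally have "2 * (B * cmod (cnj (s i) * L i j * s j)) \<le> e i + e j"
      by (simp add: norm_mult mult_ac)
    then have "cmod (cnj (s i) * L i j * s j) \<le> (e i + e j) / (2 * B)" using B by (simp add: field_simps)
    then show ?thesis using False abs_Re_le_cmod[of "cnj (s i) * L i j * s j"] by simp
  qed
  have "1/2 * (\<Sum>i\<in>J. (cmod (s i))\<^sup>2) \<le> 1/2 * (\<Sum>i\<in>J. e i)"
    unfolding e_def using mult_right_mono[OF c1] by (intro mult_left_mono sum_mono) force+
  also have "\<dots> \<le> (1 - real (card J) / B) * (\<Sum>i\<in>J. e i)"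
    using B e0 by (intro mult_right_mono sum_nonneg) (auto simp: field_simps)
  also have "\<dots> = (\<Sum>i\<in>J. \<Sum>j\<in>J. (if i = j then e i else 0) - (e i + e j) / (2 * B))"
    using fin B by (simp add: sum_subtractf sum.distrib flip: sum_divide_distrib sum_distrib_left)
      (simp add: field_simps)
  also have "\<dots> \<le> (\<Sum>i\<in>J. \<Sum>j\<in>J. Re (cnj (s i) * L i j * s j))"
    by (intro sum_mono bound)
  also have "\<dots> = Re (kform J L s)" by (simp add: kform_def)
  finally show ?thesis .
qed

section \<open>Sums of squares of noncommutative polynomials\<close>

definition windex :: "nat \<Rightarrow> nat \<Rightarrow> ('l list \<times> nat) set" where
  "windex K d = {w. length w \<le> K} \<times> {..<d}"

text \<open>Words stand for noncommutative monomials, numbers for matrix coordinates: the adjoint of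
  the basis element \<open>i\<close> times \<open>j\<close> is the word \<open>rev u @ v\<close> in
  the entry \<open>(a, b)\<close>. Kernels of the form \<open>L (wpair i j)\<close> are
  noncommutative Hankel matrices.\<close>

definition wpair :: "'l list \<times> nat \<Rightarrow> 'l list \<times> nat \<Rightarrow> 'l list \<times> nat \<times> nat" where
  "wpair i j = (rev (fst i) @ fst j, snd i, snd j)"

definition wstar :: "'l list \<times> nat \<times> nat \<Rightarrow> 'l list \<times> nat \<times> nat" where
  "wstar = (\<lambda>(w, a, b). (rev w, b, a))"

lemma finite_words: "finite {w :: 'l::finite list. length w \<le> K}"
  using finite_lists_length_le[of "UNIV :: 'l set" K] by simp

lemma finite_windex: "finite (windex K d :: ('l::finite list \<times> nat) set)"
  by (simp add: windex_def finite_words)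

text \<open>A functional that is strictly positive on sums of squares: the weights \<open>B\<^bsup>m\<^sup>2\<^esup>\<close> of the squares
  \<open>w\<^sup>* w\<close> with \<open>m = length w\<close> grow so fast that the Hankel matrix is diagonally dominant.\<close>

definition palindrome_weight :: "nat \<Rightarrow> 'l list \<times> nat \<times> nat \<Rightarrow> complex" where
  "palindrome_weight B = (\<lambda>(w, a, b).
     if a = b \<and> rev w = w \<and> even (length w) then of_nat (B ^ ((length w div 2)\<^sup>2)) else 0)"

lemma palindrome_weight_star: "palindrome_weight B (wstar t) = cnj (palindrome_weight B t)"
  by (cases t) (auto simp: palindrome_weight_def wstar_def)

text \<open>If \<open>rev u @ v\<close> is a palindrome and the two lengths agree, then
  \<open>u = v\<close>. A nonzero off-diagonal entry therefore has different lengths with even sum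
  \<open>2 * m\<close>, and strict convexity of the square gives
  \<open>2 * m^2 + 2 \<le> (length u)^2 + (length v)^2\<close>. The surplus 2 pays for the factor
  \<open>B^2\<close> in the dominance condition.\<close>

lemma palindrome_weight_positive:
  assumes B: "2 * card (windex K d :: ('l::finite list \<times> nat) set) \<le> B" "0 < B"
  shows "1/2 * (\<Sum>i\<in>windex K d. (cmod (s i))\<^sup>2)
    \<le> Re (kform (windex K d :: ('l list \<times> nat) set) (\<lambda>i j. palindrome_weight B (wpair i j)) s)"
proof (rule kform_diagonally_dominant[where B = "real B"
    and c = "\<lambda>i. real B ^ ((length (fst i))\<^sup>2)"])
  fix i j :: "'l list \<times> nat"
  assume ij: "i \<noteq> j"
  obtain u a v b where uv: "i = (u, a)" "j = (v, b)" by (cases i, cases j)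
  show "(real B * cmod (palindrome_weight B (wpair i j)))\<^sup>2
    \<le> real B ^ ((length (fst i))\<^sup>2) * real B ^ ((length (fst j))\<^sup>2)"
  proof (cases "a = b \<and> rev (rev u @ v) = rev u @ v \<and> even (length u + length v)")
    case True
    then obtain m where m: "length u + length v = 2 * m" by (elim conjE evenE)
    have ne: "length u \<noteq> length v" using True ij uv by auto
    have "2 * m\<^sup>2 + 2 \<le> (length u)\<^sup>2 + (length v)\<^sup>2"
    proof -
      \<comment> \<open>Half the difference of the lengths, a nonzero integer; the estimate is then
        the parallelogram identity.\<close>
      define y where "y = int m - int (length v)"
      have mi: "int (length u) + int (length v) = 2 * int m" using arg_cong[OF m, of int] by simp
      then have uv_y: "int (length u) - int (length v) = 2 * y" by (simp add: y_def)
      then have "y \<noteq> 0" using ne by auto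
      then have y1: "1 \<le> y\<^sup>2" by (simp add: int_one_le_iff_zero_less)
      have "2 * ((int (length u))\<^sup>2 + (int (length v))\<^sup>2)
          = (int (length u) + int (length v))\<^sup>2 + (int (length u) - int (length v))\<^sup>2"
        by (simp add: power2_eq_square algebra_simps)
      also have "\<dots> = 4 * (int m)\<^sup>2 + 4 * y\<^sup>2"
        unfolding mi uv_y power_mult_distrib by simp
      finally have "2 * (int m)\<^sup>2 + 2 \<le> (int (length u))\<^sup>2 + (int (length v))\<^sup>2"
        using y1 by simp
      then have "int (2 * m\<^sup>2 + 2) \<le> int ((length u)\<^sup>2 + (length v)\<^sup>2)" by simp
      then show ?thesis by (simp only: of_nat_le_iff)
    qed
    then have "real B ^ (2 * m\<^sup>2 + 2) \<le> real B ^ ((length u)\<^sup>2 + (length v)\<^sup>2)"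
      using B by (intro power_increasing) auto
    also have "real B ^ (2 * m\<^sup>2 + 2) = (real B * real B ^ (m\<^sup>2))\<^sup>2"
      unfolding power_add power_mult_distrib power_even_eq by (rule mult.commute)
    finally show ?thesis using True m uv
      by (simp add: palindrome_weight_def wpair_def norm_power power_add)
  next
    case False
    then have "palindrome_weight B (wpair i j) = 0" using uv by (auto simp: palindrome_weight_def wpair_def)
    then show ?thesis by simp
  qed
qed (use B in \<open>auto simp: finite_windex palindrome_weight_def wpair_def simp flip: mult_2\<close>)

section \<open>Hermitian matrices acting on vectors, and the GNS construction\<close>

definition cinner :: "nat \<Rightarrow> (nat \<Rightarrow> complex) \<Rightarrow> (nat \<Rightarrow> complex) \<Rightarrow> complex" where
  "cinner n f g = (\<Sum>i<n. f i * cnj (g i))"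

text \<open>Vectors are functions on the natural numbers of which only the values below
  \<open>n\<close> carry meaning. This avoids carrier conditions, and equalities of vectors are
  accordingly claimed below \<open>n\<close> only.\<close>

definition mact :: "nat \<Rightarrow> complex mat \<Rightarrow> (nat \<Rightarrow> complex) \<Rightarrow> nat \<Rightarrow> complex" where
  "mact n M f i = (\<Sum>j<n. M $$ (i, j) * f j)"

primrec wact :: "nat \<Rightarrow> ('l \<Rightarrow> complex mat) \<Rightarrow> 'l list \<Rightarrow> (nat \<Rightarrow> complex) \<Rightarrow> nat \<Rightarrow> complex" where
  "wact n Z [] f = f"
| "wact n Z (l # w) f = mact n (Z l) (wact n Z w f)"

lemma cinner_cong:
  "(\<And>i. i < n \<Longrightarrow> f i = f' i) \<Longrightarrow> (\<And>i. i < n \<Longrightarrow> g i = g' i) \<Longrightarrow> cinner n f g = cinner n f' g'"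
  by (simp add: cinner_def)

lemma mact_cong: "(\<And>i. i < n \<Longrightarrow> f i = g i) \<Longrightarrow> mact n M f = mact n M g"
  by (simp add: mact_def fun_eq_iff)

lemma wact_append: "wact n Z (u @ v) f = wact n Z u (wact n Z v f)"
  by (induction u) auto

lemma mat_adjoint_index:
  assumes "A \<in> carrier_mat nr nc" "i < nc" "j < nr"
  shows "mat_adjoint A $$ (i, j) = cnj (A $$ (j, i))"
  using assms by (simp add: mat_adjoint_def mat_of_rows_index cols_nth conjugate_complex_def)

lemma mat_adjoint_carrier: "A \<in> carrier_mat nr nc \<Longrightarrow> mat_adjoint A \<in> carrier_mat nc nr"
  using mat_of_rows_carrier(1)[of "dim_row A" "map conjugate (cols A)"]
  by (auto simp: mat_adjoint_def)

lemma hermitian_mat_iff: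
  assumes "A \<in> carrier_mat n n"
  shows "hermitian_mat A \<longleftrightarrow> (\<forall>i<n. \<forall>j<n. A $$ (j, i) = cnj (A $$ (i, j)))"
proof
  assume "hermitian_mat A"
  then show "\<forall>i<n. \<forall>j<n. A $$ (j, i) = cnj (A $$ (i, j))"
    using mat_adjoint_index[OF assms] unfolding hermitian_mat_def by metis
next
  assume "\<forall>i<n. \<forall>j<n. A $$ (j, i) = cnj (A $$ (i, j))"
  then have "cnj (A $$ (j, i)) = A $$ (i, j)" if "i < n" "j < n" for i j using that by metis
  then show "hermitian_mat A"
    using mat_adjoint_carrier[OF assms] assms unfolding hermitian_mat_def
    by (intro eq_matI) (auto simp: mat_adjoint_index[OF assms])
qed

lemma cinner_mact:
  assumes "M \<in> carrier_mat n n" "hermitian_mat M"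
  shows "cinner n (mact n M f) g = cinner n f (mact n M g)"
proof -
  have h: "M $$ (i, j) = cnj (M $$ (j, i))" if "i < n" "j < n" for i j
    using assms hermitian_mat_iff that by blast
  have "cinner n (mact n M f) g = (\<Sum>i<n. \<Sum>j<n. M $$ (i, j) * f j * cnj (g i))"
    by (simp add: cinner_def mact_def sum_distrib_right)
  also have "\<dots> = (\<Sum>j<n. \<Sum>i<n. M $$ (i, j) * f j * cnj (g i))" by (rule sum.swap)
  also have "\<dots> = (\<Sum>j<n. \<Sum>i<n. f j * cnj (M $$ (j, i) * g i))"
  proof (intro sum.cong refl)
    fix i j assume "i \<in> {..<n}" "j \<in> {..<n}"
    then have "M $$ (i, j) = cnj (M $$ (j, i))" using h by blast
    then show "M $$ (i, j) * f j * cnj (g i) = f j * cnj (M $$ (j, i) * g i)" by simp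
  qed
  also have "\<dots> = cinner n f (mact n M g)" by (simp add: cinner_def mact_def sum_distrib_left)
  finally show ?thesis .
qed

lemma cinner_wact:
  assumes "\<And>l. Z l \<in> carrier_mat n n \<and> hermitian_mat (Z l)"
  shows "cinner n (wact n Z w f) g = cinner n f (wact n Z (rev w) g)"
  using assms by (induction w arbitrary: g) (simp_all add: wact_append cinner_mact)

text \<open>Left multiplication by a letter is symmetric for the inner product defined by
  \<open>L\<close>, but leads out of the words of length at most \<open>K\<close>. Its compression
  \<open>Z\<close> is still hermitian and agrees with multiplication as long as the product stays in
  \<open>J\<close>. Cutting a word of length at most \<open>2 * K\<close> in two keeps every vector
  in that range.\<close>

lemma gns_construction:
  fixes L :: "'l::finite list \<times> nat \<times> nat \<Rightarrow> complex" and K d :: nat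
  defines "J \<equiv> (windex K d :: ('l list \<times> nat) set)"
  assumes star: "\<And>t. L (wstar t) = cnj (L t)"
    and psd: "psd_kernel J (\<lambda>i j. L (wpair i j))"
    and pd: "\<And>s. kform J (\<lambda>i j. L (wpair i j)) s = 0 \<Longrightarrow> \<forall>i\<in>J. s i = 0"
  obtains Z \<gamma> where "\<And>l. Z l \<in> carrier_mat (card J) (card J) \<and> hermitian_mat (Z l)"
    "\<And>w a b. length w \<le> 2 * K \<Longrightarrow> a < d \<Longrightarrow> b < d \<Longrightarrow>
      cinner (card J) (wact (card J) Z w (\<gamma> b)) (\<gamma> a) = L (w, a, b)"
proof -
  have finJ: "finite J" by (simp add: J_def finite_windex)
  define n where "n = card J"
  obtain \<rho> \<sigma> where
    \<rho>: "\<And>i j. i \<in> J \<Longrightarrow> j \<in> J \<Longrightarrow> L (wpair i j) = (\<Sum>k<n. cnj (\<rho> k i) * \<rho> k j)"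
    and \<sigma>: "\<And>i j. i \<in> J \<Longrightarrow> j \<in> J \<Longrightarrow> (\<Sum>k<n. cnj (\<sigma> k i) * \<rho> k j) = (if i = j then 1 else 0)"
    and \<sigma>': "\<And>k l. k < n \<Longrightarrow> l < n \<Longrightarrow> (\<Sum>i\<in>J. \<rho> k i * cnj (\<sigma> l i)) = (if k = l then 1 else 0)"
    by (rule pd_kernel_basis[OF finJ psd pd, folded n_def]) (assumption, rule that)
  \<comment> \<open>The form of multiplication by \<open>l\<close> in the word basis. Words of
    length \<open>2 * K + 1\<close> occur here; the symmetry of \<open>L\<close> on them makes
    \<open>Z\<close> hermitian.\<close>
  define M where "M = (\<lambda>l i j. L (rev (fst i) @ l # fst j, snd i, snd j))"
  have M_herm: "cnj (M l i j) = M l j i" for l i j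
    using star[of "(rev (fst i) @ l # fst j, snd i, snd j)"] by (simp add: M_def wstar_def)
  define Z where "Z = (\<lambda>l. mat n n (\<lambda>(k, k'). \<Sum>i\<in>J. \<Sum>j\<in>J. \<sigma> k i * M l i j * cnj (\<sigma> k' j)))"
  define \<gamma> where "\<gamma> = (\<lambda>a k. \<rho> k ([], a))"
  have Z: "Z l \<in> carrier_mat n n \<and> hermitian_mat (Z l)" for l
  proof
    show c: "Z l \<in> carrier_mat n n" by (simp add: Z_def)
    have "Z l $$ (k', k) = cnj (Z l $$ (k, k'))" if "k < n" "k' < n" for k k'
    proof -
      have "cnj (Z l $$ (k, k')) = (\<Sum>i\<in>J. \<Sum>j\<in>J. \<sigma> k' j * M l j i * cnj (\<sigma> k i))"
        using that by (simp add: Z_def M_herm mult_ac)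
      also have "\<dots> = (\<Sum>j\<in>J. \<Sum>i\<in>J. \<sigma> k' j * M l j i * cnj (\<sigma> k i))" by (rule sum.swap)
      also have "\<dots> = Z l $$ (k', k)" using that by (simp add: Z_def)
      finally show ?thesis by simp
    qed
    then show "hermitian_mat (Z l)" unfolding hermitian_mat_iff[OF c] by blast
  qed
  have shift: "mact n (Z l) (\<lambda>k. \<rho> k (v, b)) k = \<rho> k (l # v, b)"
    if vb: "(v, b) \<in> J" "(l # v, b) \<in> J" and k: "k < n" for l v b k
  proof -
    have "mact n (Z l) (\<lambda>k. \<rho> k (v, b)) k
        = (\<Sum>k'<n. \<Sum>i\<in>J. \<Sum>j\<in>J. \<sigma> k i * M l i j * (cnj (\<sigma> k' j) * \<rho> k' (v, b)))"
      using k by (simp add: mact_def Z_def sum_distrib_right mult.assoc)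
    also have "\<dots> = (\<Sum>i\<in>J. \<Sum>k'<n. \<Sum>j\<in>J. \<sigma> k i * M l i j * (cnj (\<sigma> k' j) * \<rho> k' (v, b)))"
      by (rule sum.swap)
    also have "\<dots> = (\<Sum>i\<in>J. \<Sum>j\<in>J. \<Sum>k'<n. \<sigma> k i * M l i j * (cnj (\<sigma> k' j) * \<rho> k' (v, b)))"
      by (intro sum.cong refl sum.swap)
    also have "\<dots> = (\<Sum>i\<in>J. \<Sum>j\<in>J. if j = (v, b) then \<sigma> k i * M l i j else 0)"
      using \<sigma>[OF _ vb(1)] by (intro sum.cong refl) (simp flip: sum_distrib_left)
    also have "\<dots> = (\<Sum>i\<in>J. \<sigma> k i * M l i (v, b))"
      using finJ vb by simp
    also have "\<dots> = (\<Sum>i\<in>J. \<sigma> k i * L (wpair i (l # v, b)))" by (simp add: M_def wpair_def)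
    also have "\<dots> = (\<Sum>i\<in>J. \<Sum>m<n. \<sigma> k i * cnj (\<rho> m i) * \<rho> m (l # v, b))"
      using vb by (simp add: \<rho> sum_distrib_left mult.assoc)
    also have "\<dots> = (\<Sum>m<n. \<Sum>i\<in>J. \<sigma> k i * cnj (\<rho> m i) * \<rho> m (l # v, b))" by (rule sum.swap)
    also have "\<dots> = (\<Sum>m<n. cnj (\<Sum>i\<in>J. \<rho> m i * cnj (\<sigma> k i)) * \<rho> m (l # v, b))"
      by (simp add: sum_distrib_left sum_distrib_right mult_ac)
    also have "\<dots> = (\<Sum>m<n. if m = k then \<rho> m (l # v, b) else 0)"
      using \<sigma>' k by (intro sum.cong refl) auto
    also have "\<dots> = \<rho> k (l # v, b)" using k by simp
    finally show ?thesis .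
  qed
  have words: "wact n Z w (\<gamma> b) k = \<rho> k (w, b)" if "length w \<le> K" "b < d" "k < n" for w b k
    using that
  proof (induction w arbitrary: k)
    case Nil
    then show ?case by (simp add: \<gamma>_def)
  next
    case (Cons l v)
    have "wact n Z (l # v) (\<gamma> b) k = mact n (Z l) (\<lambda>k. \<rho> k (v, b)) k"
      unfolding wact.simps using Cons by (intro fun_cong[OF mact_cong]) simp
    also have "\<dots> = \<rho> k (l # v, b)" using Cons.prems by (intro shift) (auto simp: J_def windex_def)
    finally show ?case .
  qed
  have "cinner n (wact n Z w (\<gamma> b)) (\<gamma> a) = L (w, a, b)"
    if w: "length w \<le> 2 * K" "a < d" "b < d" for w a b
  proof -
    define u v where "u = rev (take K w)" and "v = drop K w"
    have uv: "w = rev u @ v" "length u \<le> K" "length v \<le> K" using w by (auto simp: u_def v_def)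
    have "cinner n (wact n Z w (\<gamma> b)) (\<gamma> a) = cinner n (wact n Z v (\<gamma> b)) (wact n Z u (\<gamma> a))"
      using cinner_wact[OF Z, where w = "rev u"] by (simp add: uv(1) wact_append)
    also have "\<dots> = cinner n (\<lambda>k. \<rho> k (v, b)) (\<lambda>k. \<rho> k (u, a))"
      using uv w by (intro cinner_cong words) auto
    also have "\<dots> = (\<Sum>k<n. cnj (\<rho> k (u, a)) * \<rho> k (v, b))" by (simp add: cinner_def mult.commute)
    also have "\<dots> = L (wpair (u, a) (v, b))" using uv w by (intro \<rho>[symmetric]) (auto simp: J_def windex_def)
    finally show ?thesis by (simp add: wpair_def uv(1))
  qed
  then show ?thesis using that[of Z \<gamma>] Z unfolding n_def by blast
qed

section \<open>Coefficients as sums over the cut positions of a word\<close>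

lemma sum_splits:
  fixes f :: "'l list \<Rightarrow> 'l list \<Rightarrow> 'b::comm_monoid_add"
  assumes fin: "finite U" "finite V"
    and null: "\<And>u v. u @ v = w \<Longrightarrow> u \<notin> U \<or> v \<notin> V \<Longrightarrow> f u v = 0"
  shows "(\<Sum>u\<in>U. \<Sum>v\<in>V. if u @ v = w then f u v else 0) = (\<Sum>i\<le>length w. f (take i w) (drop i w))"
proof -
  have "(\<Sum>u\<in>U. \<Sum>v\<in>V. if u @ v = w then f u v else 0)
      = (\<Sum>(u, v)\<in>U \<times> V. if u @ v = w then f u v else 0)"
    by (rule sum.cartesian_product)
  also have "\<dots> = (\<Sum>(u, v)\<in>(\<lambda>i. (take i w, drop i w)) ` {..length w}. f u v)"
  proof (rule sum.mono_neutral_cong)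
    fix p assume "p \<in> (\<lambda>i. (take i w, drop i w)) ` {..length w} - U \<times> V"
    then show "(case p of (u, v) \<Rightarrow> f u v) = 0" by (auto intro!: null)
  next
    fix p assume p: "p \<in> U \<times> V - (\<lambda>i. (take i w, drop i w)) ` {..length w}"
    show "(case p of (u, v) \<Rightarrow> if u @ v = w then f u v else 0) = 0"
    proof (cases "fst p @ snd p = w")
      case True
      then have "p = (take (length (fst p)) w, drop (length (fst p)) w)" "length (fst p) \<le> length w"
        by (auto simp: prod_eq_iff)
      then show ?thesis using p by blast
    qed (auto split: prod.splits)
  qed (use fin in auto)
  also have "\<dots> = (\<Sum>i\<le>length w. f (take i w) (drop i w))"
    by (subst sum.reindex) (auto simp: inj_on_def dest: arg_cong[where f = length])
  finally show ?thesis .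
qed

lemma sum_rev_words:
  "(\<Sum>u | length u \<le> K. f (rev u)) = (\<Sum>u | length u \<le> K. f (u :: 'l list))"
  by (rule sum.reindex_bij_witness[of _ rev rev]) auto

text \<open>The index set only sees factorizations into two words of length at most
  \<open>K\<close>; since \<open>G\<close> vanishes on longer words, all cut positions may be
  included.\<close>

lemma kpush_wpair:
  assumes null: "\<And>u v a b. K < length u \<or> K < length v \<Longrightarrow> G (u, a) (v, b) = 0"
    and "a < d" "b < d"
  shows "kpush (windex K d :: ('l::finite list \<times> nat) set) wpair G (w, a, b)
    = (\<Sum>i\<le>length w. G (rev (take i w), a) (drop i w, b))"
proof -
  let ?W = "{w :: 'l list. length w \<le> K}"
  have "kpush (windex K d) wpair G (w, a, b)
      = (\<Sum>u\<in>?W. \<Sum>a'<d. \<Sum>v\<in>?W. \<Sum>b'<d. if a' = a \<and> b' = b \<and> rev u @ v = w then G (u, a') (v, b') else 0)"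
    unfolding kpush_def windex_def sum.cartesian_product'
    by (intro sum.cong refl) (auto simp: wpair_def)
  also have "\<dots> = (\<Sum>u\<in>?W. \<Sum>a'<d. if a' = a then (\<Sum>v\<in>?W. \<Sum>b'<d. if b' = b then (if rev u @ v = w then G (u, a') (v, b') else 0) else 0) else 0)"
    by (intro sum.cong refl) (auto intro!: sum.cong)
  also have "\<dots> = (\<Sum>u\<in>?W. \<Sum>v\<in>?W. if rev u @ v = w then G (u, a) (v, b) else 0)"
    using assms(2,3) by simp
  also have "\<dots> = (\<Sum>u\<in>?W. \<Sum>v\<in>?W. if rev u @ v = w then G (rev (rev u), a) (v, b) else 0)"
    by (simp only: rev_rev_ident)
  also have "\<dots> = (\<Sum>u\<in>?W. \<Sum>v\<in>?W. if u @ v = w then G (rev u, a) (v, b) else 0)"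
    by (rule sum_rev_words[where f = "\<lambda>u. \<Sum>v\<in>?W. if u @ v = w then G (rev u, a) (v, b) else 0"])
  also have "\<dots> = (\<Sum>i\<le>length w. G (rev (take i w), a) (drop i w, b))"
    by (rule sum_splits) (auto simp: finite_words intro!: null)
  finally show ?thesis .
qed

text \<open>Helton's theorem; the sum over \<open>i\<close> runs over the factorizations of the word \<open>w\<close>.\<close>

lemma positive_imp_sum_of_squares:
  fixes q :: "'l::finite list \<Rightarrow> nat \<Rightarrow> nat \<Rightarrow> complex"
  assumes herm: "\<And>w a b. q (rev w) b a = cnj (q w a b)"
    and deg: "\<And>w a b. 2 * K < length w \<Longrightarrow> q w a b = 0"
    and pos: "\<And>n Z \<xi>. 0 < n \<Longrightarrow> (\<And>l. Z l \<in> carrier_mat n n \<and> hermitian_mat (Z l)) \<Longrightarrow>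
      0 \<le> Re (\<Sum>w | length w \<le> 2 * K. \<Sum>a<d. \<Sum>b<d. q w a b * cinner n (wact n Z w (\<xi> b)) (\<xi> a))"
  shows "\<exists>N > (0 :: nat). \<exists>\<Lambda>. (\<forall>k v b. K < length v \<longrightarrow> \<Lambda> k v b = 0) \<and>
    (\<forall>w. \<forall>a<d. \<forall>b<d. q w a b =
      (\<Sum>i\<le>length w. \<Sum>k<N. cnj (\<Lambda> k (rev (take i w)) a) * \<Lambda> k (drop i w) b))"
proof -
  let ?J = "windex K d :: ('l list \<times> nat) set"
  let ?T = "{w :: 'l list. length w \<le> 2 * K} \<times> {..<d} \<times> {..<d}"
  define q' where "q' = (\<lambda>(w, a, b). q w a b)"
  define B where "B = 2 * card ?J + 1"
  define L0 where "L0 = (palindrome_weight B :: 'l list \<times> nat \<times> nat \<Rightarrow> complex)"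
  have L0: "1/2 * (\<Sum>i\<in>?J. (cmod (s i))\<^sup>2) \<le> Re (kform ?J (\<lambda>i j. L0 (wpair i j)) s)" for s
    unfolding L0_def by (rule palindrome_weight_positive) (auto simp: B_def)
  have finJ: "finite ?J" by (rule finite_windex)
  have "(\<exists>G. psd_kernel ?J G \<and> (\<forall>t\<in>?T. kpush ?J wpair G t = q' t)) \<or>
    (\<exists>r. psd_kernel ?J (\<lambda>i j. r (wpair i j)) \<and> (\<forall>t. r (wstar t) = cnj (r t)) \<and> Re (\<Sum>t\<in>?T. q' t * r t) < 0)"
  proof (rule kpush_or_separated[where c = "1/2" and L = L0])
    show "finite ?T" by (simp add: finite_words)
  qed (use L0 finJ herm in \<open>auto simp: windex_def wpair_def wstar_def q'_def\<close>)
  then show ?thesis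
  proof (elim disjE exE conjE)
    fix G assume G: "psd_kernel ?J G" "\<forall>t\<in>?T. kpush ?J wpair G t = q' t"
    obtain \<rho> where \<rho>: "\<And>i j. i \<in> ?J \<Longrightarrow> j \<in> ?J \<Longrightarrow> G i j = (\<Sum>k<card ?J. cnj (\<rho> k i) * \<rho> k j)"
      using psd_kernel_factorization[OF finJ G(1)] by blast
    \<comment> \<open>One more than needed for the factorization, with a zero last component, so
      that \<open>N\<close> is positive even if \<open>d = 0\<close>.\<close>
    define N where "N = Suc (card ?J)"
    define \<Lambda> where "\<Lambda> = (\<lambda>k v b. if k < card ?J \<and> (v, b) \<in> ?J then \<rho> k (v, b) else 0)"
    define H where "H = (\<lambda>i j. \<Sum>k<N. cnj (\<Lambda> k (fst i) (snd i)) * \<Lambda> k (fst j) (snd j))"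
    have \<Lambda>0: "\<Lambda> k v b = 0" if "K < length v" for k v b
      using that by (simp add: \<Lambda>_def windex_def)
    have GH: "G i j = H i j" if "i \<in> ?J" "j \<in> ?J" for i j
      using that by (simp add: \<rho> H_def N_def \<Lambda>_def)
    have "q w a b = (\<Sum>i\<le>length w. \<Sum>k<N. cnj (\<Lambda> k (rev (take i w)) a) * \<Lambda> k (drop i w) b)"
      if ab: "a < d" "b < d" for w a b
    proof (cases "length w \<le> 2 * K")
      case True
      then have "q w a b = kpush ?J wpair G (w, a, b)" using G(2) ab by (auto simp: q'_def)
      also have "\<dots> = kpush ?J wpair H (w, a, b)"
        unfolding kpush_def by (intro sum.cong refl if_cong GH)
      also have "\<dots> = (\<Sum>i\<le>length w. H (rev (take i w), a) (drop i w, b))"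
        by (rule kpush_wpair[OF _ ab]) (auto simp: H_def \<Lambda>0)
      finally show ?thesis by (simp add: H_def)
    next
      case False
      \<comment> \<open>Wherever a word longer than \<open>2 * K\<close> is cut, one of the two
        factors is longer than \<open>K\<close>.\<close>
      have "(\<Sum>i\<le>length w. \<Sum>k<N. cnj (\<Lambda> k (rev (take i w)) a) * \<Lambda> k (drop i w) b) = 0"
      proof (intro sum.neutral ballI)
        fix i k
        show "cnj (\<Lambda> k (rev (take i w)) a) * \<Lambda> k (drop i w) b = 0"
          using False \<Lambda>0[of "rev (take i w)" k a] \<Lambda>0[of "drop i w" k b]
          by (cases "K < length (drop i w)") auto
      qed
      then show ?thesis using deg[of w a b] False by simp
    qed
    moreover have "0 < N" by (simp add: N_def)
    ultimately show ?thesis using \<Lambda>0 by blast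
  next
    fix r assume r: "psd_kernel ?J (\<lambda>i j. r (wpair i j))" "\<forall>t. r (wstar t) = cnj (r t)"
      and neg: "Re (\<Sum>t\<in>?T. q' t * r t) < 0"
    have "d \<noteq> 0" using neg by (intro notI) simp
    then have "([], 0) \<in> ?J" by (simp add: windex_def)
    then have n: "0 < card ?J" using finJ by (auto simp: card_gt_0_iff)
    define S where "S = (\<Sum>t\<in>?T. q' t * r t)"
    define S0 where "S0 = (\<Sum>t\<in>?T. q' t * L0 t)"
    \<comment> \<open>Small enough that adding \<open>\<epsilon> * L0\<close> raises the negative
      value \<open>Re S\<close> by at most half of its modulus.\<close>
    define \<epsilon> where "\<epsilon> = - Re S / (2 * (\<bar>Re S0\<bar> + 1))"
    have \<epsilon>: "0 < \<epsilon>" using neg unfolding \<epsilon>_def S_def by (intro divide_pos_pos) auto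
    have "\<epsilon> * Re S0 \<le> \<epsilon> * (\<bar>Re S0\<bar> + 1)" using \<epsilon> by (intro mult_left_mono) auto
    also have "\<dots> = - Re S / 2" by (simp add: \<epsilon>_def field_simps)
    finally have neg': "Re S + \<epsilon> * Re S0 < 0" using neg unfolding S_def by linarith
    define L where "L = (\<lambda>t. r t + of_real \<epsilon> * L0 t)"
    have split: "kform ?J (\<lambda>i j. L (wpair i j)) s
        = kform ?J (\<lambda>i j. r (wpair i j)) s + of_real \<epsilon> * kform ?J (\<lambda>i j. L0 (wpair i j)) s" for s
      by (simp add: L_def kform_def sum.distrib sum_distrib_left algebra_simps)
    have strict: "\<epsilon> * (1/2 * (\<Sum>i\<in>?J. (cmod (s i))\<^sup>2)) \<le> Re (kform ?J (\<lambda>i j. L (wpair i j)) s)" for s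
    proof -
      have "0 \<le> Re (kform ?J (\<lambda>i j. r (wpair i j)) s)" using r unfolding psd_kernel_def by blast
      moreover have "\<epsilon> * (1/2 * (\<Sum>i\<in>?J. (cmod (s i))\<^sup>2)) \<le> \<epsilon> * Re (kform ?J (\<lambda>i j. L0 (wpair i j)) s)"
        using \<epsilon> L0 by (intro mult_left_mono) auto
      ultimately show ?thesis by (simp add: split)
    qed
    have L_star: "L (wstar t) = cnj (L t)" for t
      using spec[OF r(2), of t] by (simp add: L_def L0_def palindrome_weight_star)
    have "psd_kernel ?J (\<lambda>i j. L (wpair i j))"
    proof (rule psd_kernelI)
      fix i j :: "'l list \<times> nat"
      have "wpair j i = wstar (wpair i j)" by (simp add: wpair_def wstar_def)
      then show "L (wpair j i) = cnj (L (wpair i j))" by (simp add: L_star)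
    next
      fix s
      have "0 \<le> \<epsilon> * (1/2 * (\<Sum>i\<in>?J. (cmod (s i))\<^sup>2))" using \<epsilon> by (simp add: sum_nonneg)
      then show "0 \<le> Re (kform ?J (\<lambda>i j. L (wpair i j)) s)" using strict[of s] by linarith
    qed
    moreover have "\<forall>i\<in>?J. s i = 0" if "kform ?J (\<lambda>i j. L (wpair i j)) s = 0" for s
    proof -
      have "\<epsilon> * (1/2 * (\<Sum>i\<in>?J. (cmod (s i))\<^sup>2)) \<le> 0" using strict[of s] that by simp
      then have "(\<Sum>i\<in>?J. (cmod (s i))\<^sup>2) \<le> 0" using \<epsilon> by (simp add: mult_le_0_iff)
      then have "(\<Sum>i\<in>?J. (cmod (s i))\<^sup>2) = 0" by (intro antisym sum_nonneg) auto
      then show ?thesis using finJ by (simp add: sum_nonneg_eq_0_iff)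
    qed
    ultimately obtain Z \<gamma> where Z: "\<And>l. Z l \<in> carrier_mat (card ?J) (card ?J) \<and> hermitian_mat (Z l)"
      and \<gamma>: "\<And>w a b. length w \<le> 2 * K \<Longrightarrow> a < d \<Longrightarrow> b < d \<Longrightarrow>
        cinner (card ?J) (wact (card ?J) Z w (\<gamma> b)) (\<gamma> a) = L (w, a, b)"
      using gns_construction[of L K d, OF L_star] by metis
    \<comment> \<open>The positivity assumption at the GNS matrices and vectors is the value of the
      functional \<open>L\<close> at \<open>q\<close>, which was made negative.\<close>
    have "0 \<le> Re (\<Sum>w | length w \<le> 2 * K. \<Sum>a<d. \<Sum>b<d.
        q w a b * cinner (card ?J) (wact (card ?J) Z w (\<gamma> b)) (\<gamma> a))"
      by (rule pos[OF n]) (rule Z)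
    also have "(\<Sum>w | length w \<le> 2 * K. \<Sum>a<d. \<Sum>b<d.
        q w a b * cinner (card ?J) (wact (card ?J) Z w (\<gamma> b)) (\<gamma> a))
      = (\<Sum>w | length w \<le> 2 * K. \<Sum>a<d. \<Sum>b<d. q' (w, a, b) * L (w, a, b))"
      by (intro sum.cong refl) (simp add: \<gamma> q'_def)
    also have "\<dots> = (\<Sum>t\<in>?T. q' t * L t)" by (simp add: sum.cartesian_product')
    also have "\<dots> = S + of_real \<epsilon> * S0"
      by (simp add: L_def S_def S0_def sum.distrib sum_distrib_left algebra_simps)
    finally show ?thesis using neg' by simp
  qed
qed

section \<open>Quadratic forms of free polynomials\<close>

text \<open>Polarization: \<open>0 \<le> z\<close> for complex \<open>z\<close> includes
  \<open>Im z = 0\<close>. Vectors supported on \<open>i\<close> and \<open>j\<close> with values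
  \<open>(1, 1)\<close> and \<open>(\<i>, 1)\<close> yield the imaginary and the real part of the
  symmetry.\<close>

lemma kform_ge_0_imp_hermitian:
  assumes "finite J" and pos: "\<And>s. 0 \<le> kform J G s" and ij: "i \<in> J" "j \<in> J"
  shows "G j i = cnj (G i j)"
proof -
  have im: "Im (kform I G s) = 0" if "I \<subseteq> J" for I s
  proof -
    have "kform I G s = kform I G (\<lambda>i. if i \<in> I then s i else 0)"
      unfolding kform_def by (intro sum.cong) auto
    also have "\<dots> = kform J G (\<lambda>i. if i \<in> I then s i else 0)"
      by (rule kform_supported[symmetric]) (use assms that in auto)
    finally show ?thesis using pos by (simp add: less_eq_complex_def)
  qed
  have d: "Im (G k k) = 0" if "k \<in> J" for k
    using im[of "{k}" "\<lambda>_. 1"] that by (simp add: kform_def)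
  show ?thesis
  proof (cases "i = j")
    case True
    then show ?thesis using d[OF ij(1)] by (simp add: complex_eq_iff)
  next
    case False
    have "Im (kform {i, j} G (\<lambda>_. 1)) = 0" "Im (kform {i, j} G (\<lambda>k. if k = i then \<i> else 1)) = 0"
      using im ij by auto
    then show ?thesis using False d ij by (simp add: kform_def complex_eq_iff)
  qed
qed

lemma psd_mat_iff_kform:
  assumes T: "T \<in> carrier_mat m m"
  shows "psd_mat T \<longleftrightarrow> (\<forall>s. 0 \<le> kform {..<m} (\<lambda>i j. T $$ (i, j)) s)"
proof -
  have form: "(T *\<^sub>v v) \<bullet>c v = kform {..<m} (\<lambda>i j. T $$ (i, j)) (\<lambda>i. v $ i)"
    if "v \<in> carrier_vec m" for v
    using that T
    by (simp add: kform_def scalar_prod_def conjugate_complex_def sum_distrib_left sum_distrib_right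
        atLeast0LessThan mult_ac)
  show ?thesis
  proof (intro iffI allI)
    fix s assume T': "psd_mat T"
    have "kform {..<m} (\<lambda>i j. T $$ (i, j)) s = kform {..<m} (\<lambda>i j. T $$ (i, j)) (\<lambda>i. vec m s $ i)"
      by (simp add: kform_def)
    moreover have "0 \<le> (T *\<^sub>v vec m s) \<bullet>c vec m s" using T' T by (auto simp: psd_mat_def)
    ultimately show "0 \<le> kform {..<m} (\<lambda>i j. T $$ (i, j)) s"
      using form[of "vec m s"] by simp
  next
    assume pos: "\<forall>s. 0 \<le> kform {..<m} (\<lambda>i j. T $$ (i, j)) s"
    have "T $$ (j, i) = cnj (T $$ (i, j))" if "i < m" "j < m" for i j
      using kform_ge_0_imp_hermitian[of "{..<m}" "\<lambda>i j. T $$ (i, j)" i j] pos that by auto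
    then have "hermitian_mat T" unfolding hermitian_mat_iff[OF T] by blast
    then show "psd_mat T" using pos form T by (auto simp: psd_mat_def)
  qed
qed

lemma word_eval_carrier:
  assumes "\<And>l. letter_eval A X l \<in> carrier_mat n n"
  shows "word_eval n A X w \<in> carrier_mat n n"
  using assms by (induction w) (auto intro: mult_carrier_mat)

lemma letter_eval_herm:
  assumes "A \<in> herm_tuples n" "X \<in> herm_tuples n"
  shows "letter_eval A X l \<in> carrier_mat n n \<and> hermitian_mat (letter_eval A X l)"
  using assms by (cases l) (auto simp: herm_tuples_def)

lemma word_eval_wact:
  assumes Z: "\<And>l. letter_eval A X l \<in> carrier_mat n n" and "i < n"
  shows "(\<Sum>j<n. word_eval n A X w $$ (i, j) * f j) = wact n (letter_eval A X) w f i"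
  using assms(2)
proof (induction w arbitrary: i)
  case Nil
  then show ?case by (simp add: if_distrib[of "\<lambda>x. x * _"] cong: if_cong)
next
  case (Cons l w)
  note W = word_eval_carrier[OF Z, of w]
  have "(\<Sum>j<n. word_eval n A X (l # w) $$ (i, j) * f j)
      = (\<Sum>j<n. \<Sum>k<n. letter_eval A X l $$ (i, k) * (word_eval n A X w $$ (k, j) * f j))"
    using Cons.prems Z[of l] W
    by (intro sum.cong refl) (simp add: scalar_prod_def sum_distrib_right atLeast0LessThan mult.assoc)
  also have "\<dots> = (\<Sum>k<n. letter_eval A X l $$ (i, k) * (\<Sum>j<n. word_eval n A X w $$ (k, j) * f j))"
    by (subst sum.swap) (simp add: sum_distrib_left)
  also have "\<dots> = wact n (letter_eval A X) (l # w) f i"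
    using Cons.IH by (simp add: mact_def)
  finally show ?case .
qed

lemma wact_cong:
  assumes "\<And>i. i < n \<Longrightarrow> f i = g i" "i < n"
  shows "wact n Z w f i = wact n Z w g i"
  using assms(2)
proof (induction w arbitrary: i)
  case (Cons l w)
  have "mact n (Z l) (wact n Z w f) = mact n (Z l) (wact n Z w g)"
    by (rule mact_cong) (rule Cons.IH)
  then show ?case by simp
qed (simp add: assms)

text \<open>The sesquilinear form of \<open>p\<close> evaluated at the letters \<open>Z\<close>,
  with vectors of the tensor product written as families of vectors of length \<open>n\<close>.
  Kronecker indices disappear, and \<open>Z\<close> may be any assignment of matrices to
  letters.\<close>

definition fp_bil :: "nat \<Rightarrow> ('m letter \<Rightarrow> complex mat) \<Rightarrow> 'm fpoly \<Rightarrow>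
    (nat \<Rightarrow> nat \<Rightarrow> complex) \<Rightarrow> (nat \<Rightarrow> nat \<Rightarrow> complex) \<Rightarrow> complex" where
  "fp_bil n Z p \<xi> \<eta> =
    (\<Sum>w\<in>fp_supp p. \<Sum>k<fp_rows p. \<Sum>b<fp_cols p. p w $$ (k, b) * cinner n (wact n Z w (\<xi> b)) (\<eta> k))"

definition fp_act :: "nat \<Rightarrow> ('m letter \<Rightarrow> complex mat) \<Rightarrow> 'm fpoly \<Rightarrow>
    (nat \<Rightarrow> nat \<Rightarrow> complex) \<Rightarrow> nat \<Rightarrow> nat \<Rightarrow> complex" where
  "fp_act n Z p \<xi> k i = (\<Sum>w\<in>fp_supp p. \<Sum>b<fp_cols p. p w $$ (k, b) * wact n Z w (\<xi> b) i)"

lemma free_polysD: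
  assumes "p \<in> free_polys N d"
  shows "p w \<in> carrier_mat N d" "dim_row (p w) = N" "dim_col (p w) = d" "finite (fp_supp p)"
  using assms by (auto simp: free_polys_def)

lemma fp_supp_index:
  assumes "p \<in> free_polys N d" "w \<notin> fp_supp p" "k < N" "b < d"
  shows "p w $$ (k, b) = 0"
proof -
  have "p w = 0\<^sub>m N d" using assms(2) free_polysD(1-3)[OF assms(1), of w] by (simp add: fp_supp_def)
  then show ?thesis using assms by simp
qed

text \<open>Lets polynomials with different supports be compared by summing over one common finite
  set of words.\<close>

lemma fp_bil_superset:
  assumes p: "p \<in> free_polys N d" and "finite W" "fp_supp p \<subseteq> W"
  shows "fp_bil n Z p \<xi> \<eta>
    = (\<Sum>w\<in>W. \<Sum>k<N. \<Sum>b<d. p w $$ (k, b) * cinner n (wact n Z w (\<xi> b)) (\<eta> k))"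
  unfolding fp_bil_def free_polysD[OF p]
  by (rule sum.mono_neutral_left) (use assms fp_supp_index[OF p] in \<open>auto intro!: sum.neutral\<close>)

lemma cinner_sum_left: "cinner n (\<lambda>i. \<Sum>x\<in>S. f x i) g = (\<Sum>x\<in>S. cinner n (f x) g)"
  by (simp add: cinner_def sum_distrib_right) (rule sum.swap)

lemma cinner_scale_left: "cinner n (\<lambda>i. c * f i) g = c * cinner n f g"
  by (simp add: cinner_def sum_distrib_left mult.assoc)

lemma cinner_commute: "cinner n g f = cnj (cinner n f g)"
  by (simp add: cinner_def mult.commute)

lemma fp_bil_act:
  assumes p: "p \<in> free_polys N d"
  shows "fp_bil n Z p \<xi> \<eta> = (\<Sum>k<N. cinner n (fp_act n Z p \<xi> k) (\<eta> k))"
proof -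
  have "(\<Sum>k<N. cinner n (fp_act n Z p \<xi> k) (\<eta> k))
      = (\<Sum>k<N. \<Sum>w\<in>fp_supp p. \<Sum>b<d. p w $$ (k, b) * cinner n (wact n Z w (\<xi> b)) (\<eta> k))"
    unfolding fp_act_def[abs_def] free_polysD[OF p]
    by (simp add: cinner_sum_left cinner_scale_left)
  also have "\<dots> = fp_bil n Z p \<xi> \<eta>"
    unfolding fp_bil_def free_polysD[OF p] by (rule sum.swap)
  finally show ?thesis by simp
qed

lemma fp_bil_cong:
  assumes p: "p \<in> free_polys N d"
    and "\<And>b i. b < d \<Longrightarrow> i < n \<Longrightarrow> \<xi> b i = \<xi>' b i" "\<And>k i. k < N \<Longrightarrow> i < n \<Longrightarrow> \<eta> k i = \<eta>' k i"
  shows "fp_bil n Z p \<xi> \<eta> = fp_bil n Z p \<xi>' \<eta>'"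
  unfolding fp_bil_def free_polysD[OF p]
  by (intro sum.cong refl arg_cong2[where f = "(*)"] cinner_cong wact_cong) (use assms in auto)

text \<open>The numbering \<open>k * n + i\<close> matches the \<open>div\<close> and
  \<open>mod\<close> in \<open>kron\<close>.\<close>

lemma sum_blocks: "(\<Sum>m<d * n. f m) = (\<Sum>k<d. \<Sum>i<n. f (k * n + i :: nat))"
proof -
  have "(\<Sum>m<d * n. f m) = (\<Sum>k<d. sum f {k * n..<k * n + n})"
    by (rule sum.nat_group[symmetric])
  also have "\<dots> = (\<Sum>k<d. \<Sum>i<n. f (k * n + i))"
  proof (rule sum.cong[OF refl])
    fix k
    show "sum f {k * n..<k * n + n} = (\<Sum>i<n. f (k * n + i))"
      using sum.shift_bounds_nat_ivl[of f 0 "k * n" n] by (simp add: atLeast0LessThan add.commute)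
  qed
  finally show ?thesis .
qed

lemma block_index_less: "k < d \<Longrightarrow> i < n \<Longrightarrow> k * n + i < d * (n::nat)"
  by (metis add.commute add_less_cancel_left less_le_trans mult_Suc mult_le_mono1 Suc_leI)

lemma fp_eval_carrier:
  assumes "p \<in> free_polys N d"
  shows "fp_eval n p A X \<in> carrier_mat (N * n) (d * n)"
  by (simp add: fp_eval_def mat_sum_def free_polysD[OF assms])

lemma fp_eval_index:
  assumes p: "p \<in> free_polys N d" and Z: "\<And>l. letter_eval A X l \<in> carrier_mat n n"
    and "k < N" "i < n" "b < d" "j < n"
  shows "fp_eval n p A X $$ (k * n + i, b * n + j)
    = (\<Sum>w\<in>fp_supp p. p w $$ (k, b) * word_eval n A X w $$ (i, j))"
proof -
  have "(p w \<otimes>\<^sub>K word_eval n A X w) $$ (k * n + i, b * n + j)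
      = p w $$ (k, b) * word_eval n A X w $$ (i, j)" for w
    using free_polysD(1-3)[OF p, of w] word_eval_carrier[OF Z, of w] block_index_less assms(3-6)
    by (simp add: kron_def)
  then show ?thesis
    using assms block_index_less by (simp add: fp_eval_def mat_sum_def free_polysD[OF p])
qed

lemma kform_fp_eval:
  assumes p: "p \<in> free_polys d d" and Z: "\<And>l. letter_eval A X l \<in> carrier_mat n n"
  shows "kform {..<d * n} (\<lambda>i j. fp_eval n p A X $$ (i, j)) s
    = fp_bil n (letter_eval A X) p (\<lambda>b j. s (b * n + j)) (\<lambda>b j. s (b * n + j))"
proof -
  let ?\<xi> = "\<lambda>b j. s (b * n + j)"
  have "kform {..<d * n} (\<lambda>i j. fp_eval n p A X $$ (i, j)) s
      = (\<Sum>k<d. \<Sum>i<n. \<Sum>b<d. \<Sum>j<n. \<Sum>w\<in>fp_supp p.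
          cnj (?\<xi> k i) * (p w $$ (k, b) * (word_eval n A X w $$ (i, j) * ?\<xi> b j)))"
    unfolding kform_def sum_blocks
    by (intro sum.cong refl)
      (simp add: fp_eval_index[OF p Z] sum_distrib_left sum_distrib_right mult.assoc)
  also have "\<dots> = (\<Sum>k<d. \<Sum>i<n. \<Sum>b<d. \<Sum>w\<in>fp_supp p. \<Sum>j<n.
          cnj (?\<xi> k i) * (p w $$ (k, b) * (word_eval n A X w $$ (i, j) * ?\<xi> b j)))"
    by (intro sum.cong refl sum.swap)
  also have "\<dots> = (\<Sum>k<d. \<Sum>i<n. \<Sum>b<d. \<Sum>w\<in>fp_supp p.
          cnj (?\<xi> k i) * (p w $$ (k, b) * wact n (letter_eval A X) w (?\<xi> b) i))"
    by (intro sum.cong refl) (simp add: word_eval_wact[OF Z, symmetric] sum_distrib_left)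
  also have "\<dots> = (\<Sum>k<d. \<Sum>i<n. \<Sum>w\<in>fp_supp p. \<Sum>b<d.
          cnj (?\<xi> k i) * (p w $$ (k, b) * wact n (letter_eval A X) w (?\<xi> b) i))"
    by (intro sum.cong refl sum.swap)
  also have "\<dots> = (\<Sum>k<d. cinner n (fp_act n (letter_eval A X) p ?\<xi> k) (?\<xi> k))"
    by (simp add: cinner_def fp_act_def free_polysD[OF p] sum_distrib_left sum_distrib_right mult_ac)
  finally show ?thesis by (simp add: fp_bil_act[OF p])
qed

lemma fp_bil_blocks:
  assumes "p \<in> free_polys d d"
  shows "fp_bil n Z p (\<lambda>b j. \<xi> ((b * n + j) div n) ((b * n + j) mod n)) (\<lambda>b j. \<xi> ((b * n + j) div n) ((b * n + j) mod n))
    = fp_bil n Z p \<xi> \<xi>"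
  by (rule fp_bil_cong[OF assms]) auto

lemma psd_fp_eval_iff:
  assumes p: "p \<in> free_polys d d" and Z: "\<And>l. letter_eval A X l \<in> carrier_mat n n"
  shows "psd_mat (fp_eval n p A X) \<longleftrightarrow> (\<forall>\<xi>. 0 \<le> fp_bil n (letter_eval A X) p \<xi> \<xi>)"
  unfolding psd_mat_iff_kform[OF fp_eval_carrier[OF p]] kform_fp_eval[OF p Z]
proof (intro iffI allI)
  fix \<xi>
  assume "\<forall>s. 0 \<le> fp_bil n (letter_eval A X) p (\<lambda>b j. s (b * n + j)) (\<lambda>b j. s (b * n + j))"
  \<comment> \<open>Every block family arises from a single long vector by splitting its
    index.\<close>
  from spec[OF this, of "\<lambda>m. \<xi> (m div n) (m mod n)"]
  show "0 \<le> fp_bil n (letter_eval A X) p \<xi> \<xi>" by (simp only: fp_bil_blocks[OF p])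
qed blast

lemma nsd_fp_eval_iff:
  assumes p: "p \<in> free_polys d d" and Z: "\<And>l. letter_eval A X l \<in> carrier_mat n n"
  shows "fp_eval n p A X \<preceq> 0\<^sub>m (d * n) (d * n) \<longleftrightarrow> (\<forall>\<xi>. fp_bil n (letter_eval A X) p \<xi> \<xi> \<le> 0)"
proof -
  let ?E = "fp_eval n p A X"
  note E = fp_eval_carrier[OF p, of n A X]
  have c: "0\<^sub>m (d * n) (d * n) - ?E \<in> carrier_mat (d * n) (d * n)" using E by (rule minus_carrier_mat)
  have neg: "kform {..<d * n} (\<lambda>i j. (0\<^sub>m (d * n) (d * n) - ?E) $$ (i, j)) s
      = - fp_bil n (letter_eval A X) p (\<lambda>b j. s (b * n + j)) (\<lambda>b j. s (b * n + j))" for s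
    unfolding kform_fp_eval[OF p Z, symmetric] using E by (simp add: kform_def sum_negf)
  show ?thesis
    unfolding loewner_le_def psd_mat_iff_kform[OF c] neg neg_0_le_iff_le
  proof (intro iffI allI)
    fix \<xi>
    assume "\<forall>s. fp_bil n (letter_eval A X) p (\<lambda>b j. s (b * n + j)) (\<lambda>b j. s (b * n + j)) \<le> 0"
    from spec[OF this, of "\<lambda>m. \<xi> (m div n) (m mod n)"]
    show "fp_bil n (letter_eval A X) p \<xi> \<xi> \<le> 0" by (simp only: fp_bil_blocks[OF p])
  qed blast
qed

lemma letter_eval_affine_carrier:
  assumes "A \<in> herm_tuples n" "X \<in> herm_tuples n" "Y \<in> herm_tuples n"
  shows "letter_eval A (\<lambda>j. \<alpha> \<cdot>\<^sub>m X j + \<beta> \<cdot>\<^sub>m Y j) l \<in> carrier_mat n n"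
  using assms by (cases l) (auto simp: herm_tuples_def)

lemma convex_in_x_iff:
  assumes p: "p \<in> free_polys d d"
  shows "convex_in_x p \<longleftrightarrow>
    (\<forall>n > 0. \<forall>A \<in> herm_tuples n. \<forall>X \<in> herm_tuples n. \<forall>Y \<in> herm_tuples n. \<forall>t::real. 0 < t \<and> t < 1 \<longrightarrow>
      (\<forall>\<xi>. fp_bil n (letter_eval A (\<lambda>j. of_real t \<cdot>\<^sub>m X j + of_real (1 - t) \<cdot>\<^sub>m Y j)) p \<xi> \<xi>
        \<le> of_real t * fp_bil n (letter_eval A X) p \<xi> \<xi> + of_real (1 - t) * fp_bil n (letter_eval A Y) p \<xi> \<xi>))"
proof -
  have "(fp_eval n p A (\<lambda>j. of_real t \<cdot>\<^sub>m X j + of_real (1 - t) \<cdot>\<^sub>m Y j)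
        \<preceq> of_real t \<cdot>\<^sub>m fp_eval n p A X + of_real (1 - t) \<cdot>\<^sub>m fp_eval n p A Y) \<longleftrightarrow>
      (\<forall>\<xi>. fp_bil n (letter_eval A (\<lambda>j. of_real t \<cdot>\<^sub>m X j + of_real (1 - t) \<cdot>\<^sub>m Y j)) p \<xi> \<xi>
        \<le> of_real t * fp_bil n (letter_eval A X) p \<xi> \<xi> + of_real (1 - t) * fp_bil n (letter_eval A Y) p \<xi> \<xi>)"
    if h: "A \<in> herm_tuples n" "X \<in> herm_tuples n" "Y \<in> herm_tuples n" for n A X Y and t :: real
  proof -
    define XY where "XY = (\<lambda>j. of_real t \<cdot>\<^sub>m X j + of_real (1 - t) \<cdot>\<^sub>m Y j)"
    note E = fp_eval_carrier[OF p, of n A]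
    let ?D = "of_real t \<cdot>\<^sub>m fp_eval n p A X + of_real (1 - t) \<cdot>\<^sub>m fp_eval n p A Y - fp_eval n p A XY"
    have c: "?D \<in> carrier_mat (d * n) (d * n)" by (rule minus_carrier_mat[OF E])
    have Z: "letter_eval A X l \<in> carrier_mat n n" "letter_eval A Y l \<in> carrier_mat n n"
      "letter_eval A XY l \<in> carrier_mat n n" for l
      using letter_eval_herm h letter_eval_affine_carrier[OF h] by (auto simp: XY_def)
    have form: "kform {..<d * n} (\<lambda>i j. ?D $$ (i, j)) s
        = of_real t * kform {..<d * n} (\<lambda>i j. fp_eval n p A X $$ (i, j)) s
          + of_real (1 - t) * kform {..<d * n} (\<lambda>i j. fp_eval n p A Y $$ (i, j)) s
          - kform {..<d * n} (\<lambda>i j. fp_eval n p A XY $$ (i, j)) s" for s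
    proof -
      have entry: "?D $$ (i, j) = of_real t * fp_eval n p A X $$ (i, j)
          + of_real (1 - t) * fp_eval n p A Y $$ (i, j) - fp_eval n p A XY $$ (i, j)"
        if "i < d * n" "j < d * n" for i j
        using E[of X] E[of Y] E[of XY] that by simp
      have "kform {..<d * n} (\<lambda>i j. ?D $$ (i, j)) s
          = (\<Sum>i<d * n. \<Sum>j<d * n. of_real t * (cnj (s i) * fp_eval n p A X $$ (i, j) * s j)
              + of_real (1 - t) * (cnj (s i) * fp_eval n p A Y $$ (i, j) * s j)
              - cnj (s i) * fp_eval n p A XY $$ (i, j) * s j)"
        unfolding kform_def
      proof (intro sum.cong refl)
        fix i j assume "i \<in> {..<d * n}" "j \<in> {..<d * n}"
        then have "i < d * n" "j < d * n" by auto
        from entry[OF this] show "cnj (s i) * ?D $$ (i, j) * s j =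
            of_real t * (cnj (s i) * fp_eval n p A X $$ (i, j) * s j)
              + of_real (1 - t) * (cnj (s i) * fp_eval n p A Y $$ (i, j) * s j)
              - cnj (s i) * fp_eval n p A XY $$ (i, j) * s j"
          by (simp only:) (simp only: distrib_left distrib_right left_diff_distrib right_diff_distrib mult_ac)
      qed
      then show ?thesis by (simp only: kform_def sum_distrib_left sum.distrib sum_subtractf)
    qed
    show ?thesis
      unfolding loewner_le_def XY_def[symmetric] psd_mat_iff_kform[OF c] form
        kform_fp_eval[OF p Z(1)] kform_fp_eval[OF p Z(2)] kform_fp_eval[OF p Z(3)] diff_ge_0_iff_ge
    proof (intro iffI allI)
      fix \<xi>
      assume "\<forall>s. fp_bil n (letter_eval A XY) p (\<lambda>b j. s (b * n + j)) (\<lambda>b j. s (b * n + j))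
        \<le> of_real t * fp_bil n (letter_eval A X) p (\<lambda>b j. s (b * n + j)) (\<lambda>b j. s (b * n + j))
          + of_real (1 - t) * fp_bil n (letter_eval A Y) p (\<lambda>b j. s (b * n + j)) (\<lambda>b j. s (b * n + j))"
      from spec[OF this, of "\<lambda>m. \<xi> (m div n) (m mod n)"]
      show "fp_bil n (letter_eval A XY) p \<xi> \<xi> \<le> of_real t * fp_bil n (letter_eval A X) p \<xi> \<xi>
          + of_real (1 - t) * fp_bil n (letter_eval A Y) p \<xi> \<xi>"
        by (simp only: fp_bil_blocks[OF p])
    qed blast
  qed
  then show ?thesis unfolding convex_in_x_def by (intro all_cong ball_cong refl)
qed

section \<open>Sums, adjoints and squares of polynomials\<close>

lemma fp_add_free_polys:
  assumes "p \<in> free_polys N d" "q \<in> free_polys N d"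
  shows "fp_add p q \<in> free_polys N d"
proof -
  have "fp_supp (fp_add p q) \<subseteq> fp_supp p \<union> fp_supp q"
    using free_polysD(2,3)[OF assms(1)] free_polysD(2,3)[OF assms(2)] by (auto simp: fp_supp_def fp_add_def)
  then show ?thesis
    using assms by (auto simp: free_polys_def fp_add_def intro: finite_subset add_carrier_mat)
qed

lemma fp_bil_add:
  assumes p: "p \<in> free_polys N d" and q: "q \<in> free_polys N d"
  shows "fp_bil n Z (fp_add p q) \<xi> \<eta> = fp_bil n Z p \<xi> \<eta> + fp_bil n Z q \<xi> \<eta>"
proof -
  let ?W = "fp_supp p \<union> fp_supp q \<union> fp_supp (fp_add p q)"
  note pq = fp_add_free_polys[OF p q]
  have fin: "finite ?W" using free_polysD(4)[OF p] free_polysD(4)[OF q] free_polysD(4)[OF pq] by simp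
  have "fp_add p q w $$ (k, b) = p w $$ (k, b) + q w $$ (k, b)" if "k < N" "b < d" for w k b
    using free_polysD(1)[OF p, of w] free_polysD(1)[OF q, of w] that by (simp add: fp_add_def)
  moreover have
    "fp_bil n Z p \<xi> \<eta> = (\<Sum>w\<in>?W. \<Sum>k<N. \<Sum>b<d. p w $$ (k, b) * cinner n (wact n Z w (\<xi> b)) (\<eta> k))"
    "fp_bil n Z q \<xi> \<eta> = (\<Sum>w\<in>?W. \<Sum>k<N. \<Sum>b<d. q w $$ (k, b) * cinner n (wact n Z w (\<xi> b)) (\<eta> k))"
    "fp_bil n Z (fp_add p q) \<xi> \<eta>
      = (\<Sum>w\<in>?W. \<Sum>k<N. \<Sum>b<d. fp_add p q w $$ (k, b) * cinner n (wact n Z w (\<xi> b)) (\<eta> k))"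
    by (rule fp_bil_superset[OF p fin] fp_bil_superset[OF q fin] fp_bil_superset[OF pq fin]; blast)+
  ultimately show ?thesis by (simp add: distrib_right sum.distrib)
qed

lemma fp_adjoint_free_polys:
  assumes p: "p \<in> free_polys N d"
  shows "fp_adjoint p \<in> free_polys d N"
proof -
  have "fp_supp (fp_adjoint p) \<subseteq> rev ` fp_supp p"
  proof
    fix w assume w: "w \<in> fp_supp (fp_adjoint p)"
    have "rev w \<in> fp_supp p"
    proof (rule ccontr)
      assume "rev w \<notin> fp_supp p"
      then have "p (rev w) = 0\<^sub>m N d" using free_polysD(2,3)[OF p, of "rev w"] by (simp add: fp_supp_def)
      then have "fp_adjoint p w = 0\<^sub>m d N"
        using mat_adjoint_carrier[OF zero_carrier_mat[of N d]]
        by (intro eq_matI) (auto simp: fp_adjoint_def mat_adjoint_index[OF zero_carrier_mat])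
      then show False using w by (simp add: fp_supp_def)
    qed
    then show "w \<in> rev ` fp_supp p" by (intro image_eqI[of _ _ "rev w"]) auto
  qed
  then show ?thesis using free_polysD(1,4)[OF p]
    by (auto simp: free_polys_def fp_adjoint_def mat_adjoint_carrier intro: finite_subset)
qed

lemma fp_adjoint_index:
  assumes p: "p \<in> free_polys N d" and "a < d" "k < N"
  shows "fp_adjoint p w $$ (a, k) = cnj (p (rev w) $$ (k, a))"
  using mat_adjoint_index[OF free_polysD(1)[OF p]] assms by (simp add: fp_adjoint_def)

lemma fp_bil_adjoint:
  assumes p: "p \<in> free_polys N d" and Z: "\<And>l. Z l \<in> carrier_mat n n \<and> hermitian_mat (Z l)"
  shows "fp_bil n Z (fp_adjoint p) \<eta> \<xi> = cnj (fp_bil n Z p \<xi> \<eta>)"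
proof -
  let ?W = "fp_supp p \<union> rev ` fp_supp (fp_adjoint p)"
  note p' = fp_adjoint_free_polys[OF p]
  have fin: "finite ?W" "finite (rev ` ?W)" using free_polysD(4)[OF p] free_polysD(4)[OF p'] by auto
  have "fp_bil n Z (fp_adjoint p) \<eta> \<xi> = (\<Sum>w\<in>rev ` ?W. \<Sum>a<d. \<Sum>k<N.
      fp_adjoint p w $$ (a, k) * cinner n (wact n Z w (\<eta> k)) (\<xi> a))"
    by (rule fp_bil_superset[OF p' fin(2)]) (auto simp: image_Un image_image)
  also have "\<dots> = (\<Sum>w\<in>?W. \<Sum>a<d. \<Sum>k<N.
      cnj (p w $$ (k, a)) * cinner n (wact n Z (rev w) (\<eta> k)) (\<xi> a))"
    by (subst sum.reindex) (auto simp: fp_adjoint_index[OF p] inj_on_def intro!: sum.cong)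
  also have "\<dots> = (\<Sum>w\<in>?W. \<Sum>k<N. \<Sum>a<d.
      cnj (p w $$ (k, a)) * cinner n (wact n Z (rev w) (\<eta> k)) (\<xi> a))"
    by (intro sum.cong refl sum.swap)
  also have "\<dots> = (\<Sum>w\<in>?W. \<Sum>k<N. \<Sum>a<d.
      cnj (p w $$ (k, a) * cinner n (wact n Z w (\<xi> a)) (\<eta> k)))"
    by (intro sum.cong refl) (simp add: cinner_wact[OF Z] cinner_commute[of n _ "\<xi> _"])
  also have "\<dots> = cnj (fp_bil n Z p \<xi> \<eta>)"
    by (subst fp_bil_superset[OF p fin(1)]) auto
  finally show ?thesis .
qed

text \<open>The right-hand side has the shape delivered by
  \<open>positive_imp_sum_of_squares\<close>, so the final identity can be checked coefficient by
  coefficient.\<close>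

lemma fp_mult_adjoint_index:
  assumes p: "p \<in> free_polys N d" and "a < d" "b < d"
  shows "fp_mult (fp_adjoint p) p w $$ (a, b)
    = (\<Sum>i\<le>length w. \<Sum>k<N. cnj (p (rev (take i w)) $$ (k, a)) * p (drop i w) $$ (k, b))"
proof -
  note p' = fp_adjoint_free_polys[OF p]
  have splits: "{(u, v). u @ v = w} = (\<lambda>i. (take i w, drop i w)) ` {..length w}"
  proof (intro equalityI subsetI)
    fix x assume "x \<in> {(u, v). u @ v = w}"
    then have "x = (take (length (fst x)) w, drop (length (fst x)) w)" "length (fst x) \<le> length w"
      by (auto simp: prod_eq_iff)
    then show "x \<in> (\<lambda>i. (take i w, drop i w)) ` {..length w}" by blast
  qed auto
  have "fp_mult (fp_adjoint p) p w $$ (a, b)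
      = (\<Sum>(u, v)\<in>{(u, v). u @ v = w}. (fp_adjoint p u * p v) $$ (a, b))"
    using assms(2,3) free_polysD[OF p] free_polysD[OF p']
    by (simp add: fp_mult_def mat_sum_def case_prod_unfold)
  also have "\<dots> = (\<Sum>i\<le>length w. (fp_adjoint p (take i w) * p (drop i w)) $$ (a, b))"
    unfolding splits by (subst sum.reindex) (auto simp: inj_on_def dest: arg_cong[where f = length])
  also have "\<dots> = (\<Sum>i\<le>length w. \<Sum>k<N. cnj (p (rev (take i w)) $$ (k, a)) * p (drop i w) $$ (k, b))"
  proof (rule sum.cong[OF refl])
    fix i
    show "(fp_adjoint p (take i w) * p (drop i w)) $$ (a, b)
        = (\<Sum>k<N. cnj (p (rev (take i w)) $$ (k, a)) * p (drop i w) $$ (k, b))"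
      using free_polysD(1)[OF p, of "drop i w"] free_polysD(1)[OF p', of "take i w"] assms(2,3)
      by (simp add: scalar_prod_def atLeast0LessThan fp_adjoint_index[OF p])
  qed
  finally show ?thesis .
qed

lemma fp_mult_adjoint_free_polys:
  assumes p: "p \<in> free_polys N d"
  shows "fp_mult (fp_adjoint p) p \<in> free_polys d d"
    and "fp_supp (fp_mult (fp_adjoint p) p) \<subseteq> (\<lambda>(u, v). rev u @ v) ` (fp_supp p \<times> fp_supp p)"
proof -
  let ?P = "fp_mult (fp_adjoint p) p"
  have c: "?P w \<in> carrier_mat d d" for w
    using free_polysD[OF p] free_polysD[OF fp_adjoint_free_polys[OF p]]
    by (simp add: fp_mult_def mat_sum_def)
  show s: "fp_supp ?P \<subseteq> (\<lambda>(u, v). rev u @ v) ` (fp_supp p \<times> fp_supp p)"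
  proof (rule subsetI, rule ccontr)
    fix w assume w: "w \<in> fp_supp ?P" "w \<notin> (\<lambda>(u, v). rev u @ v) ` (fp_supp p \<times> fp_supp p)"
    have "?P w $$ (a, b) = 0" if ab: "a < d" "b < d" for a b
      unfolding fp_mult_adjoint_index[OF p ab]
    proof (intro sum.neutral ballI)
      fix i k assume k: "k \<in> {..<N}"
      have "w = rev (rev (take i w)) @ drop i w" by simp
      then have "rev (take i w) \<notin> fp_supp p \<or> drop i w \<notin> fp_supp p" using w(2)
        by (metis (mono_tags, lifting) SigmaI case_prod_conv image_eqI)
      then show "cnj (p (rev (take i w)) $$ (k, a)) * p (drop i w) $$ (k, b) = 0"
        using fp_supp_index[OF p] k ab by auto
    qed
    then have "?P w = 0\<^sub>m d d" using c[of w] by (intro eq_matI) auto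
    then show False using w(1) by (simp add: fp_supp_def)
  qed
  show "?P \<in> free_polys d d"
    using c finite_subset[OF s] free_polysD(4)[OF p] by (simp add: free_polys_def)
qed

text \<open>The coefficients of the square are the image of a Gram kernel under
  \<open>(u, v) \<mapsto> rev u @ v\<close>. By \<open>kpush_pairing\<close> the form becomes a
  double sum over words, and moving \<open>rev u\<close> across the inner product turns it into
  squared norms.\<close>

lemma fp_bil_square:
  assumes p: "p \<in> free_polys N d" and Z: "\<And>l. Z l \<in> carrier_mat n n \<and> hermitian_mat (Z l)"
  shows "fp_bil n Z (fp_mult (fp_adjoint p) p) \<xi> \<xi>
    = (\<Sum>k<N. cinner n (fp_act n Z p \<xi> k) (fp_act n Z p \<xi> k))"
proof -
  let ?S = "fp_supp p" and ?W = "(\<lambda>(u, v). rev u @ v) ` (fp_supp p \<times> fp_supp p)"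
  have fin: "finite ?S" "finite ?W" using free_polysD(4)[OF p] by auto
  define G where "G = (\<lambda>a b u v. \<Sum>k<N. cnj (p u $$ (k, a)) * p v $$ (k, b))"
  let ?t = "\<lambda>a b u v k. (p v $$ (k, b) * cnj (p u $$ (k, a))) * cinner n (wact n Z v (\<xi> b)) (wact n Z u (\<xi> a))"
  define r where "r = (\<lambda>a b w. cinner n (wact n Z w (\<xi> b)) (\<xi> a))"
  have coeff: "fp_mult (fp_adjoint p) p w $$ (a, b) = kpush ?S (\<lambda>u v. rev u @ v) (G a b) w"
    if ab: "a < d" "b < d" for w a b
  proof -
    have "kpush ?S (\<lambda>u v. rev u @ v) (G a b) w
        = (\<Sum>u\<in>?S. \<Sum>v\<in>?S. if rev u @ v = w then G a b (rev (rev u)) v else 0)"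
      by (simp only: kpush_def rev_rev_ident)
    also have "\<dots> = (\<Sum>u\<in>rev ` ?S. \<Sum>v\<in>?S. if u @ v = w then G a b (rev u) v else 0)"
      by (subst sum.reindex) (auto simp: inj_on_def)
    also have "\<dots> = (\<Sum>i\<le>length w. G a b (rev (take i w)) (drop i w))"
    proof (rule sum_splits)
      fix u v assume "u \<notin> rev ` ?S \<or> v \<notin> ?S"
      then have "rev u \<notin> ?S \<or> v \<notin> ?S" by (metis image_eqI rev_rev_ident)
      then show "G a b (rev u) v = 0"
        using fp_supp_index[OF p] ab by (auto simp: G_def intro!: sum.neutral)
    qed (use fin in auto)
    finally show ?thesis by (simp add: fp_mult_adjoint_index[OF p ab] G_def)
  qed
  have "fp_bil n Z (fp_mult (fp_adjoint p) p) \<xi> \<xi> = (\<Sum>w\<in>?W. \<Sum>a<d. \<Sum>b<d.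
      kpush ?S (\<lambda>u v. rev u @ v) (G a b) w * r a b w)"
    unfolding fp_bil_superset[OF fp_mult_adjoint_free_polys(1)[OF p] fin(2) fp_mult_adjoint_free_polys(2)[OF p]]
    by (intro sum.cong refl) (simp add: coeff r_def)
  also have "\<dots> = (\<Sum>a<d. \<Sum>w\<in>?W. \<Sum>b<d. kpush ?S (\<lambda>u v. rev u @ v) (G a b) w * r a b w)"
    by (rule sum.swap)
  also have "\<dots> = (\<Sum>a<d. \<Sum>b<d. \<Sum>w\<in>?W. kpush ?S (\<lambda>u v. rev u @ v) (G a b) w * r a b w)"
    by (intro sum.cong refl sum.swap)
  also have "\<dots> = (\<Sum>a<d. \<Sum>b<d. \<Sum>u\<in>?S. \<Sum>v\<in>?S. G a b u v * r a b (rev u @ v))"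
    by (intro sum.cong refl kpush_pairing fin(2)) auto
  also have "\<dots> = (\<Sum>a<d. \<Sum>b<d. \<Sum>u\<in>?S. \<Sum>v\<in>?S. \<Sum>k<N. ?t a b u v k)"
    by (intro sum.cong refl) (simp add: G_def r_def cinner_wact[where Z = Z, OF Z] wact_append sum_distrib_left sum_distrib_right mult_ac)
  also have "\<dots> = (\<Sum>k<N. \<Sum>a<d. \<Sum>b<d. \<Sum>u\<in>?S. \<Sum>v\<in>?S. ?t a b u v k)"
  proof -
    have "(\<Sum>a<d. \<Sum>b<d. \<Sum>u\<in>?S. \<Sum>v\<in>?S. \<Sum>k<N. ?t a b u v k)
        = (\<Sum>a<d. \<Sum>b<d. \<Sum>u\<in>?S. \<Sum>k<N. \<Sum>v\<in>?S. ?t a b u v k)"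
      by (intro sum.cong refl sum.swap)
    also have "\<dots> = (\<Sum>a<d. \<Sum>b<d. \<Sum>k<N. \<Sum>u\<in>?S. \<Sum>v\<in>?S. ?t a b u v k)"
      by (intro sum.cong refl sum.swap)
    also have "\<dots> = (\<Sum>a<d. \<Sum>k<N. \<Sum>b<d. \<Sum>u\<in>?S. \<Sum>v\<in>?S. ?t a b u v k)"
      by (intro sum.cong refl sum.swap)
    also have "\<dots> = (\<Sum>k<N. \<Sum>a<d. \<Sum>b<d. \<Sum>u\<in>?S. \<Sum>v\<in>?S. ?t a b u v k)"
      by (rule sum.swap)
    finally show ?thesis .
  qed
  also have "\<dots> = (\<Sum>k<N. cinner n (fp_act n Z p \<xi> k) (fp_act n Z p \<xi> k))"
  proof (rule sum.cong[OF refl])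
    fix k
    have act: "fp_act n Z p \<xi> k i = (\<Sum>b<d. \<Sum>w\<in>?S. p w $$ (k, b) * wact n Z w (\<xi> b) i)" for i
      unfolding fp_act_def free_polysD[OF p] by (rule sum.swap)
    have "(\<Sum>a<d. \<Sum>b<d. \<Sum>u\<in>?S. \<Sum>v\<in>?S. ?t a b u v k)
        = (\<Sum>a<d. \<Sum>u\<in>?S. \<Sum>b<d. \<Sum>v\<in>?S. ?t a b u v k)"
      by (intro sum.cong refl sum.swap)
    also have "\<dots> = (\<Sum>a<d. \<Sum>u\<in>?S. cnj (p u $$ (k, a))
        * cinner n (fp_act n Z p \<xi> k) (wact n Z u (\<xi> a)))"
      unfolding act cinner_sum_left cinner_scale_left
      by (simp add: sum_distrib_left mult_ac)
    also have "\<dots> = cnj (cinner n (fp_act n Z p \<xi> k) (fp_act n Z p \<xi> k))"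
    proof -
      have "cinner n (fp_act n Z p \<xi> k) g
          = (\<Sum>a<d. \<Sum>u\<in>?S. p u $$ (k, a) * cinner n (wact n Z u (\<xi> a)) g)" for g
        unfolding act cinner_sum_left cinner_scale_left ..
      then have "cnj (cinner n (fp_act n Z p \<xi> k) (fp_act n Z p \<xi> k))
          = cnj (\<Sum>a<d. \<Sum>u\<in>?S. p u $$ (k, a) * cinner n (wact n Z u (\<xi> a)) (fp_act n Z p \<xi> k))"
        by (rule arg_cong)
      then show ?thesis
        unfolding cnj_sum complex_cnj_mult cinner_commute[of n "fp_act n Z p \<xi> k" "wact n Z _ _"] by (rule sym)

    qed
    also have "\<dots> = cinner n (fp_act n Z p \<xi> k) (fp_act n Z p \<xi> k)"
      by (rule cinner_commute[symmetric])
    finally show "(\<Sum>a<d. \<Sum>b<d. \<Sum>u\<in>?S. \<Sum>v\<in>?S. ?t a b u v k)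
      = cinner n (fp_act n Z p \<xi> k) (fp_act n Z p \<xi> k)" .
  qed
  finally show ?thesis .
qed

section \<open>Pencils, linear squares and the block matrix\<close>

lemma cinner_self: "cinner n f f = of_real (\<Sum>i<n. (cmod (f i))\<^sup>2)"
  unfolding cinner_def of_real_sum complex_norm_square ..

lemma cinner_self_nonneg: "0 \<le> cinner n f f"
  by (simp add: cinner_self less_eq_complex_def sum_nonneg)

text \<open>The defect of convexity is \<open>t * (1 - t)\<close> times the squared norm of
  \<open>f - g\<close>.\<close>

lemma cinner_convex:
  fixes t :: real
  assumes "0 < t" "t < 1" and h: "\<And>i. i < n \<Longrightarrow> h i = of_real t * f i + of_real (1 - t) * g i"
  shows "cinner n h h \<le> of_real t * cinner n f f + of_real (1 - t) * cinner n g g"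
proof -
  have "of_real t * cinner n f f + of_real (1 - t) * cinner n g g - cinner n h h
      = of_real (t * (1 - t)) * cinner n (\<lambda>i. f i - g i) (\<lambda>i. f i - g i)"
    unfolding cinner_def sum_distrib_left sum.distrib[symmetric] sum_subtractf[symmetric]
    by (intro sum.cong refl) (simp add: h algebra_simps)
  also have "0 \<le> \<dots>"
    using assms(1,2) by (simp add: cinner_self less_eq_complex_def sum_nonneg)
  finally show ?thesis by simp
qed

lemma xcount_simps [simp]:
  "xcount [] = 0" "xcount (Avar j # w) = xcount w" "xcount (Xvar j # w) = Suc (xcount w)"
  "xcount (u @ v) = xcount u + xcount v" "xcount (rev w) = xcount w"
  by (simp_all add: xcount_def rev_filter[symmetric])

lemma wact_no_x: "xcount w = 0 \<Longrightarrow> wact n (letter_eval A X) w f = wact n (letter_eval A Y) w f"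
proof (induction w)
  case (Cons l w)
  then show ?case by (cases l) auto
qed simp

lemma mact_affine:
  assumes "X \<in> carrier_mat n n" "Y \<in> carrier_mat n n" "i < n"
  shows "mact n (\<alpha> \<cdot>\<^sub>m X + \<beta> \<cdot>\<^sub>m Y) f i = \<alpha> * mact n X f i + \<beta> * mact n Y f i"
  using assms by (simp add: mact_def sum_distrib_left sum.distrib algebra_simps)

text \<open>At most one letter varies, and the letters to its right act in the same way in all three
  evaluations. Words without \<open>x\<close> need \<open>\<alpha> + \<beta> = 1\<close>.\<close>

lemma wact_affine:
  assumes X: "\<And>j. X j \<in> carrier_mat n n" and Y: "\<And>j. Y j \<in> carrier_mat n n"
    and "\<alpha> + \<beta> = 1" "xcount w \<le> 1" "i < n"
  shows "wact n (letter_eval A (\<lambda>j. \<alpha> \<cdot>\<^sub>m X j + \<beta> \<cdot>\<^sub>m Y j)) w f i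
    = \<alpha> * wact n (letter_eval A X) w f i + \<beta> * wact n (letter_eval A Y) w f i"
  using assms(4,5)
proof (induction w arbitrary: i)
  case Nil
  then show ?case using assms(3) by (simp flip: distrib_right)
next
  case (Cons l w)
  show ?case
  proof (cases l)
    case (Avar j)
    then show ?thesis using Cons
      by (simp add: mact_def sum_distrib_left sum.distrib algebra_simps)
  next
    case (Xvar j)
    then have w0: "xcount w = 0" using Cons.prems by simp
    show ?thesis
      using Xvar mact_affine[OF X Y Cons.prems(2)]
      by (simp add: wact_no_x[OF w0, of n A "\<lambda>j. \<alpha> \<cdot>\<^sub>m X j + \<beta> \<cdot>\<^sub>m Y j" f X] wact_no_x[OF w0, of n A Y f X])
  qed
qed

lemma herm_tuples_combination:
  assumes X: "X \<in> herm_tuples n" and Y: "Y \<in> herm_tuples n"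
  shows "(\<lambda>j. complex_of_real s \<cdot>\<^sub>m X j + complex_of_real t \<cdot>\<^sub>m Y j) \<in> herm_tuples n"
  unfolding herm_tuples_def
proof (intro CollectI allI conjI)
  fix j
  have c: "X j \<in> carrier_mat n n" "Y j \<in> carrier_mat n n" using assms by (auto simp: herm_tuples_def)
  define W where "W = complex_of_real s \<cdot>\<^sub>m X j + complex_of_real t \<cdot>\<^sub>m Y j"
  have cW: "W \<in> carrier_mat n n" using c by (simp add: W_def)
  then show "complex_of_real s \<cdot>\<^sub>m X j + complex_of_real t \<cdot>\<^sub>m Y j \<in> carrier_mat n n" by (simp add: W_def)
  have entry: "W $$ (a, b) = of_real s * X j $$ (a, b) + of_real t * Y j $$ (a, b)"
    if "a < n" "b < n" for a b
    using c that by (simp add: W_def)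
  have X': "X j $$ (b, a) = cnj (X j $$ (a, b))" if "a < n" "b < n" for a b
    using hermitian_mat_iff[OF c(1)] X that unfolding herm_tuples_def by blast
  have Y': "Y j $$ (b, a) = cnj (Y j $$ (a, b))" if "a < n" "b < n" for a b
    using hermitian_mat_iff[OF c(2)] Y that unfolding herm_tuples_def by blast
  have "hermitian_mat W"
    unfolding hermitian_mat_iff[OF cW]
  proof (intro allI impI)
    fix a b assume ab: "a < n" "b < n"
    show "W $$ (b, a) = cnj (W $$ (a, b))"
      unfolding entry[OF ab] entry[OF ab(2,1)] X'[OF ab] Y'[OF ab] by simp
  qed
  then show "hermitian_mat (complex_of_real s \<cdot>\<^sub>m X j + complex_of_real t \<cdot>\<^sub>m Y j)" by (simp add: W_def)
qed

text \<open>The pencil contributes an equality. In the square, the components of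
  \<open>\<Lambda>\<close> applied to a vector are affine in \<open>x\<close>, so their squared
  norms are convex.\<close>

lemma square_plus_pencil_convex:
  assumes L: "L \<in> free_polys d d" "\<And>w. w \<in> fp_supp L \<Longrightarrow> xcount w \<le> 1"
    and \<Lambda>: "\<Lambda> \<in> free_polys N d" "linear_in_x \<Lambda>"
  shows "convex_in_x (fp_add L (fp_mult (fp_adjoint \<Lambda>) \<Lambda>))"
proof -
  let ?P = "fp_mult (fp_adjoint \<Lambda>) \<Lambda>"
  note P = fp_mult_adjoint_free_polys(1)[OF \<Lambda>(1)]
  show ?thesis
    unfolding convex_in_x_iff[OF fp_add_free_polys[OF L(1) P]]
  proof (intro allI impI ballI)
    fix n :: nat and A X Y :: "'a \<Rightarrow> complex mat" and t :: real and \<xi> :: "nat \<Rightarrow> nat \<Rightarrow> complex"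
    assume h: "A \<in> herm_tuples n" "X \<in> herm_tuples n" "Y \<in> herm_tuples n" and t: "0 < t \<and> t < 1"
    define ZX where "ZX = letter_eval A X"
    define ZY where "ZY = letter_eval A Y"
    define XY where "XY = (\<lambda>j. complex_of_real t \<cdot>\<^sub>m X j + complex_of_real (1 - t) \<cdot>\<^sub>m Y j)"
    define Z where "Z = letter_eval A XY"
    have hX: "X j \<in> carrier_mat n n" "Y j \<in> carrier_mat n n" for j
      using h by (auto simp: herm_tuples_def)
    have "XY \<in> herm_tuples n"
      unfolding XY_def by (rule herm_tuples_combination[OF h(2,3)])
    then have herm: "Z l \<in> carrier_mat n n \<and> hermitian_mat (Z l)"
      "ZX l \<in> carrier_mat n n \<and> hermitian_mat (ZX l)" "ZY l \<in> carrier_mat n n \<and> hermitian_mat (ZY l)" for l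
      using letter_eval_herm h unfolding Z_def ZX_def ZY_def by blast+
    define \<alpha> \<beta> where "\<alpha> = complex_of_real t" and "\<beta> = complex_of_real (1 - t)"
    have affine: "wact n Z w f i = \<alpha> * wact n ZX w f i + \<beta> * wact n ZY w f i"
      if "xcount w \<le> 1" "i < n" for w f i
      unfolding Z_def XY_def ZX_def ZY_def \<alpha>_def \<beta>_def
      by (rule wact_affine) (use hX that in auto)
    have "cinner n (wact n Z w (\<xi> b)) (\<xi> k)
        = \<alpha> * cinner n (wact n ZX w (\<xi> b)) (\<xi> k) + \<beta> * cinner n (wact n ZY w (\<xi> b)) (\<xi> k)"
      if "w \<in> fp_supp L" for w b k
      using affine[OF L(2)[OF that]] by (simp add: cinner_def sum_distrib_left sum.distrib algebra_simps)
    then have 1: "fp_bil n Z L \<xi> \<xi> = \<alpha> * fp_bil n ZX L \<xi> \<xi> + \<beta> * fp_bil n ZY L \<xi> \<xi>"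
      by (simp add: fp_bil_def sum_distrib_left sum.distrib algebra_simps)
    have act: "fp_act n Z \<Lambda> \<xi> k i = \<alpha> * fp_act n ZX \<Lambda> \<xi> k i + \<beta> * fp_act n ZY \<Lambda> \<xi> k i"
      if "i < n" for k i
      using affine \<Lambda>(2) that unfolding fp_act_def linear_in_x_def
      by (simp add: sum_distrib_left sum.distrib algebra_simps)
    have "fp_bil n Z ?P \<xi> \<xi> \<le> (\<Sum>k<N. \<alpha> * cinner n (fp_act n ZX \<Lambda> \<xi> k) (fp_act n ZX \<Lambda> \<xi> k)
        + \<beta> * cinner n (fp_act n ZY \<Lambda> \<xi> k) (fp_act n ZY \<Lambda> \<xi> k))"
      unfolding fp_bil_square[OF \<Lambda>(1) herm(1)] \<alpha>_def \<beta>_def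
      by (rule sum_mono, rule cinner_convex) (use t act in \<open>auto simp: \<alpha>_def \<beta>_def\<close>)
    also have "\<dots> = \<alpha> * fp_bil n ZX ?P \<xi> \<xi> + \<beta> * fp_bil n ZY ?P \<xi> \<xi>"
      unfolding fp_bil_square[OF \<Lambda>(1) herm(2)] fp_bil_square[OF \<Lambda>(1) herm(3)]
      by (simp only: sum.distrib sum_distrib_left)
    finally have 2: "fp_bil n Z ?P \<xi> \<xi> \<le> \<alpha> * fp_bil n ZX ?P \<xi> \<xi> + \<beta> * fp_bil n ZY ?P \<xi> \<xi>" .
    have "fp_bil n Z (fp_add L ?P) \<xi> \<xi>
        \<le> \<alpha> * fp_bil n ZX (fp_add L ?P) \<xi> \<xi> + \<beta> * fp_bil n ZY (fp_add L ?P) \<xi> \<xi>"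
      unfolding fp_bil_add[OF L(1) P] 1 using 2 by (simp add: less_eq_complex_def algebra_simps)
    then show "fp_bil n (letter_eval A (\<lambda>j. complex_of_real t \<cdot>\<^sub>m X j + complex_of_real (1 - t) \<cdot>\<^sub>m Y j))
        (fp_add L ?P) \<xi> \<xi> \<le> of_real t * fp_bil n (letter_eval A X) (fp_add L ?P) \<xi> \<xi>
        + of_real (1 - t) * fp_bil n (letter_eval A Y) (fp_add L ?P) \<xi> \<xi>"
      unfolding Z_def XY_def ZX_def ZY_def \<alpha>_def \<beta>_def .
  qed
qed

section \<open>Block matrices and the Schur complement\<close>

lemma sum_lessThan_add: "(\<Sum>k<N + d. f k) = (\<Sum>k<N. f k) + (\<Sum>k<d. f (N + k :: nat) :: 'a::comm_monoid_add)"
  by (induction d) (simp_all add: add.assoc)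

lemma fp_block_index:
  assumes "p \<in> free_polys N N" "q \<in> free_polys N d" "r \<in> free_polys d N" "s \<in> free_polys d d"
  shows "k < N \<Longrightarrow> b < N \<Longrightarrow> fp_block p q r s w $$ (k, b) = p w $$ (k, b)"
    and "k < N \<Longrightarrow> b < d \<Longrightarrow> fp_block p q r s w $$ (k, N + b) = q w $$ (k, b)"
    and "k < d \<Longrightarrow> b < N \<Longrightarrow> fp_block p q r s w $$ (N + k, b) = r w $$ (k, b)"
    and "k < d \<Longrightarrow> b < d \<Longrightarrow> fp_block p q r s w $$ (N + k, N + b) = s w $$ (k, b)"
  using free_polysD(2,3)[OF assms(1), of w] free_polysD(2,3)[OF assms(4), of w]
  by (simp_all add: fp_block_def)

lemma fp_block_free_polys:
  assumes "p \<in> free_polys N N" "q \<in> free_polys N d" "r \<in> free_polys d N" "s \<in> free_polys d d"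
  shows "fp_block p q r s \<in> free_polys (N + d) (N + d)"
proof -
  have c: "fp_block p q r s w \<in> carrier_mat (N + d) (N + d)" for w
    unfolding fp_block_def by (intro four_block_carrier_mat free_polysD(1) assms)
  have "fp_supp (fp_block p q r s) \<subseteq> fp_supp p \<union> fp_supp q \<union> fp_supp r \<union> fp_supp s"
  proof (rule subsetI, rule ccontr)
    fix w assume w: "w \<in> fp_supp (fp_block p q r s)"
      "w \<notin> fp_supp p \<union> fp_supp q \<union> fp_supp r \<union> fp_supp s"
    then have "p w = 0\<^sub>m N N" "q w = 0\<^sub>m N d" "r w = 0\<^sub>m d N" "s w = 0\<^sub>m d d"
      using free_polysD(2,3)[OF assms(1), of w] free_polysD(2,3)[OF assms(2), of w]
        free_polysD(2,3)[OF assms(3), of w] free_polysD(2,3)[OF assms(4), of w]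
      by (simp_all add: fp_supp_def)
    then have "fp_block p q r s w = 0\<^sub>m (N + d) (N + d)"
      by (intro eq_matI) (auto simp: fp_block_def)
    then show False using w(1) by (simp add: fp_supp_def)
  qed
  then show ?thesis using c free_polysD(4)[OF assms(1)] free_polysD(4)[OF assms(2)]
      free_polysD(4)[OF assms(3)] free_polysD(4)[OF assms(4)]
    by (auto simp: free_polys_def intro: finite_subset)
qed

lemma fp_bil_block:
  assumes p: "p \<in> free_polys N N" and q: "q \<in> free_polys N d"
    and r: "r \<in> free_polys d N" and s: "s \<in> free_polys d d"
  shows "fp_bil n Z (fp_block p q r s) \<zeta> \<zeta>
    = fp_bil n Z p \<zeta> \<zeta> + fp_bil n Z q (\<lambda>b. \<zeta> (N + b)) \<zeta>
      + fp_bil n Z r \<zeta> (\<lambda>b. \<zeta> (N + b)) + fp_bil n Z s (\<lambda>b. \<zeta> (N + b)) (\<lambda>b. \<zeta> (N + b))"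
proof -
  let ?B = "fp_block p q r s"
  note B = fp_block_free_polys[OF assms]
  define W where "W = fp_supp p \<union> fp_supp q \<union> fp_supp r \<union> fp_supp s \<union> fp_supp ?B"
  have fin: "finite W"
    using free_polysD(4)[OF p] free_polysD(4)[OF q] free_polysD(4)[OF r] free_polysD(4)[OF s]
      free_polysD(4)[OF B] by (simp add: W_def)
  have sub: "fp_supp p \<subseteq> W" "fp_supp q \<subseteq> W" "fp_supp r \<subseteq> W" "fp_supp s \<subseteq> W" "fp_supp ?B \<subseteq> W"
    by (auto simp: W_def)
  show ?thesis
    unfolding fp_bil_superset[OF p fin sub(1)] fp_bil_superset[OF q fin sub(2)]
      fp_bil_superset[OF r fin sub(3)] fp_bil_superset[OF s fin sub(4)]
      fp_bil_superset[OF B fin sub(5)] sum_lessThan_add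
    by (simp add: fp_block_index[OF assms] sum.distrib add.assoc)
qed

lemma fp_one_free_polys: "fp_one N \<in> free_polys N N"
proof -
  have "fp_supp (fp_one N) \<subseteq> {[]}" by (auto simp: fp_supp_def fp_one_def split: if_splits)
  then show ?thesis by (auto simp: free_polys_def fp_one_def intro: finite_subset)
qed

lemma fp_bil_one:
  fixes Z :: "'m letter \<Rightarrow> complex mat"
  shows "fp_bil n Z (fp_one N) \<eta> \<eta> = (\<Sum>k<N. cinner n (\<eta> k) (\<eta> k))"
proof -
  have "fp_supp (fp_one N :: 'm fpoly) \<subseteq> {[]}" by (auto simp: fp_supp_def fp_one_def split: if_splits)
  from fp_bil_superset[OF fp_one_free_polys _ this] have "fp_bil n Z (fp_one N) \<eta> \<eta>
      = (\<Sum>k<N. \<Sum>b<N. (fp_one N :: 'm fpoly) [] $$ (k, b) * cinner n (\<eta> b) (\<eta> k))"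
    by simp
  also have "\<dots> = (\<Sum>k<N. \<Sum>b<N. if b = k then cinner n (\<eta> b) (\<eta> k) else 0)"
    by (intro sum.cong refl) (auto simp: fp_one_def)
  finally show ?thesis by simp
qed

lemma fp_uminus_free_polys:
  assumes "p \<in> free_polys N d"
  shows "fp_uminus p \<in> free_polys N d" "fp_supp (fp_uminus p) \<subseteq> fp_supp p"
proof -
  show s: "fp_supp (fp_uminus p) \<subseteq> fp_supp p"
  proof (rule subsetI, rule ccontr)
    fix w assume w: "w \<in> fp_supp (fp_uminus p)" "w \<notin> fp_supp p"
    then have "p w = 0\<^sub>m N d" using free_polysD(2,3)[OF assms, of w] by (simp add: fp_supp_def)
    then have "fp_uminus p w = 0\<^sub>m N d" by (intro eq_matI) (auto simp: fp_uminus_def)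
    then show False using w(1) by (simp add: fp_supp_def)
  qed
  show "fp_uminus p \<in> free_polys N d"
    using free_polysD(1,4)[OF assms] finite_subset[OF s] by (simp add: free_polys_def fp_uminus_def)
qed

lemma fp_bil_uminus:
  assumes p: "p \<in> free_polys N d"
  shows "fp_bil n Z (fp_uminus p) \<xi> \<eta> = - fp_bil n Z p \<xi> \<eta>"
proof -
  note u = fp_uminus_free_polys[OF p]
  have "fp_uminus p w $$ (k, b) = - p w $$ (k, b)" if "k < N" "b < d" for w k b
    using free_polysD(2,3)[OF p, of w] that by (simp add: fp_uminus_def)
  then show ?thesis
    unfolding fp_bil_superset[OF u(1) free_polysD(4)[OF p] u(2)]
      fp_bil_superset[OF p free_polysD(4)[OF p] order_refl]
    by (simp add: sum_negf)
qed

text \<open>Completing the square in the first \<open>N\<close> components, i.e. a Schur complement.\<close>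

lemma nsd_iff_block_psd:
  assumes L: "L \<in> free_polys d d" and \<Lambda>: "\<Lambda> \<in> free_polys N d"
    and h: "A \<in> herm_tuples n" "X \<in> herm_tuples n"
  shows "fp_eval n (fp_add L (fp_mult (fp_adjoint \<Lambda>) \<Lambda>)) A X \<preceq> 0\<^sub>m (d * n) (d * n) \<longleftrightarrow>
    psd_mat (fp_eval n (fp_block (fp_one N) \<Lambda> (fp_adjoint \<Lambda>) (fp_uminus L)) A X)"
proof -
  let ?P = "fp_mult (fp_adjoint \<Lambda>) \<Lambda>"
  let ?p = "fp_add L ?P"
  let ?B = "fp_block (fp_one N) \<Lambda> (fp_adjoint \<Lambda>) (fp_uminus L)"
  define Z where "Z = letter_eval A X"
  have Z: "Z l \<in> carrier_mat n n \<and> hermitian_mat (Z l)" for l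
    unfolding Z_def by (rule letter_eval_herm[OF h])
  then have Zc: "letter_eval A X l \<in> carrier_mat n n" for l by (simp add: Z_def)
  note P = fp_mult_adjoint_free_polys(1)[OF \<Lambda>]
  note p = fp_add_free_polys[OF L P]
  note blocks = fp_one_free_polys \<Lambda> fp_adjoint_free_polys[OF \<Lambda>] fp_uminus_free_polys(1)[OF L]
  note B = fp_block_free_polys[OF blocks]
  have form: "fp_bil n Z ?B \<zeta> \<zeta>
      = (\<Sum>k<N. cinner n (\<lambda>i. \<zeta> k i + fp_act n Z \<Lambda> (\<lambda>b. \<zeta> (N + b)) k i)
          (\<lambda>i. \<zeta> k i + fp_act n Z \<Lambda> (\<lambda>b. \<zeta> (N + b)) k i))
        - fp_bil n Z ?p (\<lambda>b. \<zeta> (N + b)) (\<lambda>b. \<zeta> (N + b))" for \<zeta>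
  proof -
    let ?F = "fp_act n Z \<Lambda> (\<lambda>b. \<zeta> (N + b))"
    have "cinner n (\<lambda>i. \<zeta> k i + ?F k i) (\<lambda>i. \<zeta> k i + ?F k i)
        = cinner n (\<zeta> k) (\<zeta> k) + cinner n (?F k) (\<zeta> k) + cnj (cinner n (?F k) (\<zeta> k)) + cinner n (?F k) (?F k)" for k
      by (simp add: cinner_def sum.distrib algebra_simps)
    then show ?thesis
      unfolding fp_bil_block[OF blocks] fp_bil_one fp_bil_adjoint[OF \<Lambda> Z] fp_bil_act[OF \<Lambda>]
        fp_bil_uminus[OF L] fp_bil_add[OF L P] fp_bil_square[OF \<Lambda> Z]
      by (simp add: sum.distrib)
  qed
  show ?thesis
    unfolding nsd_fp_eval_iff[OF p Zc] psd_fp_eval_iff[OF B Zc] Z_def[symmetric]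
  proof (intro iffI allI)
    fix \<zeta> assume neg: "\<forall>\<xi>. fp_bil n Z ?p \<xi> \<xi> \<le> 0"
    have "fp_bil n Z ?p (\<lambda>b. \<zeta> (N + b)) (\<lambda>b. \<zeta> (N + b)) \<le> 0" using neg by blast
    also have "0 \<le> (\<Sum>k<N. cinner n (\<lambda>i. \<zeta> k i + fp_act n Z \<Lambda> (\<lambda>b. \<zeta> (N + b)) k i)
          (\<lambda>i. \<zeta> k i + fp_act n Z \<Lambda> (\<lambda>b. \<zeta> (N + b)) k i))"
      by (intro sum_nonneg cinner_self_nonneg)
    finally show "0 \<le> fp_bil n Z ?B \<zeta> \<zeta>" unfolding form by simp
  next
    fix \<xi> assume pos: "\<forall>\<zeta>. 0 \<le> fp_bil n Z ?B \<zeta> \<zeta>"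
    \<comment> \<open>The first \<open>N\<close> components are chosen to make the completed square
      zero.\<close>
    define \<zeta> where "\<zeta> = (\<lambda>k. if k < N then (\<lambda>i. - fp_act n Z \<Lambda> \<xi> k i) else \<xi> (k - N))"
    have x: "(\<lambda>b. \<zeta> (N + b)) = \<xi>" by (simp add: \<zeta>_def)
    have "0 \<le> fp_bil n Z ?B \<zeta> \<zeta>" using pos by blast
    also have "fp_bil n Z ?B \<zeta> \<zeta> = - fp_bil n Z ?p \<xi> \<xi>"
      unfolding form x by (simp add: \<zeta>_def cinner_def)
    finally show "fp_bil n Z ?p \<xi> \<xi> \<le> 0" by simp
  qed
qed

section \<open>The second difference of a convex polynomial\<close>

instance letter :: (finite) finite
proof
  have "(UNIV :: 'a letter set) = range Avar \<union> range Xvar"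
  proof (intro equalityI subsetI)
    fix x :: "'a letter" show "x \<in> range Avar \<union> range Xvar" by (cases x) auto
  qed simp
  then show "finite (UNIV :: 'a letter set)" by (metis finite_UnI finite_imageI finite)
qed

text \<open>In the alphabet \<open>'m letter + 'm\<close> the letter \<open>Inr j\<close> stands for a second copy \<open>y\<^sub>j\<close> of the
  variable \<open>x\<^sub>j\<close>.\<close>

fun collapse :: "'m letter + 'm \<Rightarrow> 'm letter" where
  "collapse (Inl l) = l"
| "collapse (Inr j) = Xvar j"

section \<open>Words with marked letters\<close>

definition ycount :: "('m letter + 'm) list \<Rightarrow> nat" where
  "ycount w = length (filter (\<lambda>l. \<not> isl l) w)"

lemma ycount_simps [simp]:
  "ycount [] = 0" "ycount (Inl l # w) = ycount w" "ycount (Inr j # w) = Suc (ycount w)"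
  "ycount (u @ v) = ycount u + ycount v" "ycount (rev w) = ycount w"
  by (simp_all add: ycount_def rev_filter[symmetric])

lemma ycount_split: "ycount (take i w) + ycount (drop i w) = ycount w"
  by (metis append_take_drop_id ycount_simps(4))

lemma xcount_split: "xcount (take i w) + xcount (drop i w) = xcount w"
  by (metis append_take_drop_id xcount_simps(4))

lemma xcount_le_length: "xcount w \<le> length w"
  by (simp add: xcount_def)

fun mark :: "nat \<Rightarrow> 'm letter list \<Rightarrow> ('m letter + 'm) list" where
  "mark n [] = []"
| "mark n (Avar j # w) = Inl (Avar j) # mark n w"
| "mark 0 (Xvar j # w) = Inl (Xvar j) # mark 0 w"
| "mark (Suc n) (Xvar j # w) = Inr j # mark n w"

lemma map_collapse_mark [simp]: "map collapse (mark n w) = w"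
  by (induction n w rule: mark.induct) auto

text \<open>Because the first letters \<open>x\<close> are the marked ones, the number of marks in a
  prefix controls its whole \<open>x\<close>-degree: with \<open>n = 2\<close>, a prefix with
  exactly one mark contains exactly one \<open>x\<close>. This is what makes the choice of marking
  in \<open>zero_if_ycount_1\<close> effective.\<close>

lemma ycount_take_mark: "ycount (take i (mark n w)) = min n (xcount (take i w))"
  by (induction n w arbitrary: i rule: mark.induct) (auto split: nat.split simp: take_Cons)

lemma length_mark [simp]: "length (mark n w) = length w"
  by (induction n w rule: mark.induct) auto

lemma ycount_mark: "ycount (mark n w) = min n (xcount w)"
  using ycount_take_mark[of "length w" n w] by simp

fun to_y :: "'m letter \<Rightarrow> 'm letter + 'm" where
  "to_y (Avar j) = Inl (Avar j)"
| "to_y (Xvar j) = Inr j"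

lemma map_collapse_to_y [simp]: "map collapse (map to_y w) = w"
proof -
  have "collapse (to_y l) = l" for l :: "'a letter" by (cases l) auto
  then show ?thesis by (induction w) auto
qed

lemma ycount_to_y [simp]: "ycount (map to_y w) = xcount w"
proof (induction w)
  case (Cons l w)
  then show ?case by (cases l) auto
qed simp

text \<open>Noncommutative binomial expansion: each \<open>x\<close> in \<open>m\<close> is replaced
  by either \<open>x\<close> or \<open>c * y\<close>, and the choices are the words that collapse to
  \<open>m\<close>. The factor 1 at \<open>X\<close> fits the form of
  \<open>mact_affine\<close>.\<close>

lemma wact_expand:
  fixes A X Y :: "'m::finite \<Rightarrow> complex mat"
  assumes X: "\<And>j. X j \<in> carrier_mat n n" and Y: "\<And>j. Y j \<in> carrier_mat n n"
    and "i < n"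
  shows "wact n (letter_eval A (\<lambda>j. 1 \<cdot>\<^sub>m X j + c \<cdot>\<^sub>m Y j)) m f i
    = (\<Sum>w | map collapse w = m. c ^ ycount w * wact n (case_sum (letter_eval A X) Y) w f i)"
  using assms(3)
proof (induction m arbitrary: i)
  case Nil
  then show ?case by simp
next
  case (Cons l m)
  let ?Z = "case_sum (letter_eval A X) Y"
  let ?Zc = "letter_eval A (\<lambda>j. 1 \<cdot>\<^sub>m X j + c \<cdot>\<^sub>m Y j)"
  have fin: "finite {w. map collapse w = m'}" for m' :: "'m letter list"
    by (rule finite_subset[OF _ finite_words[of "length m'"]]) auto
  have "(\<Sum>w | map collapse w = l # m. c ^ ycount w * wact n ?Z w f i)
      = (\<Sum>(z, w)\<in>{z. collapse z = l} \<times> {w. map collapse w = m}. c ^ ycount (z # w) * wact n ?Z (z # w) f i)"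
    by (rule sum.reindex_bij_witness[of _ "\<lambda>(z, w). z # w" "\<lambda>w. (hd w, tl w)"]) auto
  also have "\<dots> = (\<Sum>z | collapse z = l. \<Sum>w | map collapse w = m. c ^ ycount (z # w) * wact n ?Z (z # w) f i)"
    by (rule sum.cartesian_product[symmetric])
  also have "\<dots> = (\<Sum>z | collapse z = l. (if isl z then 1 else c) *
      mact n (?Z z) (\<lambda>k. \<Sum>w | map collapse w = m. c ^ ycount w * wact n ?Z w f k) i)"
  proof (rule sum.cong[OF refl])
    fix z
    have "(\<Sum>w | map collapse w = m. c ^ ycount (z # w) * wact n ?Z (z # w) f i)
        = (\<Sum>w | map collapse w = m. \<Sum>k<n. (if isl z then 1 else c) *
            (?Z z $$ (i, k) * (c ^ ycount w * wact n ?Z w f k)))"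
      by (cases z) (simp_all add: mact_def sum_distrib_left mult_ac)
    also have "\<dots> = (\<Sum>k<n. \<Sum>w | map collapse w = m. (if isl z then 1 else c) *
            (?Z z $$ (i, k) * (c ^ ycount w * wact n ?Z w f k)))"
      by (rule sum.swap)
    finally show "(\<Sum>w | map collapse w = m. c ^ ycount (z # w) * wact n ?Z (z # w) f i)
        = (if isl z then 1 else c) *
          mact n (?Z z) (\<lambda>k. \<Sum>w | map collapse w = m. c ^ ycount w * wact n ?Z w f k) i"
      by (simp add: mact_def sum_distrib_left)
  qed
  also have "\<dots> = (\<Sum>z | collapse z = l. (if isl z then 1 else c) * mact n (?Z z) (wact n ?Zc m f) i)"
    using Cons.IH by (intro sum.cong refl arg_cong2[where f = "(*)"] fun_cong[OF mact_cong]) simp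
  also have "\<dots> = mact n (?Zc l) (wact n ?Zc m f) i"
  proof (cases l)
    case (Avar j)
    have "{z. collapse z = l} = {Inl (Avar j)}"
      using Avar by (auto elim: collapse.elims)
    then show ?thesis using Avar by simp
  next
    case (Xvar j)
    have "{z. collapse z = l} = {Inl (Xvar j), Inr j}"
      using Xvar by (auto elim: collapse.elims)
    then show ?thesis using Xvar mact_affine[OF X Y Cons.prems, of 1 j c j] by simp
  qed
  finally show ?case by simp
qed

lemma fp_bil_expand:
  fixes p :: "'m::finite fpoly"
  assumes p: "p \<in> free_polys d d" and K: "\<And>w. w \<in> fp_supp p \<Longrightarrow> length w \<le> K"
    and X: "\<And>j. X j \<in> carrier_mat n n" and Y: "\<And>j. Y j \<in> carrier_mat n n"
  shows "fp_bil n (letter_eval A (\<lambda>j. 1 \<cdot>\<^sub>m X j + c \<cdot>\<^sub>m Y j)) p \<xi> \<xi>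
    = (\<Sum>w | length w \<le> K. \<Sum>a<d. \<Sum>b<d. c ^ ycount w * p (map collapse w) $$ (a, b) *
        cinner n (wact n (case_sum (letter_eval A X) Y) w (\<xi> b)) (\<xi> a))"
proof -
  let ?Z = "case_sum (letter_eval A X) Y"
  let ?Zc = "letter_eval A (\<lambda>j. 1 \<cdot>\<^sub>m X j + c \<cdot>\<^sub>m Y j)"
  define g where "g = (\<lambda>w. \<Sum>a<d. \<Sum>b<d. c ^ ycount w * p (map collapse w) $$ (a, b) *
        cinner n (wact n ?Z w (\<xi> b)) (\<xi> a))"
  have expand: "cinner n (wact n ?Zc m f) h
      = (\<Sum>w | map collapse w = m. c ^ ycount w * cinner n (wact n ?Z w f) h)" for m f h
  proof -
    have "cinner n (wact n ?Zc m f) h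
        = cinner n (\<lambda>i. \<Sum>w | map collapse w = m. c ^ ycount w * wact n ?Z w f i) h"
      by (rule cinner_cong[OF wact_expand[OF X Y] refl])
    then show ?thesis unfolding cinner_sum_left cinner_scale_left .
  qed
  have "fp_bil n ?Zc p \<xi> \<xi> = (\<Sum>m | length m \<le> K. \<Sum>a<d. \<Sum>b<d.
      p m $$ (a, b) * cinner n (wact n ?Zc m (\<xi> b)) (\<xi> a))"
    by (rule fp_bil_superset[OF p finite_words]) (use K in auto)
  also have "\<dots> = (\<Sum>m | length m \<le> K. \<Sum>a<d. \<Sum>b<d. \<Sum>w | map collapse w = m.
      c ^ ycount w * p (map collapse w) $$ (a, b) * cinner n (wact n ?Z w (\<xi> b)) (\<xi> a))"
    unfolding expand sum_distrib_left by (intro sum.cong refl) auto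
  also have "\<dots> = (\<Sum>m | length m \<le> K. \<Sum>a<d. \<Sum>w | map collapse w = m. \<Sum>b<d.
      c ^ ycount w * p (map collapse w) $$ (a, b) * cinner n (wact n ?Z w (\<xi> b)) (\<xi> a))"
    by (intro sum.cong refl sum.swap)
  also have "\<dots> = (\<Sum>m | length m \<le> K. \<Sum>w | map collapse w = m. g w)"
    unfolding g_def by (intro sum.cong refl sum.swap)
  also have "\<dots> = (\<Sum>m | length m \<le> K. \<Sum>w\<in>{w \<in> {w. length w \<le> K}. map collapse w = m}. g w)"
    by (intro sum.cong refl) auto
  also have "\<dots> = (\<Sum>w | length w \<le> K. g w)"
    by (rule sum.group) (auto simp: finite_words)
  finally show ?thesis by (simp add: g_def)
qed

text \<open>The coefficient of a word \<open>w\<close> in \<open>p(a,x+y) + p(a,x-y) - 2 p(a,x)\<close> is that of its image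
  under \<open>y \<mapsto> x\<close>, multiplied by the following factor for \<open>n = ycount w\<close>.\<close>

definition second_difference_factor :: "nat \<Rightarrow> complex" where
  "second_difference_factor n = 1 ^ n + (- 1) ^ n - 2 * 0 ^ n"

lemma second_difference_factor_simps [simp]:
  "second_difference_factor 0 = 0" "second_difference_factor 2 = 2"
  by (simp_all add: second_difference_factor_def)

lemma cnj_second_difference_factor [simp]:
  "cnj (second_difference_factor n) = second_difference_factor n"
  by (simp add: second_difference_factor_def)

text \<open>Convexity at \<open>t = 1/2\<close> between \<open>x + y\<close> and
  \<open>x - y\<close>, whose midpoint is \<open>x\<close>. The three evaluations are the cases
  \<open>c = 1\<close>, \<open>c = - 1\<close> and \<open>c = 0\<close> of one expansion in
  \<open>x + c * y\<close>.\<close>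

lemma second_difference_nonneg:
  fixes p :: "'m::finite fpoly"
  assumes p: "p \<in> free_polys d d" and K: "\<And>w. w \<in> fp_supp p \<Longrightarrow> length w \<le> K"
    and conv: "convex_in_x p" and n: "0 < n"
    and Z: "\<And>l. Z l \<in> carrier_mat n n \<and> hermitian_mat (Z l)"
  shows "0 \<le> Re (\<Sum>w | length w \<le> K. \<Sum>a<d. \<Sum>b<d.
    second_difference_factor (ycount w) * p (map collapse w) $$ (a, b) * cinner n (wact n Z w (\<xi> b)) (\<xi> a))"
proof -
  define A where "A = (\<lambda>j. Z (Inl (Avar j)))"
  define X where "X = (\<lambda>j. Z (Inl (Xvar j)))"
  define Y where "Y = (\<lambda>j. Z (Inr j))"
  have h: "A \<in> herm_tuples n" "X \<in> herm_tuples n" "Y \<in> herm_tuples n"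
    using Z by (auto simp: herm_tuples_def A_def X_def Y_def)
  have XY: "X j \<in> carrier_mat n n" "Y j \<in> carrier_mat n n" for j using Z by (auto simp: X_def Y_def)
  have Zeq: "case_sum (letter_eval A X) Y = Z"
  proof
    fix z show "case_sum (letter_eval A X) Y z = Z z"
    proof (cases z)
      case (Inl l)
      then show ?thesis by (cases l) (auto simp: A_def X_def)
    qed (simp add: Y_def)
  qed
  define V where "V = (\<lambda>c j. (1::complex) \<cdot>\<^sub>m X j + c \<cdot>\<^sub>m Y j)"
  have V: "V (of_real c) \<in> herm_tuples n" for c
    using herm_tuples_combination[OF h(2,3), of 1 c] by (simp add: V_def)
  define F where "F = (\<lambda>c. fp_bil n (letter_eval A (V c)) p \<xi> \<xi>)"
  define T where "T = (\<lambda>w a b. p (map collapse w) $$ (a, b) * cinner n (wact n Z w (\<xi> b)) (\<xi> a))"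
  have F: "F c = (\<Sum>w | length w \<le> K. \<Sum>a<d. \<Sum>b<d. c ^ ycount w * T w a b)" for c
    using fp_bil_expand[where p = p and K = K and X = X and Y = Y and A = A and c = c and \<xi> = \<xi>, OF p K XY]
    unfolding F_def V_def Zeq by (simp add: T_def mult.assoc)
  have mid: "(\<lambda>j. of_real (1/2) \<cdot>\<^sub>m V 1 j + of_real (1 - 1/2) \<cdot>\<^sub>m V (- 1) j) = V 0"
  proof
    fix j
    show "of_real (1/2) \<cdot>\<^sub>m V 1 j + of_real (1 - 1/2) \<cdot>\<^sub>m V (- 1) j = V 0 j"
      unfolding V_def using XY[of j] by (intro eq_matI) (auto simp: field_simps)
  qed
  have "F 0 \<le> of_real (1/2) * F 1 + of_real (1 - 1/2) * F (- 1)"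
    using conv n h(1) V[of 1] V[of "- 1"] unfolding convex_in_x_iff[OF p] F_def mid[symmetric]
    by (elim allE[of _ n] impE ballE[of _ _ A] ballE[of _ _ "V 1"] ballE[of _ _ "V (- 1)"] allE[of _ "1/2"]) auto
  then have "Re (F 0) \<le> Re (F 1) / 2 + Re (F (- 1)) / 2"
    by (simp add: less_eq_complex_def)
  then have "0 \<le> Re (F 1 + F (- 1) - 2 * F 0)" by simp
  also have "F 1 + F (- 1) - 2 * F 0
      = (\<Sum>w | length w \<le> K. \<Sum>a<d. \<Sum>b<d. second_difference_factor (ycount w) * T w a b)"
    unfolding F sum_distrib_left sum.distrib[symmetric] sum_subtractf[symmetric]
    by (intro sum.cong refl) (simp add: second_difference_factor_def algebra_simps)
  finally show ?thesis by (simp add: T_def mult.assoc)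
qed

section \<open>Which words can occur in the squares\<close>

lemma sum_splits_middle:
  fixes \<Lambda> :: "nat \<Rightarrow> 'l list \<Rightarrow> nat \<Rightarrow> complex"
  assumes "\<And>i k. i \<le> 2 * length v \<Longrightarrow> i \<noteq> length v \<Longrightarrow> k < N \<Longrightarrow>
    \<Lambda> k (rev (take i (rev v @ v))) b = 0 \<or> \<Lambda> k (drop i (rev v @ v)) b = 0"
  shows "(\<Sum>i\<le>length (rev v @ v). \<Sum>k<N. cnj (\<Lambda> k (rev (take i (rev v @ v))) b) * \<Lambda> k (drop i (rev v @ v)) b)
    = of_real (\<Sum>k<N. (cmod (\<Lambda> k v b))\<^sup>2)"
proof -
  have "(\<Sum>i\<le>length (rev v @ v). \<Sum>k<N. cnj (\<Lambda> k (rev (take i (rev v @ v))) b) * \<Lambda> k (drop i (rev v @ v)) b)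
      = (\<Sum>i\<in>{length v}. \<Sum>k<N. cnj (\<Lambda> k (rev (take i (rev v @ v))) b) * \<Lambda> k (drop i (rev v @ v)) b)"
  proof (rule sum.mono_neutral_right)
    show "\<forall>i\<in>{..length (rev v @ v)} - {length v}.
        (\<Sum>k<N. cnj (\<Lambda> k (rev (take i (rev v @ v))) b) * \<Lambda> k (drop i (rev v @ v)) b) = 0"
    proof (intro ballI sum.neutral)
      fix i k assume "i \<in> {..length (rev v @ v)} - {length v}" "k \<in> {..<N}"
      then show "cnj (\<Lambda> k (rev (take i (rev v @ v))) b) * \<Lambda> k (drop i (rev v @ v)) b = 0"
        using assms[of i k] by auto
    qed
  qed auto
  also have "\<dots> = (\<Sum>k<N. \<Lambda> k v b * cnj (\<Lambda> k v b))" by (simp add: mult.commute)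
  also have "\<dots> = of_real (\<Sum>k<N. (cmod (\<Lambda> k v b))\<^sup>2)"
    unfolding of_real_sum complex_norm_square ..
  finally show ?thesis .
qed

text \<open>Cutting \<open>rev v @ v\<close> off the middle leaves one factor that, reversed if it
  is the left one, properly extends \<open>v\<close> on the left. A \<open>v\<close> of maximal
  length in a suitable class therefore isolates the middle cut.\<close>

lemma take_rev_append_longer:
  assumes "length v < i" "i \<le> 2 * length v"
  obtains s where "rev (take i (rev v @ v)) = s @ v" "s \<noteq> []"
proof
  show "rev (take i (rev v @ v)) = rev (take (i - length v) v) @ v" using assms by simp
  show "rev (take (i - length v) v) \<noteq> []" using assms by auto
qed

lemma drop_rev_append_longer:
  assumes "i < length v"
  obtains s where "drop i (rev v @ v) = s @ v" "s \<noteq> []"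
proof
  show "drop i (rev v @ v) = drop i (rev v) @ v" using assms by simp
  show "drop i (rev v) \<noteq> []" using assms by simp
qed

text \<open>Only the coefficients of \<open>p\<close> and the sum of squares identity are kept. As
  \<open>c\<close> is indexed by unmarked words, words with different markings but equally many
  marks share a coefficient.\<close>

locale second_difference_squares =
  fixes c :: "'m::finite letter list \<Rightarrow> nat \<Rightarrow> nat \<Rightarrow> complex"
    and \<Lambda> :: "nat \<Rightarrow> ('m letter + 'm) list \<Rightarrow> nat \<Rightarrow> complex"
    and N K d :: nat
  assumes bounded: "\<And>k v b. K < length v \<Longrightarrow> \<Lambda> k v b = 0"
    and squares: "\<And>w a b. a < d \<Longrightarrow> b < d \<Longrightarrow>
      second_difference_factor (ycount w) * c (map collapse w) a b
        = (\<Sum>i\<le>length w. \<Sum>k<N. cnj (\<Lambda> k (rev (take i w)) a) * \<Lambda> k (drop i w) b)"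
begin

text \<open>For a longest counterexample \<open>m\<close> only the middle cut of
  \<open>rev m @ m\<close> contributes. That word has no \<open>y\<close>, so its coefficient is 0,
  and a vanishing sum of squares forces each term to vanish.\<close>

lemma zero_if_ycount_0:
  assumes "b < d" "k < N" "ycount v = 0"
  shows "\<Lambda> k v b = 0"
proof (rule ccontr)
  assume nz: "\<Lambda> k v b \<noteq> 0"
  define P where "P = (\<lambda>v. ycount v = 0 \<and> (\<exists>k<N. \<Lambda> k v b \<noteq> 0))"
  have "P v" using assms nz by (auto simp: P_def)
  moreover have "\<forall>v. P v \<longrightarrow> length v < Suc K" using bounded by (metis P_def not_less_eq)
  ultimately have "\<exists>m. P m \<and> (\<forall>u. P u \<longrightarrow> length u \<le> length m)"
    by (rule ex_has_greatest_nat)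
  then obtain m where m: "P m" "\<And>u. P u \<Longrightarrow> length u \<le> length m" by (elim exE conjE) simp
  have "of_real (\<Sum>k<N. (cmod (\<Lambda> k m b))\<^sup>2)
      = (\<Sum>i\<le>length (rev m @ m). \<Sum>k<N. cnj (\<Lambda> k (rev (take i (rev m @ m))) b) * \<Lambda> k (drop i (rev m @ m)) b)"
  proof (rule sum_splits_middle[symmetric])
    fix i k assume i: "i \<le> 2 * length m" "i \<noteq> length m" and k: "k < N"
    have short: "\<Lambda> k (s @ m) b = 0" if "s \<noteq> []" "ycount s = 0" for s
      using m(2)[of "s @ m"] that m(1) k by (auto simp: P_def)
    show "\<Lambda> k (rev (take i (rev m @ m))) b = 0 \<or> \<Lambda> k (drop i (rev m @ m)) b = 0"
    proof (cases "i < length m")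
      case True
      then obtain s where s: "drop i (rev m @ m) = s @ m" "s \<noteq> []" by (rule drop_rev_append_longer)
      have "ycount (s @ m) \<le> ycount (rev m @ m)" by (metis ycount_split le_add2 s(1))
      then have "ycount s = 0" using m(1) by (simp add: P_def)
      then show ?thesis using short[OF s(2)] s(1) by metis
    next
      case False
      then obtain s where s: "rev (take i (rev m @ m)) = s @ m" "s \<noteq> []"
        using i by (metis linorder_neqE_nat take_rev_append_longer)
      have "ycount (s @ m) \<le> ycount (rev m @ m)"
        by (metis ycount_split le_add1 ycount_simps(5) s(1))
      then have "ycount s = 0" using m(1) by (simp add: P_def)
      then show ?thesis using short[OF s(2)] s(1) by metis
    qed
  qed
  also have "\<dots> = 0" using squares[OF assms(1,1), of "rev m @ m"] m(1) by (simp add: P_def)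
  finally have "(\<Sum>k<N. (cmod (\<Lambda> k m b))\<^sup>2) = 0" by (simp only: of_real_eq_0_iff)
  then have "\<forall>k<N. \<Lambda> k m b = 0" by (simp add: sum_nonneg_eq_0_iff)
  then show False using m(1) by (auto simp: P_def)
qed

text \<open>Each factor carries at least one of the two letters \<open>y\<close>, by
  \<open>zero_if_ycount_0\<close>.\<close>

lemma ycount_split_1:
  assumes "a < d" "b < d" "k < N" "k' < N" "ycount w = 2"
    and "\<Lambda> k (rev (take i w)) a \<noteq> 0" "\<Lambda> k' (drop i w) b \<noteq> 0"
  shows "ycount (take i w) = 1" "ycount (drop i w) = 1"
proof -
  have "ycount (take i w) \<noteq> 0" "ycount (drop i w) \<noteq> 0"
    using zero_if_ycount_0[OF assms(1,3), of "rev (take i w)"] zero_if_ycount_0[OF assms(2,4)] assms(6,7)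
    by auto
  then show "ycount (take i w) = 1" "ycount (drop i w) = 1"
    using ycount_split[of i w] assms(5) by linarith+
qed

lemma squares_nonzero_split:
  assumes "a < d" "b < d" "ycount w = 2" "c (map collapse w) a b \<noteq> 0"
  obtains i k where "k < N" "\<Lambda> k (rev (take i w)) a \<noteq> 0" "\<Lambda> k (drop i w) b \<noteq> 0"
    "ycount (take i w) = 1" "ycount (drop i w) = 1"
proof -
  have "second_difference_factor (ycount w) * c (map collapse w) a b \<noteq> 0"
    using assms(3,4) by simp
  then have "(\<Sum>i\<le>length w. \<Sum>k<N. cnj (\<Lambda> k (rev (take i w)) a) * \<Lambda> k (drop i w) b) \<noteq> 0"
    unfolding squares[OF assms(1,2)] .
  then obtain i where "(\<Sum>k<N. cnj (\<Lambda> k (rev (take i w)) a) * \<Lambda> k (drop i w) b) \<noteq> 0"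
    by (meson sum.not_neutral_contains_not_neutral)
  then obtain k where "k \<in> {..<N}" "cnj (\<Lambda> k (rev (take i w)) a) * \<Lambda> k (drop i w) b \<noteq> 0"
    by (meson sum.not_neutral_contains_not_neutral)
  then have "k < N" "\<Lambda> k (rev (take i w)) a \<noteq> 0" "\<Lambda> k (drop i w) b \<noteq> 0" by auto
  then show ?thesis using that[of k i] ycount_split_1[OF assms(1,2), of k k w i] assms(3) by blast
qed

text \<open>Take a counterexample \<open>v\<close> of maximal \<open>x\<close>-degree and then of maximal length. The coefficient of
  \<open>v\<^sup>* v\<close> does not vanish, so neither does that of the word in which instead the first two letters
  are the \<open>y\<close>'s; but the latter only factors with an even larger \<open>x\<close>-degree on the right.\<close>

lemma zero_if_ycount_1:
  assumes "b < d" "k < N" "ycount v = 1" "2 \<le> xcount (map collapse v)"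
  shows "\<Lambda> k v b = 0"
proof (rule ccontr)
  assume nz: "\<Lambda> k v b \<noteq> 0"
  let ?x = "\<lambda>v :: ('m letter + 'm) list. xcount (map collapse v)"
  define P where "P = (\<lambda>v. ycount v = 1 \<and> 2 \<le> ?x v \<and> (\<exists>k<N. \<Lambda> k v b \<noteq> 0))"
  \<comment> \<open>Lexicographic order by \<open>x\<close>-degree and then length: lengths are at
    most \<open>K\<close>, below the weight \<open>K + 1\<close>.\<close>
  define f where "f = (\<lambda>v. ?x v * (K + 1) + length v)"
  have "P v" using assms nz by (auto simp: P_def)
  have len: "length u \<le> K" if "P u" for u using bounded that by (metis P_def not_le)
  have "f u \<le> K * (K + 1) + K" if "P u" for u
  proof -
    have "?x u \<le> K" using len[OF that] xcount_le_length[of "map collapse u"] by simp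
    then show ?thesis unfolding f_def by (intro add_mono mult_right_mono len that) auto
  qed
  then have "\<forall>u. P u \<longrightarrow> f u < Suc (K * (K + 1) + K)" unfolding less_Suc_eq_le by blast
  with \<open>P v\<close> have "\<exists>m. P m \<and> (\<forall>u. P u \<longrightarrow> f u \<le> f m)" by (rule ex_has_greatest_nat)
  then obtain m where m: "P m" "\<And>u. P u \<Longrightarrow> f u \<le> f m" by (elim exE conjE) simp
  have ym: "ycount m = 1" and xm: "2 \<le> ?x m" using m(1) by (auto simp: P_def)
  let ?w = "rev m @ m"
  have "of_real (\<Sum>k<N. (cmod (\<Lambda> k m b))\<^sup>2)
      = (\<Sum>i\<le>length ?w. \<Sum>k<N. cnj (\<Lambda> k (rev (take i ?w)) b) * \<Lambda> k (drop i ?w) b)"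
  proof (rule sum_splits_middle[symmetric], rule ccontr)
    fix i k assume i: "i \<le> 2 * length m" "i \<noteq> length m" and k: "k < N"
    assume "\<not> (\<Lambda> k (rev (take i ?w)) b = 0 \<or> \<Lambda> k (drop i ?w) b = 0)"
    then have n: "\<Lambda> k (rev (take i ?w)) b \<noteq> 0" "\<Lambda> k (drop i ?w) b \<noteq> 0" by auto
    note y = ycount_split_1[OF assms(1,1) k k _ n]
    have yw: "ycount ?w = 2" using ym by simp
    have "False" if "s \<noteq> []" "ycount (s @ m) = 1" "\<Lambda> k (s @ m) b \<noteq> 0" for s
    proof -
      have "P (s @ m)" using that k xm by (auto simp: P_def)
      then have "f (s @ m) \<le> f m" by (rule m(2))
      moreover have "f (s @ m) = f m + (?x s * (K + 1) + length s)" by (simp add: f_def algebra_simps)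
      ultimately show False using that(1) by simp
    qed note long = this
    show False
    proof (cases "i < length m")
      case True
      then obtain s where s: "drop i ?w = s @ m" "s \<noteq> []" by (rule drop_rev_append_longer)
      then show False using long[OF s(2)] n(2) y(2)[OF yw] unfolding s(1) by blast
    next
      case False
      then obtain s where s: "rev (take i ?w) = s @ m" "s \<noteq> []"
        using i by (metis linorder_neqE_nat take_rev_append_longer)
      have "ycount (s @ m) = 1" by (metis s(1) y(1)[OF yw] ycount_simps(5))
      then show False using long[OF s(2)] n(1)[unfolded s(1)] by blast
    qed
  qed
  moreover have "(\<Sum>k<N. (cmod (\<Lambda> k m b))\<^sup>2) \<noteq> 0"
    using m(1) by (auto simp: P_def sum_nonneg_eq_0_iff)
  ultimately have "second_difference_factor (ycount ?w) * c (map collapse ?w) b b \<noteq> 0"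
    unfolding squares[OF assms(1,1)] by (metis of_real_eq_0_iff)
  then have cw: "c (map collapse ?w) b b \<noteq> 0" by simp
  have xw: "?x ?w = 2 * ?x m" by (simp add: rev_map[symmetric])
  define w' where "w' = mark 2 (map collapse ?w)"
  have w': "map collapse w' = map collapse ?w" "ycount w' = 2"
    using xm xw by (simp_all only: w'_def map_collapse_mark ycount_mark)
  obtain i k where k: "k < N" "\<Lambda> k (drop i w') b \<noteq> 0"
    and y: "ycount (take i w') = 1" "ycount (drop i w') = 1"
    using squares_nonzero_split[OF assms(1,1) w'(2)] cw unfolding w'(1) by metis
  \<comment> \<open>The left factor has one \<open>y\<close>, hence one \<open>x\<close> in total.
    The remaining \<open>2 * ?x m - 1\<close> fall to the right factor, which exceeds
    \<open>?x m\<close> exactly because \<open>2 \<le> ?x m\<close>.\<close>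
  have "min 2 (xcount (take i (map collapse ?w))) = 1"
    using y(1) unfolding w'_def ycount_take_mark .
  then have "xcount (take i (map collapse ?w)) = 1" by (auto simp: min_def split: if_splits)
  then have "?x (drop i w') = 2 * ?x m - 1"
    using xcount_split[of i "map collapse w'"] xw unfolding w'(1) drop_map[symmetric] by simp
  then have x': "?x m + 1 \<le> ?x (drop i w')" using xm by simp
  then have "P (drop i w')" using k y xm by (auto simp: P_def)
  then have "f (drop i w') \<le> f m" by (rule m(2))
  moreover have "(?x m + 1) * (K + 1) \<le> ?x (drop i w') * (K + 1)" by (rule mult_right_mono[OF x']) simp
  ultimately show False using len[OF m(1)] unfolding f_def by simp
qed

text \<open>With two letters marked, a nonzero coefficient would need a cut into two factors with
  one mark each. By \<open>zero_if_ycount_1\<close> each has total \<open>x\<close>-degree at most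
  1, leaving no room for a third \<open>x\<close>.\<close>

lemma coeff_zero_if_xcount_ge_3:
  assumes "a < d" "b < d" "3 \<le> xcount m"
  shows "c m a b = 0"
proof (rule ccontr)
  assume nz: "c m a b \<noteq> 0"
  let ?w = "mark 2 m"
  have "ycount ?w = 2" using assms(3) by (simp add: ycount_mark)
  then obtain i k where k: "k < N" "\<Lambda> k (rev (take i ?w)) a \<noteq> 0" "\<Lambda> k (drop i ?w) b \<noteq> 0"
    and y: "ycount (take i ?w) = 1" "ycount (drop i ?w) = 1"
    using squares_nonzero_split[OF assms(1,2), of ?w] nz by (metis map_collapse_mark)
  have "xcount (map collapse (rev (take i ?w))) < 2"
    using zero_if_ycount_1[OF assms(1) k(1), of "rev (take i ?w)"] k(2) y(1) by force
  moreover have "xcount (map collapse (drop i ?w)) < 2"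
    using zero_if_ycount_1[OF assms(2) k(1), of "drop i ?w"] k(3) y(2) by force
  ultimately show False
    using assms(3) xcount_split[of i m] by (simp add: rev_map[symmetric] take_map[symmetric] drop_map[symmetric])
qed

text \<open>Both letters \<open>x\<close> are marked, so the factor of the second difference is
  2.\<close>

lemma coeff_if_xcount_2:
  assumes "a < d" "b < d" "xcount m = 2"
  shows "2 * c m a b = (\<Sum>i\<le>length m. \<Sum>k<N.
    cnj (\<Lambda> k (map to_y (rev (take i m))) a) * \<Lambda> k (map to_y (drop i m)) b)"
  using squares[OF assms(1,2), of "map to_y m"] assms(3)
  by (simp del: map_map add: take_map drop_map rev_map)

end

section \<open>Assembly of the pencil and the linear square\<close>

lemma convex_decomposition:
  fixes p :: "'m::finite fpoly"
  assumes p: "p \<in> free_polys d d" and herm: "fp_hermitian p" and conv: "convex_in_x p"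
  shows "fp_xdegree p \<le> 2 \<and> (\<exists>L \<in> hermitian_pencils d. \<exists>N > 0. \<exists>\<Lambda> \<in> free_polys N d.
    linear_in_x \<Lambda> \<and> p = fp_add L (fp_mult (fp_adjoint \<Lambda>) \<Lambda>))"
proof -
  define K where "K = Max (length ` fp_supp p)"
  have K: "length w \<le> K" if "w \<in> fp_supp p" for w
    using that free_polysD(4)[OF p] by (simp add: K_def)
  have p_herm: "p (rev m) $$ (b, a) = cnj (p m $$ (a, b))" if "a < d" "b < d" for m a b
    using fp_adjoint_index[OF p that(2,1), of "rev m"] herm by (simp add: fp_hermitian_def)
  \<comment> \<open>Cut off outside the range, where matrix entries are unspecified, since symmetry
    is required for all \<open>a\<close> and \<open>b\<close>.\<close>
  define q where "q = (\<lambda>w a b. if a < d \<and> b < d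
    then second_difference_factor (ycount w) * p (map collapse w) $$ (a, b) else 0)"
  have "\<exists>N > (0 :: nat). \<exists>\<Lambda>. (\<forall>k v b. K < length v \<longrightarrow> \<Lambda> k v b = 0) \<and>
    (\<forall>w. \<forall>a<d. \<forall>b<d. q w a b =
      (\<Sum>i\<le>length w. \<Sum>k<N. cnj (\<Lambda> k (rev (take i w)) a) * \<Lambda> k (drop i w) b))"
  proof (rule positive_imp_sum_of_squares)
    show "q (rev w) b a = cnj (q w a b)" for w a b
      by (simp add: q_def p_herm rev_map[symmetric])
  next
    fix w :: "('m letter + 'm) list" and a b assume "2 * K < length w"
    then have "map collapse w \<notin> fp_supp p" using K[of "map collapse w"] by auto
    then show "q w a b = 0" by (simp add: q_def fp_supp_index[OF p])
  next
    fix n :: nat and Z :: "'m letter + 'm \<Rightarrow> complex mat" and \<xi>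
    assume n: "0 < n" and Z: "\<And>l. Z l \<in> carrier_mat n n \<and> hermitian_mat (Z l)"
    have K2: "length w \<le> 2 * K" if "w \<in> fp_supp p" for w using K[OF that] by simp
    show "0 \<le> Re (\<Sum>w | length w \<le> 2 * K. \<Sum>a<d. \<Sum>b<d. q w a b * cinner n (wact n Z w (\<xi> b)) (\<xi> a))"
      using second_difference_nonneg[of p d "2 * K" n Z \<xi>, OF p K2 conv n Z] by (simp add: q_def)
  qed
  then obtain N :: nat and \<Lambda> where N: "0 < N" and bounded: "\<forall>k v b. K < length v \<longrightarrow> \<Lambda> k v b = 0"
    and squares: "\<forall>w. \<forall>a<d. \<forall>b<d. q w a b =
      (\<Sum>i\<le>length w. \<Sum>k<N. cnj (\<Lambda> k (rev (take i w)) a) * \<Lambda> k (drop i w) b)"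
    by (elim exE conjE) (rule that; assumption)
  interpret second_difference_squares "\<lambda>m a b. p m $$ (a, b)" \<Lambda> N K d
  proof
    show "\<Lambda> k v b = 0" if "K < length v" for k v b using bounded that by blast
  next
    fix w a b assume ab: "a < d" "b < d"
    then have "second_difference_factor (ycount w) * p (map collapse w) $$ (a, b) = q w a b"
      by (simp add: q_def)
    also have "\<dots> = (\<Sum>i\<le>length w. \<Sum>k<N. cnj (\<Lambda> k (rev (take i w)) a) * \<Lambda> k (drop i w) b)"
      using squares ab by blast
    finally show "second_difference_factor (ycount w) * p (map collapse w) $$ (a, b)
      = (\<Sum>i\<le>length w. \<Sum>k<N. cnj (\<Lambda> k (rev (take i w)) a) * \<Lambda> k (drop i w) b)" .
  qed
  have deg: "p m = 0\<^sub>m d d" if "3 \<le> xcount m" for m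
    using coeff_zero_if_xcount_ge_3[OF _ _ that] free_polysD(2,3)[OF p, of m] by (intro eq_matI) auto
  have "fp_xdegree p \<le> 2"
    unfolding fp_xdegree_def
  proof (intro Max.boundedI)
    show "finite (insert 0 (xcount ` fp_supp p))" using free_polysD(4)[OF p] by simp
  next
    fix x assume "x \<in> insert 0 (xcount ` fp_supp p)"
    then show "x \<le> 2" using deg by (force simp: fp_supp_def not_le)
  qed simp
  \<comment> \<open>The values of \<open>\<Lambda>\<close> on words whose only \<open>x\<close> is
    marked; \<open>sqrt 2\<close> compensates the factor 2 of the second difference.\<close>
  define R where "R = (\<lambda>v. mat N d (\<lambda>(k, b). if xcount v = 1 then \<Lambda> k (map to_y v) b / of_real (sqrt 2) else 0))"
  have R_supp: "fp_supp R \<subseteq> {v. length v \<le> K \<and> xcount v = 1}"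
  proof
    fix v assume v: "v \<in> fp_supp R"
    have "v \<notin> fp_supp R" if "\<not> (length v \<le> K \<and> xcount v = 1)"
    proof -
      have "R v = 0\<^sub>m N d" using that bounded by (intro eq_matI) (auto simp: R_def)
      then show ?thesis by (simp add: fp_supp_def)
    qed
    then show "v \<in> {v. length v \<le> K \<and> xcount v = 1}" using v by blast
  qed
  have R: "R \<in> free_polys N d"
  proof -
    have "finite {v :: 'm letter list. length v \<le> K \<and> xcount v = 1}"
      by (rule finite_subset[OF _ finite_words[of K]]) auto
    then have "finite (fp_supp R)" by (rule finite_subset[OF R_supp])
    moreover have "R v \<in> carrier_mat N d" for v by (simp add: R_def)
    ultimately show ?thesis by (simp add: free_polys_def)
  qed
  have lin: "linear_in_x R" using R_supp by (auto simp: linear_in_x_def)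
  note P = fp_mult_adjoint_free_polys(1)[OF R]
  define L where "L = (\<lambda>w. if xcount w \<le> 1 then p w else 0\<^sub>m d d)"
  have L: "L \<in> free_polys d d"
  proof -
    have "fp_supp L \<subseteq> fp_supp p" by (auto simp: fp_supp_def L_def split: if_splits)
    then show ?thesis using free_polysD(1,4)[OF p] by (auto simp: free_polys_def L_def intro: finite_subset)
  qed
  have "fp_adjoint L = L"
  proof
    fix w
    have "fp_adjoint L w \<in> carrier_mat d d" using free_polysD(1)[OF fp_adjoint_free_polys[OF L]] .
    moreover have "fp_adjoint L w $$ (a, b) = L w $$ (a, b)" if "a < d" "b < d" for a b
      using fp_adjoint_index[OF L that, of w] p_herm[OF that, of w] that by (simp add: L_def)
    ultimately show "fp_adjoint L w = L w" using free_polysD(1)[OF L, of w] by (intro eq_matI) auto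
  qed
  then have pencil: "L \<in> hermitian_pencils d"
    using L by (auto simp: hermitian_pencils_def fp_hermitian_def fp_supp_def L_def split: if_splits)
  have "p = fp_add L (fp_mult (fp_adjoint R) R)"
  proof
    fix w
    let ?P = "fp_mult (fp_adjoint R) R"
    have entry: "p w $$ (a, b) = L w $$ (a, b) + ?P w $$ (a, b)" if ab: "a < d" "b < d" for a b
    proof (cases "xcount w = 2")
      case True
      have "2 * ?P w $$ (a, b) = (\<Sum>i\<le>length w. \<Sum>k<N. 2 * (cnj (R (rev (take i w)) $$ (k, a)) * R (drop i w) $$ (k, b)))"
        by (simp add: fp_mult_adjoint_index[OF R ab] sum_distrib_left)
      also have "\<dots> = (\<Sum>i\<le>length w. \<Sum>k<N. cnj (\<Lambda> k (map to_y (rev (take i w))) a) * \<Lambda> k (map to_y (drop i w)) b)"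
      proof (intro sum.cong refl)
        fix i k assume "k \<in> {..<N}"
        then have k: "k < N" by simp
        have "xcount (take i w) + xcount (drop i w) = 2" using xcount_split[of i w] True by simp
        then consider "xcount (take i w) = 0" | "xcount (drop i w) = 0"
          | "xcount (take i w) = 1" "xcount (drop i w) = 1" by linarith
        then show "2 * (cnj (R (rev (take i w)) $$ (k, a)) * R (drop i w) $$ (k, b))
            = cnj (\<Lambda> k (map to_y (rev (take i w))) a) * \<Lambda> k (map to_y (drop i w)) b"
        proof cases
          case 1
          then have "\<Lambda> k (map to_y (rev (take i w))) a = 0"
            by (intro zero_if_ycount_0[OF ab(1) k]) (simp only: ycount_to_y xcount_simps)
          then show ?thesis using 1 k ab by (simp add: R_def)
        next
          case 2
          then have "\<Lambda> k (map to_y (drop i w)) b = 0"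
            by (intro zero_if_ycount_0[OF ab(2) k]) (simp only: ycount_to_y)
          then show ?thesis using 2 k ab by (simp add: R_def)
        next
          case 3
          have "complex_of_real (sqrt 2) * complex_of_real (sqrt 2) = 2"
            by (simp flip: of_real_mult)
          then show ?thesis using 3 k ab by (simp add: R_def)
        qed
      qed
      also have "\<dots> = 2 * p w $$ (a, b)" using coeff_if_xcount_2[OF ab True] by simp
      finally show ?thesis using True ab by (simp add: L_def)
    next
      case False
      have "?P w $$ (a, b) = 0"
        unfolding fp_mult_adjoint_index[OF R ab]
      proof (intro sum.neutral ballI)
        fix i k assume "k \<in> {..<N}"
        moreover have "xcount (take i w) \<noteq> 1 \<or> xcount (drop i w) \<noteq> 1" using xcount_split[of i w] False by linarith
        ultimately show "cnj (R (rev (take i w)) $$ (k, a)) * R (drop i w) $$ (k, b) = 0"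
          using ab by (auto simp: R_def)
      qed
      moreover have "p w $$ (a, b) = L w $$ (a, b)"
        using False deg[of w] by (cases "xcount w \<le> 1") (auto simp: L_def)
      ultimately show ?thesis by simp
    qed
    show "p w = fp_add L ?P w"
      using free_polysD(1)[OF p, of w] free_polysD(1)[OF L, of w] free_polysD(1)[OF P, of w]
      by (intro eq_matI) (auto simp: fp_add_def entry)
  qed
  with \<open>fp_xdegree p \<le> 2\<close> pencil N R lin show ?thesis by blast
qed

theorem theorem1p2:
  fixes p :: "'m::finite fpoly" and d :: nat
  assumes "p \<in> free_polys d d" and "fp_hermitian p"
  shows
    "(convex_in_x p \<longrightarrow>
        fp_xdegree p \<le> 2 \<and>
        (\<exists>L \<in> hermitian_pencils d. \<exists>N > 0. \<exists>\<Lambda> \<in> free_polys N d.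
           linear_in_x \<Lambda> \<and>
           p = fp_add L (fp_mult (fp_adjoint \<Lambda>) \<Lambda>) \<and>
           (\<forall>n > 0. \<forall>A \<in> herm_tuples n. \<forall>X \<in> herm_tuples n.
              fp_eval n p A X \<preceq> 0\<^sub>m (d * n) (d * n) \<longleftrightarrow>
              psd_mat (fp_eval n (fp_block (fp_one N) \<Lambda> (fp_adjoint \<Lambda>) (fp_uminus L)) A X)))) \<and>
     ((\<exists>L \<in> hermitian_pencils d. \<exists>N > 0. \<exists>\<Lambda> \<in> free_polys N d.
         linear_in_x \<Lambda> \<and> p = fp_add L (fp_mult (fp_adjoint \<Lambda>) \<Lambda>)) \<longrightarrow>
      convex_in_x p)"
proof (intro conjI impI)
  assume "convex_in_x p"
  note dec = convex_decomposition[OF assms this]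
  then show "fp_xdegree p \<le> 2" ..
  from dec obtain L N \<Lambda> where L: "L \<in> hermitian_pencils d" and N: "N > 0"
    and \<Lambda>: "\<Lambda> \<in> free_polys N d" "linear_in_x \<Lambda>"
    and p: "p = fp_add L (fp_mult (fp_adjoint \<Lambda>) \<Lambda>)" by blast
  have "L \<in> free_polys d d" using L by (simp add: hermitian_pencils_def)
  then have "\<forall>n > 0. \<forall>A \<in> herm_tuples n. \<forall>X \<in> herm_tuples n.
      fp_eval n p A X \<preceq> 0\<^sub>m (d * n) (d * n) \<longleftrightarrow>
      psd_mat (fp_eval n (fp_block (fp_one N) \<Lambda> (fp_adjoint \<Lambda>) (fp_uminus L)) A X)"
    unfolding p using nsd_iff_block_psd[OF _ \<Lambda>(1)] by blast
  with L N \<Lambda> p show "\<exists>L \<in> hermitian_pencils d. \<exists>N > 0. \<exists>\<Lambda> \<in> free_polys N d.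
      linear_in_x \<Lambda> \<and>
      p = fp_add L (fp_mult (fp_adjoint \<Lambda>) \<Lambda>) \<and>
      (\<forall>n > 0. \<forall>A \<in> herm_tuples n. \<forall>X \<in> herm_tuples n.
        fp_eval n p A X \<preceq> 0\<^sub>m (d * n) (d * n) \<longleftrightarrow>
        psd_mat (fp_eval n (fp_block (fp_one N) \<Lambda> (fp_adjoint \<Lambda>) (fp_uminus L)) A X))"
    by blast
next
  assume "\<exists>L \<in> hermitian_pencils d. \<exists>N > 0. \<exists>\<Lambda> \<in> free_polys N d.
      linear_in_x \<Lambda> \<and> p = fp_add L (fp_mult (fp_adjoint \<Lambda>) \<Lambda>)"
  then show "convex_in_x p"
    using square_plus_pencil_convex unfolding hermitian_pencils_def by blast
qed

end
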